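(* Let $(\mathcal A,\nabla,\sigma)$ be a differential structure with $\sigma=\mathbf 1$, with associated generator $\mathscr L$. Let $f\in C^2((0,\infty);\mathbb R)$ be strictly convex, let $\varphi\in C^1((0,\infty);\mathbb R)$ be strictly increasing, and let $\theta_j=\theta$ for all $j\in\mathcal J$, where $$\theta(\lambda,\mu)=\frac{\varphi(\lambda)-\varphi(\mu)}{f'(\lambda)-f'(\mu)}\ \text{ if }\lambda\ne\mu,\qquad \theta(\lambda,\lambda)=\frac{\varphi'(\lambda)}{f''(\lambda)} ;$$ assume that $\theta$ is well-defined, is $C^\infty$ and strictly positive on $(0,\infty)\times(0,\infty)$, and extends continuously to $[0,\infty)\times[0,\infty)$. Let $\mathscr K_\rho A=\sum_{j\in\mathcal J}\partial_j^\dagger(\widehat\rho_j\#\partial_jA)$ be the operator defined with this $\theta$, and let $\mathcal F(\rho)=\tau[f(\rho)]$ for $\rho\in\mathfrak P_+$. Then for all $\rho\in\mathfrak P_+$, $$\mathscr L\varphi(\rho)=\mathscr L^\dagger\varphi(\rho)=-\mathscr K_\rho\mathrm D\mathcal F(\rho).$$ Thus the gradient flow equation for $\mathcal F$ with respect to the Riemannian metric on $\mathscr M_{\mathbf 1}$ induced by $(\mathscr K_\rho)_{\rho\in\mathscr M_{\mathbf 1}}$ is $\partial_t\rho=\mathscr L\varphi(\rho)$.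
   Context: Differential structure $(\mathcal A,\nabla,\sigma)$: $\mathcal A$ is a finite-dimensional von Neumann algebra with faithful tracial positive linear functional $\tau$, together with (1) a finite index set $\mathcal J$ and, for each $j\in\mathcal J$, a finite-dimensional von Neumann algebra $\mathcal B_j$ with faithful tracial positive linear functional $\tau_j$; (2) for each $j$, unital $*$-homomorphisms $\ell_j,r_j:\mathcal A\to\mathcal B_j$ with $\tau_j(\ell_j(A))=\tau_j(r_j(A))=\tau(A)$ for all $A\in\mathcal A$, and a non-zero $V_j\in\mathcal B_j$; (3) for each $j$ there is a unique $j^*\in\mathcal J$ with $V_{j^*}=V_j^*$, and $\mathcal B_{j^*}=\mathcal B_j$, $\tau_{j^*}=\tau_j$; moreover $\tau_j[V_j^*\ell_j(A_1)V_jr_j(A_2)]=\tau_j[V_j^*r_{j^*}(A_1)V_j\ell_{j^*}(A_2)]$ for all $A_1,A_2\in\mathcal A$; (4) an invertible density matrix $\sigma\in\mathcal A$ and numbers $\omega_j\in\mathbb R$ with $\ell_j(\sigma)V_jr_j(\sigma)^{-1}=e^{-\omega_j}V_j$. Set $\partial_jA:=V_jr_j(A)-\ell_j(A)V_j\in\mathcal B_j$ and $\nabla A:=(\partial_jA)_{j\in\mathcal J}$. (If $\sigma=\mathbf 1$ then $\tau[\mathbf 1]=1$ and all $\omega_j=0$.) The associated generator $\mathscr L$ on $\mathcal A$ is defined by $\sum_{j}\tau_j[(\partial_jA_1)^*\ell_j(\sigma^{1/2})(\partial_jA_2)r_j(\sigma^{1/2})]=-\tau[A_1^*\sigma^{1/2}(\mathscr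 LA_2)\sigma^{1/2}]$ for all $A_1,A_2\in\mathcal A$. $\dagger$ denotes adjoints with respect to $\langle A,B\rangle=\tau[A^*B]$ on $\mathcal A$ and $\tau_j[A^*B]$ on $\mathcal B_j$. $\mathfrak P_+$ is the set of positive definite $\rho\in\mathcal A$ with $\tau[\rho]=1$; $f(\rho),\varphi(\rho)$ are defined by functional calculus. For $\rho=\sum_k\lambda_kE_k$ (spectral decomposition), $\widehat\rho_j:=\sum_{k,m}\theta_j(\lambda_k,\lambda_m)\,\ell_j(E_k)\otimes r_j(E_m)$, and $\#$ is the contraction $(A\otimes B)\#C:=ACB$ extended linearly. $\mathcal A_h$: self-adjoint elements; $\mathcal A_0:=\mathrm{Ran}(\mathscr L^\dagger)\cap\mathcal A_h$; $\mathscr M_{\mathbf 1}:=(\mathbf 1+\mathcal A_0)\cap\mathfrak P_+$, with tangent space $\mathcal A_0$ at each point. For $\rho\in\mathfrak P_+$, $\mathscr K_\rho$ restricts to a bijection of $\mathcal A_0$ and the induced Riemannian metric is $g_\rho(x,y)=\tau[(\mathscr K_\rho^{-1}x)\,y]$. The differential of $\mathcal F$ is $\mathrm D\mathcal F(\rho)=f'(\rho)$, and the gradient flow equation of $\mathcal F$ is $\partial_t\rho=-\mathscr K_\rho\mathrm D\mathcal F(\rho)$. *)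

theory Defs
  imports
    "HOL-Analysis.Analysis"
    "Jordan_Normal_Form.Schur_Decomposition"
    "Jordan_Normal_Form.Gauss_Jordan_Elimination"
begin

section \<open>Smoothness and convexity on the half-line and the quadrant\<close>

primrec Ck_on :: "nat \<Rightarrow> 'a::real_normed_vector set \<Rightarrow> ('a \<Rightarrow> real) \<Rightarrow> bool" where
  "Ck_on 0 U f \<longleftrightarrow> continuous_on U f"
| "Ck_on (Suc k) U f \<longleftrightarrow>
     (\<forall>x\<in>U. f differentiable (at x)) \<and> (\<forall>v. Ck_on k U (\<lambda>x. frechet_derivative f (at x) v))"

text \<open>Only meant for open \<open>U\<close>, since full derivatives \<open>at x\<close> are used.\<close>

definition Cinfinity_on :: "'a::real_normed_vector set \<Rightarrow> ('a \<Rightarrow> real) \<Rightarrow> bool" where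
  "Cinfinity_on U f \<longleftrightarrow> (\<forall>k. Ck_on k U f)"

definition strictly_convex_on :: "real set \<Rightarrow> (real \<Rightarrow> real) \<Rightarrow> bool" where
  "strictly_convex_on S f \<longleftrightarrow>
     (\<forall>x\<in>S. \<forall>y\<in>S. \<forall>t. x \<noteq> y \<and> 0 < t \<and> t < 1 \<longrightarrow>
        f ((1 - t) * x + t * y) < (1 - t) * f x + t * f y)"

definition theta :: "(real \<Rightarrow> real) \<Rightarrow> (real \<Rightarrow> real) \<Rightarrow> real \<Rightarrow> real \<Rightarrow> real" where
  "theta f \<phi> x y =
     (if x \<noteq> y then (\<phi> x - \<phi> y) / (deriv f x - deriv f y) else deriv \<phi> x / deriv (deriv f) x)"


section \<open>Matrices and functional calculus\<close>

text \<open>The type of matrices carries no fixed zero (dimensions vary), hence an explicit finite sum.\<close>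

definition msum :: "nat \<Rightarrow> ('i \<Rightarrow> complex mat) \<Rightarrow> 'i set \<Rightarrow> complex mat" where
  "msum n F S = Matrix.mat n n (\<lambda>(a, b). \<Sum>i\<in>S. F i $$ (a, b))"

definition spectral_values :: "complex mat \<Rightarrow> real set" where
  "spectral_values A = {x. eigenvalue A (complex_of_real x)}"

text \<open>The orthogonal projection onto the eigenspace. For self-adjoint \<open>A\<close> the spectral
  decomposition is \<open>A = (\<Sum>x \<in> spectral_values A. x E\<^sub>x)\<close> with \<open>E\<^sub>x = spectral_proj A x\<close>.\<close>

definition spectral_proj :: "complex mat \<Rightarrow> real \<Rightarrow> complex mat" where
  "spectral_proj A x = (THE P. P \<in> carrier_mat (dim_row A) (dim_row A) \<and> mat_adjoint P = P \<and>
     P * P = P \<and>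
     (\<forall>v \<in> carrier_vec (dim_row A).
        P *\<^sub>v v = v \<longleftrightarrow> A *\<^sub>v v = complex_of_real x \<cdot>\<^sub>v v))"

definition fun_calc :: "(real \<Rightarrow> real) \<Rightarrow> complex mat \<Rightarrow> complex mat" where
  "fun_calc f A = msum (dim_row A)
     (\<lambda>x. complex_of_real (f x) \<cdot>\<^sub>m spectral_proj A x) (spectral_values A)"

definition pos_def_mat :: "complex mat \<Rightarrow> bool" where
  "pos_def_mat A \<longleftrightarrow> mat_adjoint A = A \<and>
     (\<forall>v \<in> carrier_vec (dim_row A). v \<noteq> 0\<^sub>v (dim_row A) \<longrightarrow> Re ((A *\<^sub>v v) \<bullet>c v) > 0)"


section \<open>Finite-dimensional von Neumann algebras with a trace\<close>

text \<open>A finite-dimensional von Neumann algebra is represented as a unital *-subalgebra of the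
  \<open>n \<times> n\<close> matrices; weak closedness is automatic in finite dimension.\<close>

definition fd_von_Neumann_algebra :: "nat \<Rightarrow> complex mat set \<Rightarrow> bool" where
  "fd_von_Neumann_algebra n M \<longleftrightarrow>
     M \<subseteq> carrier_mat n n \<and> 1\<^sub>m n \<in> M \<and>
     (\<forall>A\<in>M. \<forall>B\<in>M. A + B \<in> M \<and> A * B \<in> M) \<and>
     (\<forall>A\<in>M. \<forall>c. c \<cdot>\<^sub>m A \<in> M) \<and>
     (\<forall>A\<in>M. mat_adjoint A \<in> M)"

record tracial_algebra =
  tdim :: nat
  ops :: "complex mat set"
  tr :: "complex mat \<Rightarrow> complex"

definition is_tracial_algebra :: "tracial_algebra \<Rightarrow> bool" where
  "is_tracial_algebra M \<longleftrightarrow>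
     fd_von_Neumann_algebra (tdim M) (ops M) \<and>
     (\<forall>A\<in>ops M. \<forall>B\<in>ops M. tr M (A + B) = tr M A + tr M B) \<and>
     (\<forall>A\<in>ops M. \<forall>c. tr M (c \<cdot>\<^sub>m A) = c * tr M A) \<and>
     (\<forall>A\<in>ops M. tr M (mat_adjoint A * A) \<in> \<real> \<and> Re (tr M (mat_adjoint A * A)) \<ge> 0) \<and>
     (\<forall>A\<in>ops M. tr M (mat_adjoint A * A) = 0 \<longrightarrow> A = 0\<^sub>m (tdim M) (tdim M)) \<and>
     (\<forall>A\<in>ops M. \<forall>B\<in>ops M. tr M (A * B) = tr M (B * A))"

definition unital_star_hom :: "tracial_algebra \<Rightarrow> tracial_algebra \<Rightarrow> (complex mat \<Rightarrow> complex mat) \<Rightarrow> bool"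
  where "unital_star_hom M N h \<longleftrightarrow>
     (\<forall>A\<in>ops M. h A \<in> ops N) \<and> h (1\<^sub>m (tdim M)) = 1\<^sub>m (tdim N) \<and>
     (\<forall>A\<in>ops M. \<forall>B\<in>ops M. h (A + B) = h A + h B \<and> h (A * B) = h A * h B) \<and>
     (\<forall>A\<in>ops M. \<forall>c. h (c \<cdot>\<^sub>m A) = c \<cdot>\<^sub>m h A) \<and>
     (\<forall>A\<in>ops M. h (mat_adjoint A) = mat_adjoint (h A))"

definition self_adjoint_ops :: "tracial_algebra \<Rightarrow> complex mat set" where
  "self_adjoint_ops M = {A \<in> ops M. mat_adjoint A = A}"

definition pos_states :: "tracial_algebra \<Rightarrow> complex mat set" where
  "pos_states M = {A \<in> ops M. pos_def_mat A \<and> tr M A = 1}"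

text \<open>Adjoint of \<open>T : M \<rightarrow> N\<close> with respect to \<open>\<langle>A, B\<rangle> = \<tau>[A\<^sup>* B]\<close>.\<close>

definition adj_op ::
  "tracial_algebra \<Rightarrow> tracial_algebra \<Rightarrow> (complex mat \<Rightarrow> complex mat) \<Rightarrow> complex mat \<Rightarrow> complex mat" where
  "adj_op M N T Y = (THE X. X \<in> ops M \<and>
     (\<forall>A\<in>ops M. tr N (mat_adjoint (T A) * Y) = tr M (mat_adjoint A * X)))"


section \<open>Differential structures\<close>

record 'j differential_structure =
  alg :: tracial_algebra
  idx :: "'j set"
  tgt :: "'j \<Rightarrow> tracial_algebra"
  lhom :: "'j \<Rightarrow> complex mat \<Rightarrow> complex mat"
  rhom :: "'j \<Rightarrow> complex mat \<Rightarrow> complex mat"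
  Vop :: "'j \<Rightarrow> complex mat"
  sigma :: "complex mat"
  omega :: "'j \<Rightarrow> real"

text \<open>As all algebras are concrete, \<open>V\<^sub>k = V\<^sub>j\<^sup>*\<close> is read as an identity between elements of
  the same algebra, i.e. together with \<open>B\<^sub>k = B\<^sub>j\<close>.\<close>

definition is_star_index :: "'j differential_structure \<Rightarrow> 'j \<Rightarrow> 'j \<Rightarrow> bool" where
  "is_star_index D j k \<longleftrightarrow> k \<in> idx D \<and>
     tdim (tgt D k) = tdim (tgt D j) \<and> ops (tgt D k) = ops (tgt D j) \<and>
     Vop D k = mat_adjoint (Vop D j)"

definition is_differential_structure :: "'j differential_structure \<Rightarrow> bool" where
  "is_differential_structure D \<longleftrightarrow>
     is_tracial_algebra (alg D) \<and>
     finite (idx D) \<and>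
     (\<forall>j\<in>idx D. is_tracial_algebra (tgt D j)) \<and>
     (\<forall>j\<in>idx D.
        unital_star_hom (alg D) (tgt D j) (lhom D j) \<and>
        unital_star_hom (alg D) (tgt D j) (rhom D j) \<and>
        (\<forall>A\<in>ops (alg D). tr (tgt D j) (lhom D j A) = tr (alg D) A \<and>
                           tr (tgt D j) (rhom D j A) = tr (alg D) A) \<and>
        Vop D j \<in> ops (tgt D j) \<and> Vop D j \<noteq> 0\<^sub>m (tdim (tgt D j)) (tdim (tgt D j))) \<and>
     (\<forall>j\<in>idx D. \<exists>!k. is_star_index D j k) \<and>
     (\<forall>j\<in>idx D. \<forall>k. is_star_index D j k \<longrightarrow>
        (\<forall>B\<in>ops (tgt D j). tr (tgt D k) B = tr (tgt D j) B) \<and>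
        (\<forall>A1\<in>ops (alg D). \<forall>A2\<in>ops (alg D).
           tr (tgt D j) (mat_adjoint (Vop D j) * lhom D j A1 * Vop D j * rhom D j A2) =
           tr (tgt D j) (mat_adjoint (Vop D j) * rhom D k A1 * Vop D j * lhom D k A2))) \<and>
     sigma D \<in> pos_states (alg D) \<and>
     (\<forall>j\<in>idx D. lhom D j (sigma D) * Vop D j * the (mat_inverse (rhom D j (sigma D))) =
        complex_of_real (exp (- omega D j)) \<cdot>\<^sub>m Vop D j)"

definition partial :: "'j differential_structure \<Rightarrow> 'j \<Rightarrow> complex mat \<Rightarrow> complex mat" where
  "partial D j A = Vop D j * rhom D j A - lhom D j A * Vop D j"

definition generator :: "'j differential_structure \<Rightarrow> complex mat \<Rightarrow> complex mat" where
  "generator D A2 = (THE X. X \<in> ops (alg D) \<and>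
     (\<forall>A1\<in>ops (alg D).
        (\<Sum>j\<in>idx D. tr (tgt D j)
           (mat_adjoint (partial D j A1) * lhom D j (fun_calc sqrt (sigma D)) *
            partial D j A2 * rhom D j (fun_calc sqrt (sigma D)))) =
        - tr (alg D) (mat_adjoint A1 * fun_calc sqrt (sigma D) * X * fun_calc sqrt (sigma D))))"

definition generator_adj :: "'j differential_structure \<Rightarrow> complex mat \<Rightarrow> complex mat" where
  "generator_adj D = adj_op (alg D) (alg D) (generator D)"

definition partial_adj :: "'j differential_structure \<Rightarrow> 'j \<Rightarrow> complex mat \<Rightarrow> complex mat" where
  "partial_adj D j = adj_op (alg D) (tgt D j) (partial D j)"

text \<open>The contraction of
  \<open>(\<Sum>k m. \<theta>\<^sub>j(\<lambda>\<^sub>k, \<lambda>\<^sub>m) \<ell>\<^sub>j(E\<^sub>k) \<otimes> r\<^sub>j(E\<^sub>m))\<close> against \<open>C\<close>, using \<open>(A \<otimes> B) # C = A C B\<close>.\<close>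

definition rho_hat_contract ::
  "'j differential_structure \<Rightarrow> ('j \<Rightarrow> real \<Rightarrow> real \<Rightarrow> real) \<Rightarrow> 'j \<Rightarrow> complex mat \<Rightarrow> complex mat \<Rightarrow> complex mat"
  where "rho_hat_contract D \<theta> j \<rho> C = msum (tdim (tgt D j))
     (\<lambda>(x, y). complex_of_real (\<theta> j x y) \<cdot>\<^sub>m
        (lhom D j (spectral_proj \<rho> x) * C * rhom D j (spectral_proj \<rho> y)))
     (spectral_values \<rho> \<times> spectral_values \<rho>)"

definition Kop ::
  "'j differential_structure \<Rightarrow> ('j \<Rightarrow> real \<Rightarrow> real \<Rightarrow> real) \<Rightarrow> complex mat \<Rightarrow> complex mat \<Rightarrow> complex mat" where
  "Kop D \<theta> \<rho> A = msum (tdim (alg D))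
     (\<lambda>j. partial_adj D j (rho_hat_contract D \<theta> j \<rho> (partial D j A))) (idx D)"


section \<open>Riemannian structure and gradient flows\<close>

definition tangent_space :: "'j differential_structure \<Rightarrow> complex mat set" where
  "tangent_space D = generator_adj D ` ops (alg D) \<inter> self_adjoint_ops (alg D)"

definition M_one :: "'j differential_structure \<Rightarrow> complex mat set" where
  "M_one D = {1\<^sub>m (tdim (alg D)) + X | X. X \<in> tangent_space D} \<inter> pos_states (alg D)"

text \<open>Traces of products of self-adjoint elements are real; they are kept as complex numbers.\<close>

definition riem_metric ::
  "'j differential_structure \<Rightarrow> ('j \<Rightarrow> real \<Rightarrow> real \<Rightarrow> real) \<Rightarrow> complex mat \<Rightarrow> complex mat \<Rightarrow> complex mat \<Rightarrow> complex"
  where "riem_metric D \<theta> \<rho> x y =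
     tr (alg D) (the_inv_into (tangent_space D) (Kop D \<theta> \<rho>) x * y)"

definition entropy_functional :: "'j differential_structure \<Rightarrow> (real \<Rightarrow> real) \<Rightarrow> complex mat \<Rightarrow> complex" where
  "entropy_functional D f \<rho> = tr (alg D) (fun_calc f \<rho>)"

text \<open>The self-adjoint element representing the derivative of \<open>F\<close> at \<open>\<rho>\<close>. All self-adjoint
  directions are used (not only those of trace zero), which fixes the additive multiple of the
  identity, so that the differential of \<open>\<rho> \<mapsto> \<tau>[f(\<rho>)]\<close> is \<open>f'(\<rho>)\<close>.\<close>

definition differential ::
  "'j differential_structure \<Rightarrow> (complex mat \<Rightarrow> complex) \<Rightarrow> complex mat \<Rightarrow> complex mat" where
  "differential D F \<rho> = (THE X. X \<in> self_adjoint_ops (alg D) \<and>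
     (\<forall>A\<in>self_adjoint_ops (alg D).
        ((\<lambda>t::real. F (\<rho> + complex_of_real t \<cdot>\<^sub>m A)) has_vector_derivative tr (alg D) (X * A)) (at 0)))"

definition riem_gradient ::
  "'j differential_structure \<Rightarrow> ('j \<Rightarrow> real \<Rightarrow> real \<Rightarrow> real) \<Rightarrow> (complex mat \<Rightarrow> complex) \<Rightarrow> complex mat \<Rightarrow> complex mat"
  where "riem_gradient D \<theta> F \<rho> = (THE G. G \<in> tangent_space D \<and>
     (\<forall>y\<in>tangent_space D. riem_metric D \<theta> \<rho> G y = tr (alg D) (differential D F \<rho> * y)))"

text \<open>The curve \<open>\<rho>\<close>, defined on the interval \<open>I\<close>, stays in \<open>M_one D\<close> and solves
  \<open>\<partial>\<^sub>t \<rho> = R(\<rho>)\<close>; the derivative is taken entrywise.\<close>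

definition solves_flow ::
  "'j differential_structure \<Rightarrow> (complex mat \<Rightarrow> complex mat) \<Rightarrow> real set \<Rightarrow> (real \<Rightarrow> complex mat) \<Rightarrow> bool" where
  "solves_flow D R I \<rho> \<longleftrightarrow> (\<forall>t\<in>I. \<rho> t \<in> M_one D \<and>
     (\<forall>a<tdim (alg D). \<forall>b<tdim (alg D).
        ((\<lambda>s. \<rho> s $$ (a, b)) has_vector_derivative R (\<rho> t) $$ (a, b)) (at t within I)))"

definition gradient_flow ::
  "'j differential_structure \<Rightarrow> ('j \<Rightarrow> real \<Rightarrow> real \<Rightarrow> real) \<Rightarrow> (complex mat \<Rightarrow> complex) \<Rightarrow> real set \<Rightarrow> (real \<Rightarrow> complex mat) \<Rightarrow> bool"
  where "gradient_flow D \<theta> F = solves_flow D (\<lambda>X. - riem_gradient D \<theta> F X)"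

end

theory Submission
  imports Defs
begin

text \<open>
  For \<open>\<sigma> = 1\<close> the generator is \<open>L = - \<Sum>\<^sub>j \<partial>\<^sub>j\<^sup>\<dagger> \<partial>\<^sub>j\<close>. The theorem rests on a chain rule for the derivations
  \<open>\<partial>\<^sub>j\<close>. Let \<open>E\<^sub>x\<close> be the spectral projections of \<open>\<rho>\<close>. The block \<open>\<ell>\<^sub>j(E\<^sub>x) (\<partial>\<^sub>j g(\<rho>)) r\<^sub>j(E\<^sub>y)\<close> equals
  \<open>(g(y) - g(x)) \<ell>\<^sub>j(E\<^sub>x) V\<^sub>j r\<^sub>j(E\<^sub>y)\<close>, and contraction with \<open>\<rho>\<close>-hat multiplies it by \<open>\<theta>(x, y)\<close>. As
  \<open>\<theta>(x, y) (f'(y) - f'(x)) = \<phi>(y) - \<phi>(x)\<close>, the contraction turns \<open>\<partial>\<^sub>j f'(\<rho>)\<close> into \<open>\<partial>\<^sub>j \<phi>(\<rho>)\<close>; applying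
  \<open>\<partial>\<^sub>j\<^sup>\<dagger>\<close> and summing over \<open>j\<close> gives \<open>K\<^sub>\<rho> f'(\<rho>) = - L \<phi>(\<rho>)\<close> (lemma \<open>chain_rule\<close>).

  The remaining work identifies the objects in the statement, which are given by definite
  descriptions. Adjoints exist by a Riesz representation for possibly degenerate forms on subspaces of
  matrices (lemma \<open>riesz\<close>). Spectral projections are polynomials in the element, hence belong to the
  algebra on which \<open>\<ell>\<^sub>j\<close> and \<open>r\<^sub>j\<close> are defined (lemma \<open>spectral_theorem\<close>). The differential of
  \<open>\<tau>(f(\<rho>))\<close> is \<open>f'(\<rho>)\<close> because the first-order remainder is a sum of the scalar remainders of
  \<open>f\<close> with the weights \<open>\<tau>(E\<^sub>x F\<^sub>y)\<close> formed from the spectral projections of two elements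
  (lemmas \<open>tr_taylor_remainder\<close> and \<open>tr_fun_calc_has_derivative\<close>).

  The Riemannian gradient is governed by the Dirichlet form \<open>\<langle>X, K\<^sub>\<rho> Y\<rangle>\<close>. It is positive
  semidefinite, its null space is the common kernel of all \<open>\<partial>\<^sub>j\<close> and so does not depend on \<open>\<rho>\<close>, and the
  symmetry between \<open>V\<^sub>j\<close> and \<open>V\<^sub>j\<^sup>*\<close> makes \<open>K\<^sub>\<rho>\<close> commute with the adjoint. Consequently each \<open>K\<^sub>\<rho>\<close> is a
  bijection of the self-adjoint elements orthogonal to that null space (lemmas \<open>K_inj_on\<close> and
  \<open>K_surj\<close>). The constant weight yields \<open>- L\<close>, so this space is the tangent space
  (lemma \<open>tangent_space_eq\<close>), and the gradient of the functional is \<open>K\<^sub>\<rho> f'(\<rho>)\<close>. The two flow equations then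
  have the same right-hand side at every point of the manifold.
\<close>

section \<open>Adjoints and finite sums of matrices\<close>

lemma mat_adjoint_carrier [simp]:
  "A \<in> carrier_mat n m \<Longrightarrow> mat_adjoint A \<in> carrier_mat m n"
  by (auto simp: mat_adjoint_def mat_of_rows_def)

lemma mat_adjoint_eq_mat:
  fixes A :: "complex mat"
  assumes "A \<in> carrier_mat n m"
  shows "mat_adjoint A = Matrix.mat m n (\<lambda>(i, j). cnj (A $$ (j, i)))"
  using assms by (intro eq_matI) (auto simp: mat_adjoint_def mat_of_rows_def conjugate_complex_def)

lemma mat_adjoint_mat_adjoint:
  fixes A :: "complex mat"
  assumes "A \<in> carrier_mat n m"
  shows "mat_adjoint (mat_adjoint A) = A"
  using assms
  by (subst mat_adjoint_eq_mat[of _ m n])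
    (auto simp: mat_adjoint_eq_mat[OF assms] intro!: eq_matI)

lemma mat_adjoint_add:
  fixes A B :: "complex mat"
  assumes "A \<in> carrier_mat n m" "B \<in> carrier_mat n m"
  shows "mat_adjoint (A + B) = mat_adjoint A + mat_adjoint B"
  using assms by (auto simp: mat_adjoint_eq_mat[of _ n m] intro!: eq_matI)

lemma mat_adjoint_smult:
  fixes A :: "complex mat"
  assumes "A \<in> carrier_mat n m"
  shows "mat_adjoint (c \<cdot>\<^sub>m A) = cnj c \<cdot>\<^sub>m mat_adjoint A"
  using assms by (auto simp: mat_adjoint_eq_mat[of _ n m] intro!: eq_matI)

lemma mat_adjoint_mult:
  fixes A B :: "complex mat"
  assumes "A \<in> carrier_mat n m" "B \<in> carrier_mat m l"
  shows "mat_adjoint (A * B) = mat_adjoint B * mat_adjoint A"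
proof -
  have "A * B \<in> carrier_mat n l" using assms by auto
  then show ?thesis
    using assms
    by (auto simp: mat_adjoint_eq_mat[OF \<open>A * B \<in> _\<close>] mat_adjoint_eq_mat[OF assms(1)]
        mat_adjoint_eq_mat[OF assms(2)] scalar_prod_def mult.commute intro!: eq_matI sum.cong)
qed

lemma mat_adjoint_one: "mat_adjoint (1\<^sub>m n) = (1\<^sub>m n :: complex mat)"
  by (auto simp: mat_adjoint_eq_mat[of _ n n] intro!: eq_matI)

lemma msum_carrier [simp]: "msum n F S \<in> carrier_mat n n"
  by (simp add: msum_def)

lemma index_msum: "a < n \<Longrightarrow> b < n \<Longrightarrow> msum n F S $$ (a, b) = (\<Sum>i\<in>S. F i $$ (a, b))"
  by (simp add: msum_def)

lemma msum_empty [simp]: "msum n F {} = 0\<^sub>m n n"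
  by (rule eq_matI) (auto simp: msum_def)

lemma msum_insert:
  assumes "finite S" "x \<notin> S" "F x \<in> carrier_mat n n"
  shows "msum n F (insert x S) = F x + msum n F S"
  using assms by (intro eq_matI) (auto simp: msum_def)

lemma msum_cong: "S = T \<Longrightarrow> (\<And>x. x \<in> T \<Longrightarrow> F x = G x) \<Longrightarrow> msum n F S = msum n G T"
  by (simp add: msum_def)

lemma msum_Times:
  "msum n (\<lambda>(x, y). F x y) (S \<times> T) = msum n (\<lambda>x. msum n (\<lambda>y. F x y) T) S"
  by (intro eq_matI) (auto simp: msum_def sum.cartesian_product split_def)

lemma msum_additive_image:
  assumes S: "finite S" and F: "\<And>x. x \<in> S \<Longrightarrow> F x \<in> M" and M: "M \<subseteq> carrier_mat n n"
    and zero: "0\<^sub>m n n \<in> M" and plus: "\<And>A B. A \<in> M \<Longrightarrow> B \<in> M \<Longrightarrow> A + B \<in> M"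
    and h0: "h (0\<^sub>m n n) = 0\<^sub>m m m"
    and hplus: "\<And>A B. A \<in> M \<Longrightarrow> B \<in> M \<Longrightarrow> h (A + B) = h A + h B"
    and hM: "\<And>A. A \<in> M \<Longrightarrow> h A \<in> carrier_mat m m"
  shows "msum n F S \<in> M \<and> h (msum n F S) = msum m (\<lambda>x. h (F x)) S"
  using S F
proof (induction S rule: finite_induct)
  case empty
  then show ?case by (simp add: zero h0)
next
  case (insert x S)
  then have IH: "msum n F S \<in> M" "h (msum n F S) = msum m (\<lambda>x. h (F x)) S" and Fx: "F x \<in> M" by auto
  have "msum n F (insert x S) = F x + msum n F S"
    using insert.hyps Fx M by (intro msum_insert) auto
  moreover have "msum m (\<lambda>x. h (F x)) (insert x S) = h (F x) + msum m (\<lambda>x. h (F x)) S"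
    using insert.hyps Fx hM by (intro msum_insert) auto
  ultimately show ?case using IH Fx plus hplus by auto
qed

section \<open>Tracial matrix algebras\<close>

locale tracial =
  fixes M :: tracial_algebra
  assumes tracial: "is_tracial_algebra M"
begin

abbreviation "\<A> \<equiv> ops M"
abbreviation "n \<equiv> tdim M"
abbreviation "\<tau> \<equiv> tr M"
abbreviation "\<I> \<equiv> 1\<^sub>m (tdim M) :: complex mat"
abbreviation "\<O> \<equiv> 0\<^sub>m (tdim M) (tdim M) :: complex mat"

lemma vN: "fd_von_Neumann_algebra n \<A>"
  using tracial by (simp add: is_tracial_algebra_def)

lemma sub_carrier: "\<A> \<subseteq> carrier_mat n n"
  using vN by (simp add: fd_von_Neumann_algebra_def)

lemma in_carrier [simp]: "A \<in> \<A> \<Longrightarrow> A \<in> carrier_mat n n"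
  using sub_carrier by auto

lemma one_in [simp]: "\<I> \<in> \<A>"
  and add_in [simp]: "A \<in> \<A> \<Longrightarrow> B \<in> \<A> \<Longrightarrow> A + B \<in> \<A>"
  and mult_in [simp]: "A \<in> \<A> \<Longrightarrow> B \<in> \<A> \<Longrightarrow> A * B \<in> \<A>"
  and smult_in [simp]: "A \<in> \<A> \<Longrightarrow> c \<cdot>\<^sub>m A \<in> \<A>"
  and adj_in [simp]: "A \<in> \<A> \<Longrightarrow> mat_adjoint A \<in> \<A>"
  using vN by (auto simp: fd_von_Neumann_algebra_def)

lemma uminus_eq: "A \<in> \<A> \<Longrightarrow> - A = (-1) \<cdot>\<^sub>m A"
  by (rule eq_matI) (auto dest!: in_carrier)

lemma minus_eq: "A \<in> \<A> \<Longrightarrow> B \<in> \<A> \<Longrightarrow> A - B = A + (-1) \<cdot>\<^sub>m B"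
  by (rule eq_matI) (auto dest!: in_carrier)

lemma zero_eq: "\<O> = 0 \<cdot>\<^sub>m \<I>"
  by (rule eq_matI) auto

lemma zero_in [simp]: "\<O> \<in> \<A>"
  by (subst zero_eq) simp

lemma uminus_in [simp]: "A \<in> \<A> \<Longrightarrow> - A \<in> \<A>"
  by (simp add: uminus_eq)

lemma minus_in [simp]: "A \<in> \<A> \<Longrightarrow> B \<in> \<A> \<Longrightarrow> A - B \<in> \<A>"
  by (simp add: minus_eq)

lemma tr_add: "A \<in> \<A> \<Longrightarrow> B \<in> \<A> \<Longrightarrow> \<tau> (A + B) = \<tau> A + \<tau> B"
  and tr_smult: "A \<in> \<A> \<Longrightarrow> \<tau> (c \<cdot>\<^sub>m A) = c * \<tau> A"
  and tr_real: "A \<in> \<A> \<Longrightarrow> \<tau> (mat_adjoint A * A) \<in> \<real>"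
  and tr_nonneg: "A \<in> \<A> \<Longrightarrow> 0 \<le> Re (\<tau> (mat_adjoint A * A))"
  and tr_faithful: "A \<in> \<A> \<Longrightarrow> \<tau> (mat_adjoint A * A) = 0 \<Longrightarrow> A = \<O>"
  and tr_comm: "A \<in> \<A> \<Longrightarrow> B \<in> \<A> \<Longrightarrow> \<tau> (A * B) = \<tau> (B * A)"
  using tracial unfolding is_tracial_algebra_def by blast+

lemma tr_zero [simp]: "\<tau> \<O> = 0"
  by (subst zero_eq) (simp add: tr_smult)

lemma tr_minus: "A \<in> \<A> \<Longrightarrow> B \<in> \<A> \<Longrightarrow> \<tau> (A - B) = \<tau> A - \<tau> B"
  by (simp add: minus_eq tr_add tr_smult)

lemma mult_assoc: "A \<in> \<A> \<Longrightarrow> B \<in> \<A> \<Longrightarrow> C \<in> \<A> \<Longrightarrow> A * B * C = A * (B * C)"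
  by (rule assoc_mult_mat[of _ n n _ n _ n]) auto

lemma distribs:
  assumes "A \<in> \<A>" "B \<in> \<A>" "C \<in> \<A>"
  shows "(A + B) * C = A * C + B * C" and "A * (B + C) = A * B + A * C"
    and "(A - B) * C = A * C - B * C" and "A * (B - C) = A * B - A * C"
  using add_mult_distrib_mat[OF in_carrier in_carrier in_carrier] mult_add_distrib_mat[OF in_carrier in_carrier in_carrier]
    minus_mult_distrib_mat[OF in_carrier in_carrier in_carrier] mult_minus_distrib_mat[OF in_carrier in_carrier in_carrier] assms
  by blast+

lemma smult_mult:
  assumes "A \<in> \<A>" "B \<in> \<A>"
  shows "(c \<cdot>\<^sub>m A) * B = c \<cdot>\<^sub>m (A * B)" and "A * (c \<cdot>\<^sub>m B) = c \<cdot>\<^sub>m (A * B)"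
  using mult_smult_assoc_mat[OF in_carrier in_carrier] mult_smult_distrib[OF in_carrier in_carrier] assms by blast+

lemma smult_smult: "c \<cdot>\<^sub>m (d \<cdot>\<^sub>m A) = (c * d) \<cdot>\<^sub>m (A :: complex mat)"
  by (rule eq_matI) auto

lemma units [simp]:
  assumes "A \<in> \<A>"
  shows "\<I> * A = A" "A * \<I> = A" "\<O> * A = \<O>" "A * \<O> = \<O>" "A + \<O> = A" "\<O> + A = A" "A - \<O> = A"
    "A - A = \<O>"
  using in_carrier[OF assms] by auto

lemma smult_zero [simp]: "c \<cdot>\<^sub>m \<O> = \<O>"
  by (rule eq_matI) auto

lemma zero_smult [simp]: "A \<in> \<A> \<Longrightarrow> 0 \<cdot>\<^sub>m A = \<O>"
  by (rule eq_matI) (auto dest!: in_carrier)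

lemma adj_add: "A \<in> \<A> \<Longrightarrow> B \<in> \<A> \<Longrightarrow> mat_adjoint (A + B) = mat_adjoint A + mat_adjoint B"
  by (rule mat_adjoint_add[of _ n n]) auto

lemma adj_mult: "A \<in> \<A> \<Longrightarrow> B \<in> \<A> \<Longrightarrow> mat_adjoint (A * B) = mat_adjoint B * mat_adjoint A"
  by (rule mat_adjoint_mult[of _ n n _ n]) auto

lemma adj_smult: "A \<in> \<A> \<Longrightarrow> mat_adjoint (c \<cdot>\<^sub>m A) = cnj c \<cdot>\<^sub>m mat_adjoint A"
  by (rule mat_adjoint_smult[of _ n n]) auto

lemma adj_adj [simp]: "A \<in> \<A> \<Longrightarrow> mat_adjoint (mat_adjoint A) = A"
  by (rule mat_adjoint_mat_adjoint[of _ n n]) auto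

lemma adj_one [simp]: "mat_adjoint \<I> = \<I>"
  by (rule mat_adjoint_one)

lemma adj_minus: "A \<in> \<A> \<Longrightarrow> B \<in> \<A> \<Longrightarrow> mat_adjoint (A - B) = mat_adjoint A - mat_adjoint B"
  by (simp add: minus_eq adj_smult adj_add)

lemma adj_zero [simp]: "mat_adjoint \<O> = \<O>"
  using adj_smult[of \<I> 0] by (simp add: zero_eq[symmetric])

lemmas adj_simps = adj_add adj_mult adj_smult adj_minus
lemmas tr_simps = tr_add tr_smult tr_minus

text \<open>Positivity only constrains \<open>\<tau>(A\<^sup>* A)\<close>. Polarization against the unit recovers the real and
  the imaginary part: \<open>\<tau>((A + 1)\<^sup>* (A + 1))\<close> and \<open>\<tau>((A + \<i>)\<^sup>* (A + \<i>))\<close> are both real.\<close>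

lemma tr_adj:
  assumes A: "A \<in> \<A>"
  shows "\<tau> (mat_adjoint A) = cnj (\<tau> A)"
proof -
  have 1: "\<tau> (mat_adjoint A) + \<tau> A \<in> \<real>"
  proof -
    have "mat_adjoint (A + \<I>) * (A + \<I>) = mat_adjoint A * A + A + (mat_adjoint A + \<I>)"
      using A by (simp add: adj_simps distribs)
    then have "\<tau> (mat_adjoint (A + \<I>) * (A + \<I>)) =
        \<tau> (mat_adjoint A * A) + \<tau> (mat_adjoint \<I> * \<I>) + (\<tau> (mat_adjoint A) + \<tau> A)"
      using A by (simp add: tr_add)
    then have "\<tau> (mat_adjoint A) + \<tau> A =
        \<tau> (mat_adjoint (A + \<I>) * (A + \<I>)) - \<tau> (mat_adjoint A * A) - \<tau> (mat_adjoint \<I> * \<I>)"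
      by simp
    then show ?thesis
      by (metis A Reals_diff add_in one_in tr_real)
  qed
  have 2: "\<i> * \<tau> (mat_adjoint A) - \<i> * \<tau> A \<in> \<real>"
  proof -
    have "mat_adjoint (A + \<i> \<cdot>\<^sub>m \<I>) * (A + \<i> \<cdot>\<^sub>m \<I>) =
        mat_adjoint A * A + (- \<i>) \<cdot>\<^sub>m A + \<i> \<cdot>\<^sub>m (mat_adjoint A + (- \<i>) \<cdot>\<^sub>m \<I>)"
      using A by (simp add: adj_simps distribs smult_mult)
    then have "\<tau> (mat_adjoint (A + \<i> \<cdot>\<^sub>m \<I>) * (A + \<i> \<cdot>\<^sub>m \<I>)) =
        \<tau> (mat_adjoint A * A) + \<tau> (mat_adjoint \<I> * \<I>) + (\<i> * \<tau> (mat_adjoint A) - \<i> * \<tau> A)"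
      using A by (simp add: tr_add tr_smult algebra_simps)
    then have "\<i> * \<tau> (mat_adjoint A) - \<i> * \<tau> A =
        \<tau> (mat_adjoint (A + \<i> \<cdot>\<^sub>m \<I>) * (A + \<i> \<cdot>\<^sub>m \<I>)) - \<tau> (mat_adjoint A * A) - \<tau> (mat_adjoint \<I> * \<I>)"
      by simp
    then show ?thesis
      by (metis A Reals_diff add_in smult_in one_in tr_real)
  qed
  from 1 2 show ?thesis
    by (auto simp: complex_is_Real_iff complex_eq_iff)
qed

lemma inner_commute:
  assumes "A \<in> \<A>" "B \<in> \<A>"
  shows "\<tau> (mat_adjoint A * B) = cnj (\<tau> (mat_adjoint B * A))"
  using tr_adj[of "mat_adjoint B * A"] assms by (simp add: adj_simps)

lemma diff_zero_eq:
  assumes "A \<in> \<A>" "B \<in> \<A>" "A - B = \<O>"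
  shows "A = B"
proof (rule eq_matI)
  fix i j assume ij: "i < dim_row B" "j < dim_col B"
  have "(A - B) $$ (i, j) = 0" using ij carrier_matD[OF in_carrier[OF assms(2)]] by (simp add: assms(3))
  then show "A $$ (i, j) = B $$ (i, j)" using ij by simp
qed (use carrier_matD[OF in_carrier[OF assms(1)]] carrier_matD[OF in_carrier[OF assms(2)]] in simp_all)

lemma inner_ext:
  assumes "X \<in> \<A>" "Y \<in> \<A>" "\<And>A. A \<in> \<A> \<Longrightarrow> \<tau> (mat_adjoint A * X) = \<tau> (mat_adjoint A * Y)"
  shows "X = Y"
proof -
  have "\<tau> (mat_adjoint (X - Y) * (X - Y)) = 0"
    using assms(1,2) assms(3)[of "X - Y"] by (simp add: distribs tr_simps)
  then have "X - Y = \<O>" using assms(1,2) by (intro tr_faithful) simp_all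
  then show ?thesis by (rule diff_zero_eq[OF assms(1,2)])
qed

lemma msum_image:
  assumes "finite S" "\<And>x. x \<in> S \<Longrightarrow> F x \<in> \<A>"
    and "\<And>A B. A \<in> \<A> \<Longrightarrow> B \<in> \<A> \<Longrightarrow> h (A + B) = h A + h B" "h \<O> = 0\<^sub>m m m"
    and "\<And>A. A \<in> \<A> \<Longrightarrow> h A \<in> carrier_mat m m"
  shows "h (msum n F S) = msum m (\<lambda>x. h (F x)) S"
  using msum_additive_image[of S F \<A> n h m] assms sub_carrier by auto

lemma msum_in [simp]:
  assumes "finite S" "\<And>x. x \<in> S \<Longrightarrow> F x \<in> \<A>"
  shows "msum n F S \<in> \<A>"
  using msum_additive_image[of S F \<A> n "\<lambda>A. A" n] assms sub_carrier by auto

lemma msum_mult: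
  assumes "finite S" "\<And>x. x \<in> S \<Longrightarrow> F x \<in> \<A>" "B \<in> \<A>"
  shows "msum n F S * B = msum n (\<lambda>x. F x * B) S" "B * msum n F S = msum n (\<lambda>x. B * F x) S"
  using assms by (auto intro!: msum_image[where h = "\<lambda>A. A * B"] msum_image[where h = "\<lambda>A. B * A"] simp: distribs)

lemma adj_msum:
  assumes "finite S" "\<And>x. x \<in> S \<Longrightarrow> F x \<in> \<A>"
  shows "mat_adjoint (msum n F S) = msum n (\<lambda>x. mat_adjoint (F x)) S"
  using assms by (auto intro!: msum_image simp: adj_simps)

lemma tr_msum:
  assumes "finite S" "\<And>x. x \<in> S \<Longrightarrow> F x \<in> \<A>"
  shows "\<tau> (msum n F S) = (\<Sum>x\<in>S. \<tau> (F x))"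
  using assms by (induction S rule: finite_induct) (auto simp: msum_insert tr_add)

section \<open>Riesz representation\<close>

text \<open>Induction on a finite set of matrix entries that separates the points of \<open>V\<close>: requiring one
  more entry to vanish lowers the dimension by at most one, so a single vector orthogonal to the
  smaller subspace is all that has to be added, and no basis is ever chosen. The form may be
  degenerate, provided that the functional kills its null vectors; Dirichlet forms are of this kind.\<close>

lemma riesz_on_subspace:
  fixes b :: "complex mat \<Rightarrow> complex mat \<Rightarrow> complex"
  assumes "finite S" "S \<subseteq> {..<n} \<times> {..<n}"
    and "V \<subseteq> \<A>" "\<O> \<in> V"
    and "\<And>A B. A \<in> V \<Longrightarrow> B \<in> V \<Longrightarrow> A + B \<in> V" "\<And>A c. A \<in> V \<Longrightarrow> c \<cdot>\<^sub>m A \<in> V"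
    and "\<And>A. A \<in> V \<Longrightarrow> (\<And>p. p \<in> S \<Longrightarrow> A $$ p = 0) \<Longrightarrow> A = \<O>"
    and "\<And>A B C. A \<in> V \<Longrightarrow> B \<in> V \<Longrightarrow> C \<in> V \<Longrightarrow> b A (B + C) = b A B + b A C"
    and "\<And>A B c. A \<in> V \<Longrightarrow> B \<in> V \<Longrightarrow> b A (c \<cdot>\<^sub>m B) = c * b A B"
    and "\<And>A B. A \<in> V \<Longrightarrow> B \<in> V \<Longrightarrow> b A B = cnj (b B A)"
    and "\<And>A B. A \<in> V \<Longrightarrow> B \<in> V \<Longrightarrow> b A A = 0 \<Longrightarrow> b A B = 0"
    and "\<And>A B. A \<in> V \<Longrightarrow> B \<in> V \<Longrightarrow> L (A + B) = L A + L B"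
    and "\<And>A c. A \<in> V \<Longrightarrow> L (c \<cdot>\<^sub>m A) = c * L A"
    and "\<And>A. A \<in> V \<Longrightarrow> b A A = 0 \<Longrightarrow> L A = 0"
  shows "\<exists>X\<in>V. \<forall>A\<in>V. L A = b X A"
  using assms
proof (induction S arbitrary: V L rule: finite_induct)
  case empty
  note V = empty.prems
  have V0: "A = \<O>" if "A \<in> V" for A using V(6)[OF that] by simp
  have "b \<O> \<O> = 0" using V(8)[of \<O> \<O> 0] V(3) by simp
  moreover from this have "L \<O> = 0" using V(13)[of \<O>] V(3) by simp
  ultimately show ?case using V0 V(3) by metis
next
  case (insert s S V L)
  note V = insert.prems
  have badd: "b (A + B) C = b A C + b B C" if "A \<in> V" "B \<in> V" "C \<in> V" for A B C
    using that V(4)[of A B] V(7)[of C A B] V(9)[of "A + B" C] V(9)[of A C] V(9)[of B C] by simp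
  have bsm: "b (c \<cdot>\<^sub>m A) C = cnj c * b A C" if "A \<in> V" "C \<in> V" for A C c
    using that V(5)[of A c] V(8)[of C A c] V(9)[of "c \<cdot>\<^sub>m A" C] V(9)[of A C] by simp
  define W where "W = {A \<in> V. A $$ s = 0}"
  obtain s1 s2 where s: "s = (s1, s2)" "s1 < n" "s2 < n" using V(1) by (cases s) auto
  have ent: "(A + B) $$ s = A $$ s + B $$ s" "(c \<cdot>\<^sub>m A) $$ s = c * A $$ s"
    if "A \<in> V" "B \<in> V" for A B c
    using in_carrier[OF subsetD[OF V(2) that(1)]] in_carrier[OF subsetD[OF V(2) that(2)]] s by auto
  have WV: "W \<subseteq> V" by (auto simp: W_def)
  have "\<exists>X\<in>W. \<forall>A\<in>W. L' A = b X A"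
    if L': "\<And>A B. A \<in> W \<Longrightarrow> B \<in> W \<Longrightarrow> L' (A + B) = L' A + L' B"
      "\<And>A c. A \<in> W \<Longrightarrow> L' (c \<cdot>\<^sub>m A) = c * L' A"
      "\<And>A. A \<in> W \<Longrightarrow> b A A = 0 \<Longrightarrow> L' A = 0" for L'
  proof (rule insert.IH[of W L'])
    show "S \<subseteq> {..<n} \<times> {..<n}" "W \<subseteq> \<A>" using V(1,2) WV by auto
    show "\<O> \<in> W" using V(3) s by (simp add: W_def)
    show "\<And>A B. A \<in> W \<Longrightarrow> B \<in> W \<Longrightarrow> A + B \<in> W" using V(4) ent by (auto simp: W_def)
    show "\<And>A c. A \<in> W \<Longrightarrow> c \<cdot>\<^sub>m A \<in> W" using V(5) ent by (auto simp: W_def)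
    show "A = \<O>" if "A \<in> W" "\<And>p. p \<in> S \<Longrightarrow> A $$ p = 0" for A
    proof (rule V(6))
      show "A \<in> V" using that(1) by (simp add: W_def)
      fix p assume "p \<in> insert s S"
      then show "A $$ p = 0" using that by (cases "p = s") (simp_all add: W_def)
    qed
    show "b A (B + C) = b A B + b A C" if "A \<in> W" "B \<in> W" "C \<in> W" for A B C
      using that by (intro V(7) subsetD[OF WV])
    show "b A (c \<cdot>\<^sub>m B) = c * b A B" if "A \<in> W" "B \<in> W" for A B c
      using that by (intro V(8) subsetD[OF WV])
    show "b A B = cnj (b B A)" if "A \<in> W" "B \<in> W" for A B
      using that by (intro V(9) subsetD[OF WV])
    show "b A B = 0" if "A \<in> W" "B \<in> W" "b A A = 0" for A B
      using that(1,2) by (intro V(10)[OF _ _ that(3)] subsetD[OF WV])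
  qed (fact L')+
  note IH = this
  show ?case
  proof (cases "W = V")
    case True
    show ?thesis
      using IH[of L, unfolded True, OF V(11-13)] .
  next
    case False
    then obtain w0 where w0: "w0 \<in> V" "w0 $$ s \<noteq> 0" by (auto simp: W_def)
    \<comment> \<open>Removing from \<open>w\<close> its \<open>b\<close>-projection to \<open>W\<close> yields the direction \<open>u\<close> that \<open>W\<close> misses.\<close>
    define w where "w = (1 / w0 $$ s) \<cdot>\<^sub>m w0"
    have w: "w \<in> V" "w $$ s = 1" using w0 V(5) ent by (auto simp: w_def)
    have "\<exists>p\<in>W. \<forall>A\<in>W. b w A = b p A"
    proof (rule IH)
      show "b w A = 0" if "A \<in> W" "b A A = 0" for A
        using V(9)[of w A] V(10)[of A w] that WV w by auto
      show "b w (A + B) = b w A + b w B" if "A \<in> W" "B \<in> W" for A B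
        using V(7)[OF w(1) subsetD[OF WV] subsetD[OF WV]] that by blast
      show "b w (c \<cdot>\<^sub>m A) = c * b w A" if "A \<in> W" for A c
        using V(8)[OF w(1) subsetD[OF WV]] that by blast
    qed
    then obtain p where p: "p \<in> W" "\<And>A. A \<in> W \<Longrightarrow> b w A = b p A" by blast
    define u where "u = w + (-1) \<cdot>\<^sub>m p"
    have pV: "p \<in> V" "(-1) \<cdot>\<^sub>m p \<in> V" and ps: "p $$ s = 0" using p V(5) by (auto simp: W_def)
    have u: "u \<in> V" "u $$ s = 1"
      using w pV ps V(4) ent by (auto simp: u_def)
    have uW: "b u A = 0" if "A \<in> W" for A
      using p(2)[OF that] that WV w pV badd[of w "(-1) \<cdot>\<^sub>m p" A] bsm[of p A "-1"] by (auto simp: u_def)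
    have "\<exists>X\<in>W. \<forall>A\<in>W. L A = b X A"
    proof (rule IH)
      show "L (A + B) = L A + L B" if "A \<in> W" "B \<in> W" for A B
        using that by (intro V(11) subsetD[OF WV])
      show "L (c \<cdot>\<^sub>m A) = c * L A" if "A \<in> W" for A c
        using that by (intro V(12) subsetD[OF WV])
      show "L A = 0" if "A \<in> W" "b A A = 0" for A
        using that(1) by (intro V(13)[OF _ that(2)] subsetD[OF WV])
    qed
    then obtain x where x: "x \<in> W" "\<And>A. A \<in> W \<Longrightarrow> L A = b x A" by blast
    have xu: "b x u = 0" using V(9)[of x u] uW[OF x(1)] x(1) WV u by auto
    \<comment> \<open>If \<open>u\<close> is a null vector then \<open>c = 0\<close>, which is the right value because \<open>L u = 0\<close> as well.\<close>
    define c where "c = L u / b u u"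
    have c: "c * b u u = L u" using V(13)[OF u(1)] by (auto simp: c_def)
    have cu: "cnj c \<cdot>\<^sub>m u \<in> V" using u V(5) by auto
    show ?thesis
    proof (intro bexI ballI)
      show "x + cnj c \<cdot>\<^sub>m u \<in> V" using x WV cu V(4) by auto
      fix A assume A: "A \<in> V"
      define a where "a = A $$ s"
      define v where "v = A + (- a) \<cdot>\<^sub>m u"
      have au: "(- a) \<cdot>\<^sub>m u \<in> V" "a \<cdot>\<^sub>m u \<in> V" using u V(5) by auto
      have v: "v \<in> W" using A au ent V(4) u unfolding W_def v_def a_def by auto
      have Av: "A = v + a \<cdot>\<^sub>m u"
        unfolding v_def using in_carrier[OF subsetD[OF V(2) A]] in_carrier[OF subsetD[OF V(2) u(1)]]
        by (intro eq_matI) auto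
      have vV: "v \<in> V" using v WV by auto
      have xV: "x \<in> V" using x WV by auto
      have "L A = L v + a * L u" unfolding Av using V(11)[OF vV au(2)] V(12)[OF u(1)] by simp
      moreover have "b (x + cnj c \<cdot>\<^sub>m u) A = b x A + c * b u A"
        using badd[OF xV cu A] bsm[OF u(1) A] by simp
      moreover have "b x A = b x v"
        using V(7)[OF xV vV au(2)] V(8)[OF xV u(1)] xu Av by simp
      moreover have "b u A = a * b u u"
        using V(7)[OF u(1) vV au(2)] V(8)[OF u(1) u(1)] uW[OF v] Av by simp
      ultimately show "L A = b (x + cnj c \<cdot>\<^sub>m u) A" using x(2)[OF v] c by (simp add: algebra_simps)
    qed
  qed
qed

lemma riesz:
  fixes b :: "complex mat \<Rightarrow> complex mat \<Rightarrow> complex"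
  assumes "V \<subseteq> \<A>" "\<O> \<in> V"
    and "\<And>A B. A \<in> V \<Longrightarrow> B \<in> V \<Longrightarrow> A + B \<in> V" "\<And>A c. A \<in> V \<Longrightarrow> c \<cdot>\<^sub>m A \<in> V"
    and "\<And>A B C. A \<in> V \<Longrightarrow> B \<in> V \<Longrightarrow> C \<in> V \<Longrightarrow> b A (B + C) = b A B + b A C"
    and "\<And>A B c. A \<in> V \<Longrightarrow> B \<in> V \<Longrightarrow> b A (c \<cdot>\<^sub>m B) = c * b A B"
    and "\<And>A B. A \<in> V \<Longrightarrow> B \<in> V \<Longrightarrow> b A B = cnj (b B A)"
    and "\<And>A B. A \<in> V \<Longrightarrow> B \<in> V \<Longrightarrow> b A A = 0 \<Longrightarrow> b A B = 0"
    and "\<And>A B. A \<in> V \<Longrightarrow> B \<in> V \<Longrightarrow> L (A + B) = L A + L B"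
    and "\<And>A c. A \<in> V \<Longrightarrow> L (c \<cdot>\<^sub>m A) = c * L A"
    and "\<And>A. A \<in> V \<Longrightarrow> b A A = 0 \<Longrightarrow> L A = 0"
  shows "\<exists>X\<in>V. \<forall>A\<in>V. L A = b X A"
proof (rule riesz_on_subspace[of "{..<n} \<times> {..<n}"])
  show "A = \<O>" if "A \<in> V" "\<And>p. p \<in> {..<n} \<times> {..<n} \<Longrightarrow> A $$ p = 0" for A
    using that(2) in_carrier[OF subsetD[OF assms(1) that(1)]] by (intro eq_matI) auto
  show "finite ({..<n} \<times> {..<n})" "{..<n} \<times> {..<n} \<subseteq> {..<n} \<times> {..<n}" by auto
qed (fact assms)+

lemma riesz_tr:
  assumes "V \<subseteq> \<A>" "\<O> \<in> V"
    and "\<And>A B. A \<in> V \<Longrightarrow> B \<in> V \<Longrightarrow> A + B \<in> V" "\<And>A c. A \<in> V \<Longrightarrow> c \<cdot>\<^sub>m A \<in> V"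
    and "\<And>A B. A \<in> V \<Longrightarrow> B \<in> V \<Longrightarrow> L (A + B) = L A + L B"
    and "\<And>A c. A \<in> V \<Longrightarrow> L (c \<cdot>\<^sub>m A) = c * L A"
  shows "\<exists>X\<in>V. \<forall>A\<in>V. L A = \<tau> (mat_adjoint X * A)"
proof (rule riesz[where b = "\<lambda>X A. \<tau> (mat_adjoint X * A)"])
  have V: "A \<in> \<A>" if "A \<in> V" for A using that assms(1) by auto
  show "\<tau> (mat_adjoint A * (B + C)) = \<tau> (mat_adjoint A * B) + \<tau> (mat_adjoint A * C)"
    if "A \<in> V" "B \<in> V" "C \<in> V" for A B C
    using that by (simp add: V distribs tr_simps)
  show "\<tau> (mat_adjoint A * (c \<cdot>\<^sub>m B)) = c * \<tau> (mat_adjoint A * B)"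
    if "A \<in> V" "B \<in> V" for A B c
    using that by (simp add: V smult_mult tr_simps)
  show "\<tau> (mat_adjoint A * B) = cnj (\<tau> (mat_adjoint B * A))" if "A \<in> V" "B \<in> V" for A B
    using that by (intro inner_commute) (simp_all add: V)
  show "\<tau> (mat_adjoint A * B) = 0" if "A \<in> V" "B \<in> V" "\<tau> (mat_adjoint A * A) = 0" for A B
    using tr_faithful[OF V[OF that(1)] that(3)] V[OF that(2)] by simp
  have L0: "L \<O> = 0" using assms(6)[of \<O> 0] assms(2) by simp
  show "L A = 0" if "A \<in> V" "\<tau> (mat_adjoint A * A) = 0" for A
    using tr_faithful[OF V[OF that(1)] that(2)] L0 by simp
qed (fact assms)+

end

text \<open>The definite description in \<open>adj_op\<close> denotes: the Riesz representation gives existence and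
  faithfulness of the trace gives uniqueness.\<close>

lemma adj_op_props:
  assumes M: "is_tracial_algebra M" and N: "is_tracial_algebra N"
    and T: "\<And>A. A \<in> ops M \<Longrightarrow> T A \<in> ops N"
    "\<And>A B. A \<in> ops M \<Longrightarrow> B \<in> ops M \<Longrightarrow> T (A + B) = T A + T B"
    "\<And>A c. A \<in> ops M \<Longrightarrow> T (c \<cdot>\<^sub>m A) = c \<cdot>\<^sub>m T A"
    and Y: "Y \<in> ops N"
  shows "adj_op M N T Y \<in> ops M"
    "\<And>A. A \<in> ops M \<Longrightarrow> tr N (mat_adjoint (T A) * Y) = tr M (mat_adjoint A * adj_op M N T Y)"
proof -
  interpret M: tracial M by standard (rule M)
  interpret N: tracial N by standard (rule N)
  have "\<exists>X\<in>ops M. \<forall>A\<in>ops M. tr N (mat_adjoint Y * T A) = tr M (mat_adjoint X * A)"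
    by (rule M.riesz_tr) (use T Y in \<open>auto simp: N.distribs N.tr_simps N.smult_mult\<close>)
  then obtain X where X: "X \<in> ops M" "\<And>A. A \<in> ops M \<Longrightarrow> tr N (mat_adjoint Y * T A) = tr M (mat_adjoint X * A)"
    by blast
  have X': "tr N (mat_adjoint (T A) * Y) = tr M (mat_adjoint A * X)" if "A \<in> ops M" for A
    using X(2)[OF that] N.inner_commute[OF T(1)[OF that] Y] M.inner_commute[OF that X(1)] by simp
  have "\<exists>!X. X \<in> ops M \<and> (\<forall>A\<in>ops M. tr N (mat_adjoint (T A) * Y) = tr M (mat_adjoint A * X))"
  proof (rule ex1I[of _ X])
    show "X \<in> ops M \<and> (\<forall>A\<in>ops M. tr N (mat_adjoint (T A) * Y) = tr M (mat_adjoint A * X))"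
      using X(1) X' by blast
    fix X2 assume X2: "X2 \<in> ops M \<and> (\<forall>A\<in>ops M. tr N (mat_adjoint (T A) * Y) = tr M (mat_adjoint A * X2))"
    show "X2 = X"
    proof (rule M.inner_ext)
      fix A assume "A \<in> ops M"
      then show "tr M (mat_adjoint A * X2) = tr M (mat_adjoint A * X)"
        using X2 X'[of A] by (metis (no_types))
    qed (use X2 X(1) in auto)
  qed
  from theI'[OF this] show "adj_op M N T Y \<in> ops M"
    "\<And>A. A \<in> ops M \<Longrightarrow> tr N (mat_adjoint (T A) * Y) = tr M (mat_adjoint A * adj_op M N T Y)"
    unfolding adj_op_def by blast+
qed



section \<open>The spectral theorem inside the algebra\<close>

definition linear_factors :: "real set \<Rightarrow> complex poly" where
  "linear_factors Z = (\<Prod>z\<in>Z. [:- complex_of_real z, 1:])"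

lemma linear_factors_dvd:
  assumes "finite Z" "\<And>z. z \<in> Z \<Longrightarrow> poly r (complex_of_real z) = 0"
  shows "linear_factors Z dvd r"
  using assms
proof (induction Z arbitrary: r rule: finite_induct)
  case empty
  then show ?case by (simp add: linear_factors_def)
next
  case (insert z Z)
  then obtain s where r: "r = [:- complex_of_real z, 1:] * s"
    by (metis dvdE insertI1 poly_eq_0_iff_dvd)
  have "poly s (complex_of_real y) = 0" if "y \<in> Z" for y
    using insert.prems[of y] insert.hyps that by (auto simp: r)
  then have "linear_factors Z dvd s" by (rule insert.IH)
  then show ?case
    unfolding linear_factors_def prod.insert[OF insert.hyps(1,2)] r by (rule mult_dvd_mono[OF dvd_refl])
qed

definition lagrange_basis :: "real set \<Rightarrow> real \<Rightarrow> complex poly" where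
  "lagrange_basis Z x =
     (\<Prod>y\<in>Z - {x}. Polynomial.smult (1 / complex_of_real (x - y)) [:- complex_of_real y, 1:])"

lemma poly_lagrange_basis:
  assumes "finite Z" "x \<in> Z" "y \<in> Z"
  shows "poly (lagrange_basis Z x) (complex_of_real y) = (if x = y then 1 else 0)"
proof (cases "x = y")
  case True
  have "poly (Polynomial.smult (1 / complex_of_real (x - z)) [:- complex_of_real z, 1:]) (complex_of_real y) = 1"
    if "z \<in> Z - {x}" for z
  proof -
    have "complex_of_real (x - z) \<noteq> 0" using that by simp
    moreover have "poly [:- complex_of_real z, 1:] (complex_of_real y) = complex_of_real (x - z)"
      using True by simp
    ultimately show ?thesis by (simp only: poly_smult) (simp del: of_real_diff)
  qed
  then show ?thesis using True by (simp add: lagrange_basis_def poly_prod)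
next
  case False
  then have "y \<in> Z - {x}" using assms by auto
  then have "poly (lagrange_basis Z x) (complex_of_real y) = 0"
    unfolding lagrange_basis_def poly_prod by (intro prod_zero) (use assms in \<open>auto intro!: bexI[of _ y]\<close>)
  then show ?thesis using False by simp
qed

lemma poly_map_cnj: "poly (map_poly cnj p) (complex_of_real x) = cnj (poly p (complex_of_real x))"
  by (induction p) (auto simp: map_poly_pCons)

context tracial begin

text \<open>Horner evaluation, so that inductions over \<open>pCons\<close> apply directly.\<close>

definition peval :: "complex poly \<Rightarrow> complex mat \<Rightarrow> complex mat" where
  "peval p A = fold_coeffs (\<lambda>c X. c \<cdot>\<^sub>m \<I> + A * X) p \<O>"

lemma peval_0 [simp]: "peval 0 A = \<O>"
  by (simp add: peval_def)

lemma peval_pCons: "A \<in> \<A> \<Longrightarrow> peval (pCons c p) A = c \<cdot>\<^sub>m \<I> + A * peval p A"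
  by (cases "p = 0"; cases "c = 0") (auto simp: peval_def)

lemma peval_in [simp]: "A \<in> \<A> \<Longrightarrow> peval p A \<in> \<A>"
  by (induction p) (auto simp: peval_pCons)

lemma add_assoc: "A \<in> \<A> \<Longrightarrow> B \<in> \<A> \<Longrightarrow> C \<in> \<A> \<Longrightarrow> A + B + C = A + (B + C)"
  by (rule assoc_add_mat[of _ n n]) auto

lemma add_comm: "A \<in> \<A> \<Longrightarrow> B \<in> \<A> \<Longrightarrow> A + B = B + A"
  by (rule comm_add_mat[of _ n n]) auto

lemma add_left_comm: "A \<in> \<A> \<Longrightarrow> B \<in> \<A> \<Longrightarrow> C \<in> \<A> \<Longrightarrow> A + (B + C) = B + (A + C)"
  using add_assoc[of A B C] add_assoc[of B A C] add_comm[of A B] by simp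

lemma smult_add: "A \<in> \<A> \<Longrightarrow> B \<in> \<A> \<Longrightarrow> c \<cdot>\<^sub>m (A + B) = c \<cdot>\<^sub>m A + c \<cdot>\<^sub>m B"
  by (rule add_smult_distrib_left_mat[of _ n n]) auto

lemma add_smult: "A \<in> \<A> \<Longrightarrow> (c + d) \<cdot>\<^sub>m A = c \<cdot>\<^sub>m A + d \<cdot>\<^sub>m A"
  by (rule add_smult_distrib_right_mat[of _ n n]) auto

lemma peval_add: "A \<in> \<A> \<Longrightarrow> peval (p + q) A = peval p A + peval q A"
  by (induction p q rule: poly_induct2)
    (simp_all add: peval_pCons distribs add_smult add_assoc add_left_comm)

lemma peval_smult: "A \<in> \<A> \<Longrightarrow> peval (Polynomial.smult c p) A = c \<cdot>\<^sub>m peval p A"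
  by (induction p) (simp_all add: peval_pCons smult_add smult_smult smult_mult)

lemma peval_mult: "A \<in> \<A> \<Longrightarrow> peval (p * q) A = peval p A * peval q A"
  by (induction p)
    (simp_all add: peval_pCons peval_add peval_smult distribs smult_mult mult_assoc)

lemma one_smult [simp]: "1 \<cdot>\<^sub>m A = (A :: complex mat)"
  by (rule eq_matI) auto

lemma peval_1: "A \<in> \<A> \<Longrightarrow> peval 1 A = \<I>"
  by (simp add: one_pCons peval_pCons)

lemma peval_X: "A \<in> \<A> \<Longrightarrow> peval [:c, 1:] A = c \<cdot>\<^sub>m \<I> + A"
  using peval_1[of A] by (simp add: peval_pCons one_pCons)

lemma peval_sum: "finite S \<Longrightarrow> A \<in> \<A> \<Longrightarrow> peval (\<Sum>x\<in>S. p x) A = msum n (\<lambda>x. peval (p x) A) S"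
  by (induction S rule: finite_induct) (auto simp: msum_insert peval_add)

lemma peval_commute: "A \<in> \<A> \<Longrightarrow> A * peval p A = peval p A * A"
proof -
  assume A: "A \<in> \<A>"
  have "peval [:0, 1:] A = A" using A by (simp add: peval_X)
  then show ?thesis using A peval_mult[of A "[:0, 1:]" p] peval_mult[of A p "[:0, 1:]"]
    by (simp only: mult.commute[of p])
qed

lemma adj_peval:
  assumes "A \<in> \<A>" "mat_adjoint A = A"
  shows "mat_adjoint (peval p A) = peval (map_poly cnj p) A"
  using assms
  by (induction p) (simp_all add: peval_pCons adj_simps map_poly_pCons peval_commute)

lemma peval_eigenvector:
  assumes A: "A \<in> \<A>" and v: "v \<in> carrier_vec n" "A *\<^sub>v v = x \<cdot>\<^sub>v v"
  shows "peval p A *\<^sub>v v = poly p x \<cdot>\<^sub>v v"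
proof (induction p)
  case 0
  show ?case using v(1) by (intro eq_vecI) auto
next
  case (pCons c p)
  have "peval (pCons c p) A *\<^sub>v v = (c \<cdot>\<^sub>m \<I>) *\<^sub>v v + A *\<^sub>v (peval p A *\<^sub>v v)"
    using A v(1) by (subst peval_pCons[OF A], subst add_mult_distrib_mat_vec[of _ n n])
      (auto simp: assoc_mult_mat_vec[of _ n n _ n])
  also have "(c \<cdot>\<^sub>m \<I>) *\<^sub>v v = c \<cdot>\<^sub>v v" using v(1) by (intro eq_vecI) auto
  also have "A *\<^sub>v (peval p A *\<^sub>v v) = poly p x \<cdot>\<^sub>v (x \<cdot>\<^sub>v v)"
    unfolding pCons.IH using A v by (simp add: mult_mat_vec[of _ n n])
  finally show ?case using v(1) by (auto intro!: eq_vecI simp: algebra_simps)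
qed

text \<open>A dimension count in disguise. As the degree can be prescribed to be large, there are two
  polynomials of different degrees that kill the entries treated so far; the combination of them
  that kills one more entry keeps the larger degree, hence is not zero.\<close>

lemma annihilating_poly_entries:
  assumes A: "A \<in> \<A>" and S: "finite S" "S \<subseteq> {..<n} \<times> {..<n}"
  shows "\<exists>p. k \<le> degree p \<and> p \<noteq> 0 \<and> (\<forall>s\<in>S. peval p A $$ s = 0)"
  using S
proof (induction S arbitrary: k rule: finite_induct)
  case empty
  show ?case by (intro exI[of _ "monom 1 k"]) (simp add: degree_monom_eq monom_eq_0_iff)
next
  case (insert s S k)
  obtain p where p: "k \<le> degree p" "p \<noteq> 0" "\<forall>s\<in>S. peval p A $$ s = 0"
    using insert by blast
  obtain q where q: "Suc (degree p) \<le> degree q" "q \<noteq> 0" "\<forall>s\<in>S. peval q A $$ s = 0"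
    using insert by blast
  show ?case
  proof (cases "peval p A $$ s = 0")
    case True
    then show ?thesis using p by auto
  next
    case False
    define r where "r = Polynomial.smult (peval q A $$ s) p + Polynomial.smult (- peval p A $$ s) q"
    have "degree (Polynomial.smult (peval q A $$ s) p) \<le> degree p" by simp
    moreover have "degree (Polynomial.smult (- peval p A $$ s) q) = degree q" using False by simp
    ultimately have "degree r = degree q" unfolding r_def using q(1) by (subst degree_add_eq_right) auto
    moreover have "peval r A $$ t = 0" if t: "t \<in> insert s S" for t
    proof -
      obtain i j where ij: "t = (i, j)" "i < n" "j < n" using t insert.prems by (cases t) auto
      have "peval r A $$ t = peval q A $$ s * peval p A $$ t - peval p A $$ s * peval q A $$ t"
        unfolding r_def peval_add[OF A] peval_smult[OF A]
        using ij carrier_matD[OF in_carrier[OF peval_in[OF A, of p]]] carrier_matD[OF in_carrier[OF peval_in[OF A, of q]]]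
        by simp
      then show ?thesis using t p(3) q(3) by auto
    qed
    ultimately show ?thesis using p(1) q(1) by (intro exI[of _ r]) auto
  qed
qed

lemma annihilating_poly:
  assumes A: "A \<in> \<A>"
  shows "\<exists>p. p \<noteq> 0 \<and> peval p A = \<O>"
proof -
  obtain p where p: "p \<noteq> 0" "\<forall>s\<in>{..<n} \<times> {..<n}. peval p A $$ s = 0"
    using annihilating_poly_entries[OF A, of "{..<n} \<times> {..<n}" 0] by auto
  moreover have "peval p A = \<O>"
    using p(2) in_carrier[OF peval_in[OF A, of p]] by (intro eq_matI) auto
  ultimately show ?thesis by blast
qed

lemma smult_eq_from_sum_zero:
  assumes "X \<in> \<A>" "Y \<in> \<A>" "(- l) \<cdot>\<^sub>m X + Y = \<O>"
  shows "Y = l \<cdot>\<^sub>m X"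
proof (rule eq_matI)
  fix i j assume "i < dim_row (l \<cdot>\<^sub>m X)" "j < dim_col (l \<cdot>\<^sub>m X)"
  then have ij: "i < n" "j < n" using in_carrier[OF assms(1)] by auto
  then have "((- l) \<cdot>\<^sub>m X + Y) $$ (i, j) = 0" by (simp add: assms(3))
  then show "Y $$ (i, j) = (l \<cdot>\<^sub>m X) $$ (i, j)"
    using ij carrier_matD[OF in_carrier[OF assms(1)]] carrier_matD[OF in_carrier[OF assms(2)]] by simp
qed (use carrier_matD[OF in_carrier[OF assms(1)]] carrier_matD[OF in_carrier[OF assms(2)]] in auto)

text \<open>Evaluating \<open>\<tau>(C\<^sup>* A C)\<close> in two ways gives both \<open>l \<tau>(C\<^sup>* C)\<close> and
  \<open>cnj l \<tau>(C\<^sup>* C)\<close>, so \<open>\<tau>(C\<^sup>* C) = 0\<close>.\<close>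

lemma nonreal_eigen_zero:
  assumes A: "A \<in> \<A>" "mat_adjoint A = A" and C: "C \<in> \<A>" "A * C = l \<cdot>\<^sub>m C" and l: "Im l \<noteq> 0"
  shows "C = \<O>"
proof (rule tr_faithful[OF C(1)])
  have "l * \<tau> (mat_adjoint C * C) = \<tau> (mat_adjoint C * (A * C))"
    using C(1) by (simp add: C(2) smult_mult tr_smult)
  also have "\<dots> = \<tau> (mat_adjoint (A * C) * C)"
    using A C(1) by (simp add: adj_simps mult_assoc)
  also have "\<dots> = cnj l * \<tau> (mat_adjoint C * C)"
    using C(1) by (simp add: C(2) smult_mult tr_smult adj_smult)
  finally have "(l - cnj l) * \<tau> (mat_adjoint C * C) = 0" by (simp add: algebra_simps)
  moreover have "l - cnj l \<noteq> 0" using l by (auto simp: complex_eq_iff)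
  ultimately show "\<tau> (mat_adjoint C * C) = 0" by simp
qed

text \<open>Self-adjoint elements have no nilpotent part, since \<open>(B C)\<^sup>* (B C) = C\<^sup>* B\<^sup>2 C\<close>.\<close>

lemma selfadjoint_square_zero:
  assumes B: "B \<in> \<A>" "mat_adjoint B = B" and C: "C \<in> \<A>" "B * (B * C) = \<O>"
  shows "B * C = \<O>"
proof (rule tr_faithful)
  have "mat_adjoint (B * C) * (B * C) = mat_adjoint C * (B * (B * C))"
    using B C(1) by (simp add: adj_simps mult_assoc)
  then show "\<tau> (mat_adjoint (B * C) * (B * C)) = 0" using C by simp
qed (use B C in auto)

text \<open>Linear factors of \<open>p\<close> are treated one at a time. A factor with a non-real root can be cancelled,
  a factor with a real root that occurs in \<open>Z\<close> already can be cancelled too, and otherwise the root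
  moves to \<open>Z\<close>. What remains is an annihilating polynomial with simple real roots.\<close>

lemma annihilating_linear_factors_aux:
  assumes A: "A \<in> \<A>" "mat_adjoint A = A"
    and "p \<noteq> 0" "finite Z" "peval (p * linear_factors Z) A = \<O>"
  shows "\<exists>Z. finite Z \<and> peval (linear_factors Z) A = \<O>"
  using assms(3-5)
proof (induction "degree p" arbitrary: p Z rule: less_induct)
  case less
  show ?case
  proof (cases "degree p = 0")
    case True
    then obtain c where c: "p = [:c:]" by (rule degree_eq_zeroE)
    have "c \<noteq> 0" using less.prems(1) c by auto
    have "c \<cdot>\<^sub>m peval (linear_factors Z) A = \<O>"
      using less.prems(3) A(1) by (simp add: c peval_smult)
    then have "(1 / c) \<cdot>\<^sub>m (c \<cdot>\<^sub>m peval (linear_factors Z) A) = \<O>" by simp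
    then have "peval (linear_factors Z) A = \<O>"
      using \<open>c \<noteq> 0\<close> by (simp add: smult_smult)
    then show ?thesis using less.prems(2) by blast
  next
    case False
    then have "\<not> constant (poly p)" by (simp add: constant_degree)
    then obtain l where "poly p l = 0" using fundamental_theorem_of_algebra by blast
    then obtain q where p: "p = [:- l, 1:] * q" by (metis dvdE poly_eq_0_iff_dvd)
    have q: "q \<noteq> 0" using less.prems(1) p by auto
    have dq: "degree q < degree p" using q unfolding p by (subst degree_mult_eq) auto
    let ?B = "(- l) \<cdot>\<^sub>m \<I> + A"
    have step: "peval ([:- l, 1:] * r) A = ?B * peval r A" for r
      using A(1) by (simp only: peval_mult peval_X)
    show ?thesis
    proof (cases "Im l = 0")
      case False
      let ?C = "peval (q * linear_factors Z) A"
      have "?B * ?C = \<O>" using less.prems(3) unfolding p mult.assoc step .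
      then have "(- l) \<cdot>\<^sub>m ?C + A * ?C = \<O>"
        using A(1) distribs(1)[of "(- l) \<cdot>\<^sub>m \<I>" A ?C] smult_mult(1)[of \<I> ?C "- l"] by simp
      then have "A * ?C = l \<cdot>\<^sub>m ?C" using A(1) by (intro smult_eq_from_sum_zero) auto
      then have "?C = \<O>" using A False by (intro nonreal_eigen_zero[of A _ l]) auto
      then show ?thesis using less.hyps[OF dq q less.prems(2)] by blast
    next
      case True
      define x where "x = Re l"
      have l: "l = complex_of_real x" using True by (simp add: x_def complex_eq_iff)
      show ?thesis
      proof (cases "x \<in> Z")
        case False
        have "p * linear_factors Z = q * linear_factors (insert x Z)"
          using False less.prems(2)
          by (simp only: p l linear_factors_def prod.insert[OF less.prems(2) False] mult_ac)
        then show ?thesis using less.hyps[OF dq q, of "insert x Z"] less.prems by auto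
      next
        case True
        then have Z: "linear_factors Z = [:- l, 1:] * linear_factors (Z - {x})"
          using less.prems(2) by (simp add: l linear_factors_def prod.remove)
        let ?C = "peval (q * linear_factors (Z - {x})) A"
        have B: "?B \<in> \<A>" "mat_adjoint ?B = ?B" using A by (auto simp: adj_simps l)
        have "p * linear_factors Z = [:- l, 1:] * ([:- l, 1:] * (q * linear_factors (Z - {x})))"
          unfolding Z p by (simp only: mult_ac)
        then have "?B * (?B * ?C) = \<O>" using less.prems(3) by (simp only: step)
        then have "?B * ?C = \<O>" using selfadjoint_square_zero[OF B, of ?C] A(1) by simp
        then have "peval (q * linear_factors Z) A = \<O>"
          unfolding Z by (simp only: step[symmetric] mult_ac)
        then show ?thesis using less.hyps[OF dq q less.prems(2)] by blast
      qed
    qed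
  qed
qed

lemma annihilating_linear_factors:
  assumes A: "A \<in> \<A>" "mat_adjoint A = A"
  shows "\<exists>Z. finite Z \<and> peval (linear_factors Z) A = \<O>"
proof -
  obtain p where "p \<noteq> 0" "peval p A = \<O>" using annihilating_poly[OF A(1)] by blast
  then show ?thesis
    by (intro annihilating_linear_factors_aux[OF A, of p "{}"]) (auto simp: linear_factors_def)
qed

text \<open>Equality of the ranges gives \<open>P Q = Q\<close> and \<open>Q P = P\<close>; taking adjoints finishes the proof. This
  makes the definite description in \<open>spectral_proj\<close> single-valued.\<close>

lemma selfadjoint_projection_unique:
  fixes P Q :: "complex mat"
  assumes P: "P \<in> carrier_mat n n" "mat_adjoint P = P" "P * P = P"
    and Q: "Q \<in> carrier_mat n n" "mat_adjoint Q = Q" "Q * Q = Q"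
    and PQ: "\<And>v. v \<in> carrier_vec n \<Longrightarrow> P *\<^sub>v v = v \<longleftrightarrow> Q *\<^sub>v v = v"
  shows "P = Q"
proof -
  have "P * Q = Q" if P: "P \<in> carrier_mat n n" "P * P = P" and Q: "Q \<in> carrier_mat n n" "Q * Q = Q"
    and PQ: "\<And>v. v \<in> carrier_vec n \<Longrightarrow> Q *\<^sub>v v = v \<Longrightarrow> P *\<^sub>v v = v" for P Q :: "complex mat"
  proof (rule mat_col_eqI)
    fix j assume "j < dim_col Q"
    then have j: "j < n" using Q by auto
    have c: "col Q j \<in> carrier_vec n" by (rule carrier_vecI) (simp only: dim_col carrier_matD(1)[OF Q(1)])
    have "Q *\<^sub>v col Q j = col Q j" using col_mult2[OF Q(1) Q(1) j] Q(2) by simp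
    then have "P *\<^sub>v col Q j = col Q j" by (rule PQ[OF c])
    then show "col (P * Q) j = col Q j" using col_mult2[OF P(1) Q(1) j] by simp
  qed (use P Q in auto)
  then have "P * Q = Q" "Q * P = P" using P Q PQ by auto
  then show ?thesis using mat_adjoint_mult[of P n n Q n] P Q by simp
qed

text \<open>If the simple polynomial with root set \<open>Z\<close> annihilates \<open>A\<close>, then \<open>p(A)\<close> depends only on the values
  of \<open>p\<close> on \<open>Z\<close>, and evaluating the Lagrange polynomials at \<open>A\<close> produces the spectral projections.
  Some \<open>z \<in> Z\<close> may fail to be eigenvalues; their projections vanish. As polynomials in \<open>A\<close> the
  projections belong to the algebra, which is the point of this route: homomorphisms that are
  defined on the algebra only can be applied to them.\<close>

lemma spectral_theorem:
  assumes A: "A \<in> \<A>" "mat_adjoint A = A"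
  defines "S \<equiv> spectral_values A" and "E \<equiv> spectral_proj A"
  shows finite_spectral_values: "finite S"
    and spectral_proj_in: "\<And>x. x \<in> S \<Longrightarrow> E x \<in> \<A>"
    and adj_spectral_proj: "\<And>x. x \<in> S \<Longrightarrow> mat_adjoint (E x) = E x"
    and spectral_proj_mult: "\<And>x y. x \<in> S \<Longrightarrow> y \<in> S \<Longrightarrow> E x * E y = (if x = y then E x else \<O>)"
    and mult_spectral_proj: "\<And>x. x \<in> S \<Longrightarrow> A * E x = complex_of_real x \<cdot>\<^sub>m E x"
    and spectral_proj_nonzero: "\<And>x. x \<in> S \<Longrightarrow> E x \<noteq> \<O>"
    and msum_spectral_proj: "msum n E S = \<I>"
    and spectral_decomposition: "msum n (\<lambda>x. complex_of_real x \<cdot>\<^sub>m E x) S = A"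
proof -
  obtain Z where Z: "finite Z" "peval (linear_factors Z) A = \<O>"
    using annihilating_linear_factors[OF A] by blast
  have agree: "peval p A = peval q A"
    if pq: "\<And>z. z \<in> Z \<Longrightarrow> poly p (complex_of_real z) = poly q (complex_of_real z)" for p q
  proof -
    have "linear_factors Z dvd p - q" by (rule linear_factors_dvd[OF Z(1)]) (simp add: pq)
    then obtain r where "p - q = linear_factors Z * r" by (rule dvdE)
    then have "p = q + linear_factors Z * r" by (simp add: algebra_simps)
    then show ?thesis using A(1) Z(2) by (simp add: peval_add peval_mult)
  qed
  define F where "F x = peval (lagrange_basis Z x) A" for x
  note pl = poly_lagrange_basis[OF Z(1)]
  have F_in: "F x \<in> \<A>" for x using A(1) by (simp add: F_def)
  have F_adj: "mat_adjoint (F x) = F x" if "x \<in> Z" for x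
    unfolding F_def adj_peval[OF A] by (rule agree) (simp add: poly_map_cnj pl that)
  have F_mult: "F x * F y = (if x = y then F x else \<O>)" if "x \<in> Z" "y \<in> Z" for x y
  proof -
    have "F x * F y = peval (if x = y then lagrange_basis Z x else 0) A"
      unfolding F_def peval_mult[OF A(1), symmetric] by (rule agree) (auto simp: pl that)
    then show ?thesis by (auto simp: F_def)
  qed
  have X: "peval [:0, 1:] A = A" using A(1) by (simp add: peval_X)
  have AF: "A * F x = complex_of_real x \<cdot>\<^sub>m F x" if "x \<in> Z" for x
  proof -
    have "peval ([:0, 1:] * lagrange_basis Z x) A = peval (Polynomial.smult (complex_of_real x) (lagrange_basis Z x)) A"
      by (rule agree) (auto simp: pl that)
    then show ?thesis using A(1) X by (simp only: peval_mult peval_smult F_def)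
  qed
  have F_vec: "F x *\<^sub>v v = v \<longleftrightarrow> A *\<^sub>v v = complex_of_real x \<cdot>\<^sub>v v"
    if x: "x \<in> Z" and v: "v \<in> carrier_vec n" for x v
  proof
    assume "F x *\<^sub>v v = v"
    then have "A *\<^sub>v v = A *\<^sub>v (F x *\<^sub>v v)" by simp
    also have "\<dots> = (A * F x) *\<^sub>v v" using A(1) F_in[of x] v by (subst assoc_mult_mat_vec[of _ n n _ n]) auto
    also have "\<dots> = complex_of_real x \<cdot>\<^sub>v (F x *\<^sub>v v)"
      unfolding AF[OF x] using in_carrier[OF F_in[of x]] v by (intro eq_vecI) auto
    finally show "A *\<^sub>v v = complex_of_real x \<cdot>\<^sub>v v" using \<open>F x *\<^sub>v v = v\<close> by simp
  next
    assume "A *\<^sub>v v = complex_of_real x \<cdot>\<^sub>v v"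
    then show "F x *\<^sub>v v = v"
      unfolding F_def using peval_eigenvector[OF A(1) v] pl[OF x x] by simp
  qed
  have EF: "E x = F x" if x: "x \<in> Z" for x
    unfolding E_def spectral_proj_def
    unfolding carrier_matD(1)[OF in_carrier[OF A(1)]]
  proof (rule the_equality)
    show P: "F x \<in> carrier_mat n n \<and> mat_adjoint (F x) = F x \<and> F x * F x = F x \<and>
      (\<forall>v\<in>carrier_vec n. F x *\<^sub>v v = v \<longleftrightarrow> A *\<^sub>v v = complex_of_real x \<cdot>\<^sub>v v)"
    proof (intro conjI ballI)
      show "F x \<in> carrier_mat n n" by (rule in_carrier[OF F_in])
      show "mat_adjoint (F x) = F x" by (rule F_adj[OF x])
      show "F x * F x = F x" using F_mult[OF x x] by (simp only: if_True refl)
      fix v :: "complex Matrix.vec" assume "v \<in> carrier_vec n"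
      then show "F x *\<^sub>v v = v \<longleftrightarrow> A *\<^sub>v v = complex_of_real x \<cdot>\<^sub>v v" by (rule F_vec[OF x])
    qed
    fix P assume Q: "P \<in> carrier_mat n n \<and> mat_adjoint P = P \<and> P * P = P \<and>
      (\<forall>v\<in>carrier_vec n. P *\<^sub>v v = v \<longleftrightarrow> A *\<^sub>v v = complex_of_real x \<cdot>\<^sub>v v)"
    show "P = F x"
    proof (rule selfadjoint_projection_unique)
      show "P \<in> carrier_mat n n" "mat_adjoint P = P" "P * P = P" using Q by blast+
      show "F x \<in> carrier_mat n n" "mat_adjoint (F x) = F x" "F x * F x = F x" using P by blast+
      show "P *\<^sub>v v = v \<longleftrightarrow> F x *\<^sub>v v = v" if "v \<in> carrier_vec n" for v
        using P Q that by blast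
    qed
  qed
  have S: "S = {x \<in> Z. F x \<noteq> \<O>}"
  proof (intro equalityI subsetI)
    fix x assume "x \<in> S"
    then obtain v where v: "v \<in> carrier_vec n" "v \<noteq> 0\<^sub>v n" "A *\<^sub>v v = complex_of_real x \<cdot>\<^sub>v v"
      using in_carrier[OF A(1)] by (auto simp: S_def spectral_values_def eigenvalue_def eigenvector_def)
    have nz: "c = 0" if "c \<cdot>\<^sub>v v = 0\<^sub>v n" for c
    proof (rule ccontr)
      assume c: "c \<noteq> 0"
      have "c * vec_index v i = 0" if "i < n" for i
        using arg_cong[OF \<open>c \<cdot>\<^sub>v v = 0\<^sub>v n\<close>, of "\<lambda>u. vec_index u i"] that v(1) by simp
      then have "v = 0\<^sub>v n" using v(1) c by (intro eq_vecI) auto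
      then show False using v(2) by simp
    qed
    have Ov: "\<O> *\<^sub>v v = 0\<^sub>v n" using v(1) by (intro eq_vecI) auto
    have "poly (linear_factors Z) (complex_of_real x) \<cdot>\<^sub>v v = 0\<^sub>v n"
      using peval_eigenvector[OF A(1) v(1,3), of "linear_factors Z"] unfolding Z(2) Ov by (rule sym)
    then have "poly (linear_factors Z) (complex_of_real x) = 0" by (rule nz)
    then have xZ: "x \<in> Z" using Z(1) by (auto simp: linear_factors_def poly_prod)
    have "F x *\<^sub>v v = v" using F_vec[OF xZ v(1)] v(3) by simp
    then have "F x \<noteq> \<O>" using v(2) Ov by metis
    then show "x \<in> {x \<in> Z. F x \<noteq> \<O>}" using xZ by blast
  next
    fix x assume x: "x \<in> {x \<in> Z. F x \<noteq> \<O>}"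
    have "\<exists>j<n. col (F x) j \<noteq> 0\<^sub>v n"
    proof (rule ccontr)
      assume no: "\<not> ?thesis"
      have "F x = \<O>"
      proof (rule mat_col_eqI)
        fix j assume "j < dim_col \<O>"
        then show "col (F x) j = col \<O> j" using no by simp
      qed (simp_all only: carrier_matD[OF in_carrier[OF F_in[of x]]] index_zero_mat)
      then show False using x by simp
    qed
    then obtain j where j: "j < n" "col (F x) j \<noteq> 0\<^sub>v n" by blast
    have FA: "F x \<in> carrier_mat n n" "A \<in> carrier_mat n n" using in_carrier F_in A(1) by auto
    note dims = carrier_matD[OF FA(1)] carrier_matD[OF FA(2)]
    have "A *\<^sub>v col (F x) j = col (complex_of_real x \<cdot>\<^sub>m F x) j"
      using col_mult2[OF FA(2) FA(1) j(1)] AF[of x] x by simp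
    also have "\<dots> = complex_of_real x \<cdot>\<^sub>v col (F x) j"
      using j(1) dims by (intro eq_vecI) simp_all
    finally have "eigenvector A (col (F x) j) (complex_of_real x)"
      using j(2) col_carrier_vec[OF j(1) FA(1)] by (simp add: eigenvector_def dims)
    then show "x \<in> S" unfolding S_def spectral_values_def eigenvalue_def by blast
  qed
  have SZ: "S \<subseteq> Z" by (auto simp: S)
  show "finite S" using Z(1) SZ by (rule rev_finite_subset)
  have Z_S: "x \<in> Z" if "x \<in> S" for x using that SZ by blast
  show "E x \<in> \<A>" if "x \<in> S" for x unfolding EF[OF Z_S[OF that]] by (rule F_in)
  show "mat_adjoint (E x) = E x" if "x \<in> S" for x
    unfolding EF[OF Z_S[OF that]] by (rule F_adj[OF Z_S[OF that]])
  show "E x * E y = (if x = y then E x else \<O>)" if "x \<in> S" "y \<in> S" for x y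
    unfolding EF[OF Z_S[OF that(1)]] EF[OF Z_S[OF that(2)]] by (rule F_mult[OF Z_S[OF that(1)] Z_S[OF that(2)]])
  show "A * E x = complex_of_real x \<cdot>\<^sub>m E x" if "x \<in> S" for x
    unfolding EF[OF Z_S[OF that]] by (rule AF[OF Z_S[OF that]])
  show "E x \<noteq> \<O>" if "x \<in> S" for x
    unfolding EF[OF Z_S[OF that]] using that S by blast
  have sum: "msum n (\<lambda>x. c x \<cdot>\<^sub>m E x) S = peval (\<Sum>x\<in>Z. Polynomial.smult (c x) (lagrange_basis Z x)) A" for c
  proof -
    have "msum n (\<lambda>x. c x \<cdot>\<^sub>m E x) S = msum n (\<lambda>x. c x \<cdot>\<^sub>m F x) Z"
    proof -
      have "(\<Sum>i\<in>S. (c i \<cdot>\<^sub>m E i) $$ (a, b)) = (\<Sum>i\<in>Z. (c i \<cdot>\<^sub>m F i) $$ (a, b))" if "a < n" "b < n" for a b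
      proof (rule sum.mono_neutral_cong_left[OF Z(1) SZ])
        show "\<forall>i\<in>Z - S. (c i \<cdot>\<^sub>m F i) $$ (a, b) = 0" using that by (auto simp: S)
      qed (use SZ EF in auto)
      then show ?thesis by (intro eq_matI) (simp_all add: msum_def)
    qed
    then show ?thesis using A(1) Z(1) by (simp add: peval_sum peval_smult F_def)
  qed
  have val: "poly (\<Sum>x\<in>Z. Polynomial.smult (c x) (lagrange_basis Z x)) (complex_of_real z) = c z" if "z \<in> Z" for c z
    using that Z(1) by (simp add: poly_sum pl if_distrib[of "\<lambda>u. _ * u"] cong: if_cong)
  have "msum n (\<lambda>x. 1 \<cdot>\<^sub>m E x) S = peval 1 A"
    unfolding sum by (rule agree) (simp only: val[where c = "\<lambda>_. 1"] poly_1)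
  moreover have "msum n (\<lambda>x. 1 \<cdot>\<^sub>m E x) S = msum n E S"
    by simp
  ultimately show "msum n E S = \<I>" using A(1) by (simp add: peval_1)
  have "msum n (\<lambda>x. complex_of_real x \<cdot>\<^sub>m E x) S = peval [:0, 1:] A"
    unfolding sum by (rule agree) (simp add: val)
  then show "msum n (\<lambda>x. complex_of_real x \<cdot>\<^sub>m E x) S = A" using X by simp
qed

end



section \<open>Functional calculus and the derivative of the trace functional\<close>

lemma has_vector_derivative_quadratic:
  fixes g :: "real \<Rightarrow> complex"
  assumes "\<delta> > 0" "\<And>t. \<bar>t\<bar> < \<delta> \<Longrightarrow> norm (g t - g 0 - of_real t * d) \<le> C * t\<^sup>2"
  shows "(g has_vector_derivative d) (at 0)"
proof -
  have "(\<lambda>h. norm (g (0 + h) - g 0 - h *\<^sub>R d) / norm h) \<midarrow>0\<rightarrow> 0"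
  proof (rule Lim_null_comparison)
    show "eventually (\<lambda>h. norm (norm (g (0 + h) - g 0 - h *\<^sub>R d) / norm h) \<le> C * \<bar>h\<bar>) (at 0)"
      unfolding eventually_at
    proof (intro exI[of _ \<delta>] conjI ballI impI)
      fix h :: real assume h: "h \<noteq> 0 \<and> dist h 0 < \<delta>"
      then have "norm (g h - g 0 - of_real h * d) \<le> C * h\<^sup>2" by (intro assms(2)) (simp add: dist_real_def)
      then have "norm (g h - g 0 - of_real h * d) / \<bar>h\<bar> \<le> (C * h\<^sup>2) / \<bar>h\<bar>"
        by (rule divide_right_mono) simp
      also have "(C * h\<^sup>2) / \<bar>h\<bar> = C * \<bar>h\<bar>"
        using h by (simp add: power2_eq_square abs_if divide_simps)
      finally show "norm (norm (g (0 + h) - g 0 - h *\<^sub>R d) / norm h) \<le> C * \<bar>h\<bar>"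
        by (simp add: scaleR_conv_of_real)
    qed (rule assms(1))
    show "(\<lambda>h. C * \<bar>h\<bar>) \<midarrow>0\<rightarrow> (0::real)"
      by (auto intro!: tendsto_eq_intros)
  qed
  then show ?thesis
    unfolding has_vector_derivative_def has_derivative_at
    by (auto intro: bounded_linear_scaleR_left)
qed

lemma C1_on_deriv:
  assumes "f C1_differentiable_on {0<..}"
  shows "\<And>x. x > 0 \<Longrightarrow> (f has_real_derivative deriv f x) (at x)"
    and "continuous_on {0<..} (deriv f)"
proof -
  obtain D where D: "\<And>x. x > 0 \<Longrightarrow> (f has_vector_derivative D x) (at x)" "continuous_on {0<..} D"
    using assms by (auto simp: C1_differentiable_on_def)
  have F: "(f has_real_derivative D x) (at x)" if "x > 0" for x
    using D(1)[OF that] by (simp add: has_real_derivative_iff_has_vector_derivative)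
  have eq: "deriv f x = D x" if "x > 0" for x by (rule DERIV_imp_deriv[OF F[OF that]])
  show "(f has_real_derivative deriv f x) (at x)" if "x > 0" for x using F[OF that] eq[OF that] by simp
  show "continuous_on {0<..} (deriv f)"
    by (rule continuous_on_eq[OF D(2)]) (simp add: eq)
qed

lemma taylor_quadratic_bound:
  fixes a b :: real
  assumes f: "f C1_differentiable_on {0<..}" "deriv f C1_differentiable_on {0<..}" and a: "0 < a"
  shows "\<exists>C\<ge>0. \<forall>x\<in>{a..b}. \<forall>y\<in>{a..b}. \<bar>f x - f y - deriv f y * (x - y)\<bar> \<le> C * (x - y)\<^sup>2"
proof -
  have "{a..b} \<subseteq> {0<..}" using a by auto
  then have "continuous_on {a..b} (deriv (deriv f))"
    using C1_on_deriv(2)[OF f(2)] continuous_on_subset by blast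
  then have "bounded (deriv (deriv f) ` {a..b})"
    by (intro compact_imp_bounded compact_continuous_image) simp_all
  then obtain C where C: "C > 0" "\<And>x. x \<in> {a..b} \<Longrightarrow> \<bar>deriv (deriv f) x\<bar> \<le> C"
    unfolding bounded_pos by auto
  have lip: "\<bar>deriv f u - deriv f v\<bar> \<le> C * \<bar>u - v\<bar>" if "u \<in> {a..b}" "v \<in> {a..b}" for u v
  proof -
    have der: "(deriv f has_field_derivative deriv (deriv f) z) (at z within {a..b})" if "z \<in> {a..b}" for z
    proof (rule has_field_derivative_at_within, rule C1_on_deriv(1)[OF f(2)])
      show "0 < z" using that a by simp
    qed
    have "norm (deriv (deriv f) z) \<le> C" if "z \<in> {a..b}" for z using C(2)[OF that] by simp
    from field_differentiable_bound[OF convex_closed_interval[of a b, unfolded box_real] der this that]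
    have "norm (deriv f u - deriv f v) \<le> C * norm (u - v)" .
    then show ?thesis by simp
  qed
  have "\<bar>f x - f y - deriv f y * (x - y)\<bar> \<le> C * (x - y)\<^sup>2" if xy: "x \<in> {a..b}" "y \<in> {a..b}" for x y
  proof -
    have seg: "closed_segment y x \<subseteq> {a..b}" using xy by (intro closed_segment_subset) auto
    have "norm ((f x - deriv f y * (x - y)) - (f y - deriv f y * (y - y))) \<le> C * \<bar>x - y\<bar> * norm (x - y)"
    proof (rule field_differentiable_bound[where S = "closed_segment y x" and f' = "\<lambda>z. deriv f z - deriv f y"])
      fix z assume z: "z \<in> closed_segment y x"
      then have zab: "z \<in> {a..b}" using seg by blast
      have "0 < z" using zab a by simp
      then have "(f has_real_derivative deriv f z) (at z within closed_segment y x)"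
        by (rule has_field_derivative_at_within[OF C1_on_deriv(1)[OF f(1)]])
      from DERIV_diff[OF this DERIV_cmult[OF DERIV_diff[OF DERIV_ident DERIV_const]], of "deriv f y" y]
      show "((\<lambda>z. f z - deriv f y * (z - y)) has_field_derivative deriv f z - deriv f y) (at z within closed_segment y x)"
        by simp
      have "\<bar>z - y\<bar> \<le> \<bar>x - y\<bar>" using z by (auto simp: closed_segment_eq_real_ivl split: if_splits)
      then have "C * \<bar>z - y\<bar> \<le> C * \<bar>x - y\<bar>" using C(1) by simp
      then show "norm (deriv f z - deriv f y) \<le> C * \<bar>x - y\<bar>" using lip[OF zab xy(2)] by simp
    qed auto
    then show ?thesis by (simp add: power2_eq_square abs_mult_self_eq mult.assoc)
  qed
  then show ?thesis using C(1) by (intro exI[of _ C]) auto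
qed

context tracial begin

abbreviation "\<H> \<equiv> self_adjoint_ops M"

lemma selfadjD: "A \<in> \<H> \<Longrightarrow> A \<in> \<A>" "A \<in> \<H> \<Longrightarrow> mat_adjoint A = A"
  by (simp_all add: self_adjoint_ops_def)

lemma selfadjI: "A \<in> \<A> \<Longrightarrow> mat_adjoint A = A \<Longrightarrow> A \<in> \<H>"
  by (simp add: self_adjoint_ops_def)

lemma selfadj_add: "A \<in> \<H> \<Longrightarrow> B \<in> \<H> \<Longrightarrow> A + B \<in> \<H>"
  and selfadj_minus: "A \<in> \<H> \<Longrightarrow> B \<in> \<H> \<Longrightarrow> A - B \<in> \<H>"
  and selfadj_scale: "A \<in> \<H> \<Longrightarrow> complex_of_real t \<cdot>\<^sub>m A \<in> \<H>"
  and selfadj_one: "\<I> \<in> \<H>"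
  by (simp_all add: self_adjoint_ops_def adj_simps)

context
  fixes A assumes A: "A \<in> \<H>"
begin

lemma fin [simp]: "finite (spectral_values A)"
  and E_in [simp]: "\<And>x. x \<in> spectral_values A \<Longrightarrow> spectral_proj A x \<in> \<A>"
  using finite_spectral_values[OF selfadjD[OF A]] spectral_proj_in[OF selfadjD[OF A]] by auto

lemma E_selfadj: "x \<in> spectral_values A \<Longrightarrow> spectral_proj A x \<in> \<H>"
  using adj_spectral_proj[OF selfadjD[OF A]] by (intro selfadjI) auto

lemma E_idem: "x \<in> spectral_values A \<Longrightarrow> spectral_proj A x * spectral_proj A x = spectral_proj A x"
  using spectral_proj_mult[OF selfadjD[OF A], of x x] by simp

lemma fun_calc_eq: "fun_calc f A = msum n (\<lambda>x. complex_of_real (f x) \<cdot>\<^sub>m spectral_proj A x) (spectral_values A)"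
  unfolding fun_calc_def carrier_matD(1)[OF in_carrier[OF selfadjD(1)[OF A]]] ..

lemma fun_calc_selfadj: "fun_calc f A \<in> \<H>"
proof (rule selfadjI)
  show "fun_calc f A \<in> \<A>" unfolding fun_calc_eq by (rule msum_in) simp_all
  show "mat_adjoint (fun_calc f A) = fun_calc f A"
    unfolding fun_calc_eq
    by (subst adj_msum) (simp_all add: adj_smult selfadjD(2)[OF E_selfadj] cong: msum_cong)
qed

lemma fun_calc_in [simp]: "fun_calc f A \<in> \<A>"
  by (rule selfadjD(1)[OF fun_calc_selfadj])

lemma fun_calc_id: "fun_calc (\<lambda>x. x) A = A"
  unfolding fun_calc_eq by (rule spectral_decomposition[OF selfadjD[OF A]])

lemma fun_calc_one: "fun_calc (\<lambda>_. 1) A = \<I>"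
  unfolding fun_calc_eq using msum_spectral_proj[OF selfadjD[OF A]] by simp

lemma msum_spectral_delta:
  assumes "x \<in> spectral_values A" "X \<in> \<A>"
  shows "msum n (\<lambda>y. if x = y then X else \<O>) (spectral_values A) = X"
proof (rule eq_matI)
  fix a b assume "a < dim_row X" "b < dim_col X"
  then have ab: "a < n" "b < n" using carrier_matD[OF in_carrier[OF assms(2)]] by auto
  have "(\<Sum>y\<in>spectral_values A. (if x = y then X else \<O>) $$ (a, b)) = (\<Sum>y\<in>spectral_values A. if x = y then X $$ (a, b) else 0)"
    using ab by (intro sum.cong) auto
  also have "\<dots> = X $$ (a, b)" using assms(1) by simp
  finally show "msum n (\<lambda>y. if x = y then X else \<O>) (spectral_values A) $$ (a, b) = X $$ (a, b)"
    using ab by (simp add: index_msum)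
qed (simp_all add: msum_def carrier_matD[OF in_carrier[OF assms(2)]])

lemma spectral_proj_fun_calc:
  assumes x: "x \<in> spectral_values A"
  shows "spectral_proj A x * fun_calc f A = complex_of_real (f x) \<cdot>\<^sub>m spectral_proj A x"
    and "fun_calc f A * spectral_proj A x = complex_of_real (f x) \<cdot>\<^sub>m spectral_proj A x"
proof -
  have "spectral_proj A x * fun_calc f A = msum n (\<lambda>y. spectral_proj A x * (complex_of_real (f y) \<cdot>\<^sub>m spectral_proj A y)) (spectral_values A)"
    unfolding fun_calc_eq using x by (intro msum_mult(2)) simp_all
  also have "\<dots> = msum n (\<lambda>y. if x = y then complex_of_real (f x) \<cdot>\<^sub>m spectral_proj A x else \<O>) (spectral_values A)"
    using x by (intro msum_cong refl) (simp add: smult_mult spectral_proj_mult[OF selfadjD[OF A]])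
  also have "\<dots> = complex_of_real (f x) \<cdot>\<^sub>m spectral_proj A x"
    using x by (intro msum_spectral_delta) simp_all
  finally show 1: "spectral_proj A x * fun_calc f A = complex_of_real (f x) \<cdot>\<^sub>m spectral_proj A x" .
  have "mat_adjoint (spectral_proj A x * fun_calc f A) = mat_adjoint (complex_of_real (f x) \<cdot>\<^sub>m spectral_proj A x)"
    using 1 by (rule arg_cong)
  then show "fun_calc f A * spectral_proj A x = complex_of_real (f x) \<cdot>\<^sub>m spectral_proj A x"
    using x by (simp add: adj_simps selfadjD(2)[OF E_selfadj] selfadjD(2)[OF fun_calc_selfadj])
qed

lemma fun_calc_mult: "fun_calc f A * fun_calc g A = fun_calc (\<lambda>x. f x * g x) A"
proof -
  have "fun_calc f A * fun_calc g A = msum n (\<lambda>x. (complex_of_real (f x) \<cdot>\<^sub>m spectral_proj A x) * fun_calc g A) (spectral_values A)"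
    unfolding fun_calc_eq[of f] by (rule msum_mult(1)) simp_all
  also have "\<dots> = msum n (\<lambda>x. complex_of_real (f x * g x) \<cdot>\<^sub>m spectral_proj A x) (spectral_values A)"
    by (intro msum_cong refl) (simp add: smult_mult spectral_proj_fun_calc smult_smult)
  finally show ?thesis by (simp only: fun_calc_eq)
qed

lemma tr_fun_calc_mult:
  assumes B: "B \<in> \<A>"
  shows "\<tau> (fun_calc f A * B) = (\<Sum>x\<in>spectral_values A. complex_of_real (f x) * \<tau> (spectral_proj A x * B))"
proof -
  have "fun_calc f A * B = msum n (\<lambda>x. (complex_of_real (f x) \<cdot>\<^sub>m spectral_proj A x) * B) (spectral_values A)"
    unfolding fun_calc_eq using B by (intro msum_mult(1)) simp_all
  then show ?thesis using B by (simp add: tr_msum smult_mult tr_smult)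
qed

end

text \<open>The weights \<open>\<tau>(P Q)\<close> of two projections behave like unnormalized joint probabilities, because
  \<open>\<tau>(P Q) = \<tau>((P Q)\<^sup>* (P Q))\<close>.\<close>

lemma tr_proj_mult:
  assumes P: "P \<in> \<H>" "P * P = P" and Q: "Q \<in> \<H>" "Q * Q = Q"
  shows "\<tau> (P * Q) = complex_of_real (Re (\<tau> (P * Q)))" "0 \<le> Re (\<tau> (P * Q))"
proof -
  note PQ = selfadjD[OF P(1)] selfadjD[OF Q(1)]
  have "mat_adjoint (P * Q) * (P * Q) = Q * (P * P * Q)"
    using PQ by (simp add: adj_simps mult_assoc)
  also have "\<dots> = Q * (P * Q)" by (simp only: P(2))
  finally have "\<tau> (mat_adjoint (P * Q) * (P * Q)) = \<tau> (Q * (P * Q))" by (rule arg_cong)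
  also have "\<dots> = \<tau> (P * Q * Q)" using PQ by (intro tr_comm) simp_all
  also have "P * Q * Q = P * Q" using PQ by (simp add: mult_assoc Q(2))
  finally have e: "\<tau> (mat_adjoint (P * Q) * (P * Q)) = \<tau> (P * Q)" .
  show "\<tau> (P * Q) = complex_of_real (Re (\<tau> (P * Q)))" "0 \<le> Re (\<tau> (P * Q))"
    using tr_real[of "P * Q"] tr_nonneg[of "P * Q"] PQ unfolding e by simp_all
qed

lemma tr_fun_calc_fun_calc:
  assumes X: "X \<in> \<H>" and Y: "Y \<in> \<H>"
  shows "\<tau> (fun_calc f X * fun_calc g Y) = (\<Sum>x\<in>spectral_values X. \<Sum>y\<in>spectral_values Y.
    complex_of_real (f x * g y) * \<tau> (spectral_proj X x * spectral_proj Y y))"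
proof -
  have "\<tau> (spectral_proj X x * fun_calc g Y) = (\<Sum>y\<in>spectral_values Y.
    complex_of_real (g y) * \<tau> (spectral_proj X x * spectral_proj Y y))" if x: "x \<in> spectral_values X" for x
  proof -
    have "\<tau> (spectral_proj X x * fun_calc g Y) = \<tau> (fun_calc g Y * spectral_proj X x)"
      using x X Y by (intro tr_comm) simp_all
    also have "\<dots> = (\<Sum>y\<in>spectral_values Y. complex_of_real (g y) * \<tau> (spectral_proj Y y * spectral_proj X x))"
      using x X Y by (intro tr_fun_calc_mult) simp_all
    also have "\<dots> = (\<Sum>y\<in>spectral_values Y. complex_of_real (g y) * \<tau> (spectral_proj X x * spectral_proj Y y))"
      using x X Y by (intro sum.cong refl arg_cong2[of _ _ _ _ "(*)"] tr_comm) simp_all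
    finally show ?thesis .
  qed
  then show ?thesis
    using X Y by (simp add: tr_fun_calc_mult sum_distrib_left mult.assoc)
qed

text \<open>Under the trace two non-commuting elements \<open>X\<close> and \<open>Y\<close> interact only through the joint weights of
  their spectral projections, so the first-order remainder of \<open>\<tau> f\<close> is a weighted sum of scalar
  remainders.\<close>

lemma tr_taylor_remainder:
  assumes X: "X \<in> \<H>" and Y: "Y \<in> \<H>"
  shows "\<tau> (fun_calc f X) - \<tau> (fun_calc f Y) - \<tau> (fun_calc g Y * (X - Y)) =
    (\<Sum>x\<in>spectral_values X. \<Sum>y\<in>spectral_values Y.
      complex_of_real (f x - f y - g y * (x - y)) * \<tau> (spectral_proj X x * spectral_proj Y y))"
proof -
  note D = tr_fun_calc_fun_calc[OF X Y]
  have 1: "\<tau> (fun_calc f X) = \<tau> (fun_calc f X * fun_calc (\<lambda>_. 1) Y)"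
    using X by (simp add: fun_calc_one[OF Y])
  have 2: "\<tau> (fun_calc f Y) = \<tau> (fun_calc (\<lambda>_. 1) X * fun_calc f Y)"
    using Y by (simp add: fun_calc_one[OF X])
  have 3: "\<tau> (fun_calc g Y * X) = \<tau> (fun_calc (\<lambda>x. x) X * fun_calc g Y)"
    unfolding fun_calc_id[OF X] using X Y by (intro tr_comm) (simp_all add: selfadjD)
  have 4: "\<tau> (fun_calc g Y * Y) = \<tau> (fun_calc (\<lambda>_. 1) X * fun_calc (\<lambda>x. g x * x) Y)"
    using fun_calc_mult[OF Y, of g "\<lambda>x. x"] Y unfolding fun_calc_id[OF Y] fun_calc_one[OF X] by simp
  have "\<tau> (fun_calc g Y * (X - Y)) = \<tau> (fun_calc g Y * X) - \<tau> (fun_calc g Y * Y)"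
    using X Y by (simp add: distribs tr_simps selfadjD)
  then show ?thesis
    unfolding 1 2 3 4 D by (simp add: sum_subtractf[symmetric] algebra_simps)
qed

text \<open>The weighted sum of \<open>(x - y)\<^sup>2\<close> for the same weights: this turns a quadratic bound for the scalar
  remainders into a quadratic bound for the trace functional.\<close>

lemma tr_square_diff:
  assumes X: "X \<in> \<H>" and Y: "Y \<in> \<H>"
  shows "\<tau> ((X - Y) * (X - Y)) =
    (\<Sum>x\<in>spectral_values X. \<Sum>y\<in>spectral_values Y.
      complex_of_real ((x - y)\<^sup>2) * \<tau> (spectral_proj X x * spectral_proj Y y))"
proof -
  note D = tr_fun_calc_fun_calc[OF X Y]
  have 1: "\<tau> (X * X) = \<tau> (fun_calc (\<lambda>x. x * x) X * fun_calc (\<lambda>_. 1) Y)"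
    using fun_calc_mult[OF X, of "\<lambda>x. x" "\<lambda>x. x"] X unfolding fun_calc_id[OF X] fun_calc_one[OF Y] by simp
  have 2: "\<tau> (Y * Y) = \<tau> (fun_calc (\<lambda>_. 1) X * fun_calc (\<lambda>x. x * x) Y)"
    using fun_calc_mult[OF Y, of "\<lambda>x. x" "\<lambda>x. x"] Y unfolding fun_calc_id[OF Y] fun_calc_one[OF X] by simp
  have 3: "\<tau> (X * Y) = \<tau> (fun_calc (\<lambda>x. x) X * fun_calc (\<lambda>x. x) Y)"
    by (simp add: fun_calc_id X Y)
  have XY: "X \<in> \<A>" "Y \<in> \<A>" using X Y by (simp_all add: selfadjD)
  then have 4: "\<tau> (Y * X) = \<tau> (X * Y)" by (intro tr_comm)
  have "\<tau> ((X - Y) * (X - Y)) = \<tau> (X * X) + \<tau> (Y * Y) - 2 * \<tau> (X * Y)"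
    using XY by (simp add: distribs tr_simps 4)
  moreover have "complex_of_real ((x - y)\<^sup>2) * w = complex_of_real (x * x * 1) * w + complex_of_real (1 * (y * y)) * w
      - 2 * (complex_of_real (x * y) * w)" for x y w
    by (simp add: power2_eq_square algebra_simps)
  ultimately show ?thesis
    unfolding 1 2 3 D by (simp only: sum.distrib sum_subtractf sum_distrib_left)
qed

lemma tr_proj_pos:
  assumes P: "P \<in> \<H>" "P * P = P" "P \<noteq> \<O>"
  shows "0 < Re (\<tau> P)" "\<tau> P = complex_of_real (Re (\<tau> P))"
proof -
  note r = tr_proj_mult[OF P(1,2) P(1,2), unfolded P(2)]
  show "\<tau> P = complex_of_real (Re (\<tau> P))" by (rule r(1))
  have "\<tau> P \<noteq> 0" using tr_faithful[of P] P selfadjD[OF P(1)] by auto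
  then have "Re (\<tau> P) \<noteq> 0" using r(1) by (metis of_real_0)
  then show "0 < Re (\<tau> P)" using r(2) by simp
qed

lemma tr_compression_bounds:
  assumes Y: "Y \<in> \<H>" and P: "P \<in> \<H>" "P * P = P"
    and S: "\<And>y. y \<in> spectral_values Y \<Longrightarrow> a \<le> y \<and> y \<le> b"
  shows "a * Re (\<tau> P) \<le> Re (\<tau> (Y * P))" "Re (\<tau> (Y * P)) \<le> b * Re (\<tau> P)"
proof -
  let ?w = "\<lambda>y. Re (\<tau> (spectral_proj Y y * P))"
  have PA: "P \<in> \<A>" by (rule selfadjD(1)[OF P(1)])
  have w: "0 \<le> ?w y" if "y \<in> spectral_values Y" for y
    using tr_proj_mult(2)[OF E_selfadj[OF Y that] E_idem[OF Y that] P] .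
  have 1: "Re (\<tau> P) = (\<Sum>y\<in>spectral_values Y. ?w y)"
    using tr_fun_calc_mult[OF Y PA, of "\<lambda>_. 1"] PA unfolding fun_calc_one[OF Y] by simp
  have 2: "Re (\<tau> (Y * P)) = (\<Sum>y\<in>spectral_values Y. y * ?w y)"
    using tr_fun_calc_mult[OF Y PA, of "\<lambda>y. y"] unfolding fun_calc_id[OF Y] by simp
  show "a * Re (\<tau> P) \<le> Re (\<tau> (Y * P))" "Re (\<tau> (Y * P)) \<le> b * Re (\<tau> P)"
    unfolding 1 2 sum_distrib_left using S w by (auto intro!: sum_mono mult_right_mono)
qed

lemma pos_def_spectral_values:
  assumes A: "A \<in> \<A>" "pos_def_mat A" and x: "x \<in> spectral_values A"
  shows "x > 0"
proof -
  obtain v where v: "v \<in> carrier_vec n" "v \<noteq> 0\<^sub>v n" "A *\<^sub>v v = complex_of_real x \<cdot>\<^sub>v v"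
    using x carrier_matD[OF in_carrier[OF A(1)]] by (auto simp: spectral_values_def eigenvalue_def eigenvector_def)
  have "Re ((A *\<^sub>v v) \<bullet>c v) > 0"
    using A(2) v(1,2) carrier_matD[OF in_carrier[OF A(1)]] by (simp add: pos_def_mat_def)
  moreover have "(A *\<^sub>v v) \<bullet>c v = complex_of_real x * (v \<bullet>c v)" using v by simp
  ultimately have "0 < x * Re (v \<bullet>c v)" by simp
  moreover have "Re (v \<bullet>c v) = (\<Sum>i<n. (Re (vec_index v i))\<^sup>2 + (Im (vec_index v i))\<^sup>2)"
    using v(1) unfolding scalar_prod_def Re_sum
    by (intro sum.cong) (simp_all add: lessThan_atLeast0 power2_eq_square conjugate_complex_def)
  then have "0 \<le> Re (v \<bullet>c v)" by (simp add: sum_nonneg)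
  ultimately show ?thesis by (simp add: zero_less_mult_iff)
qed

text \<open>Weyl's perturbation bound, read off by compressing \<open>Y + t A\<close> with a spectral projection of \<open>Y + t A\<close>.\<close>

lemma spectral_values_perturbation:
  assumes Y: "Y \<in> \<H>" and A: "A \<in> \<H>"
    and SY: "\<And>y. y \<in> spectral_values Y \<Longrightarrow> a \<le> y \<and> y \<le> b"
    and SA: "\<And>z. z \<in> spectral_values A \<Longrightarrow> \<bar>z\<bar> \<le> K"
    and x: "x \<in> spectral_values (Y + complex_of_real t \<cdot>\<^sub>m A)"
  shows "a - \<bar>t\<bar> * K \<le> x" "x \<le> b + \<bar>t\<bar> * K"
proof -
  let ?X = "Y + complex_of_real t \<cdot>\<^sub>m A"
  have X: "?X \<in> \<H>" using Y A by (intro selfadj_add selfadj_scale)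
  let ?P = "spectral_proj ?X x"
  have P: "?P \<in> \<H>" "?P * ?P = ?P" "?P \<noteq> \<O>"
    using E_selfadj[OF X x] E_idem[OF X x] spectral_proj_nonzero[OF selfadjD[OF X] x] by auto
  define p where "p = Re (\<tau> ?P)"
  have p: "p > 0" using tr_proj_pos[OF P] by (simp add: p_def)
  have in_A: "?P \<in> \<A>" "Y \<in> \<A>" "A \<in> \<A>" using P Y A by (simp_all add: selfadjD)
  have "?X * ?P = complex_of_real x \<cdot>\<^sub>m ?P"
    by (rule mult_spectral_proj[OF selfadjD[OF X] x])
  then have "\<tau> (?X * ?P) = complex_of_real x * \<tau> ?P" using in_A by (simp add: tr_smult)
  moreover have "\<tau> (?X * ?P) = \<tau> (Y * ?P) + complex_of_real t * \<tau> (A * ?P)"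
    using in_A by (simp add: distribs tr_simps smult_mult)
  ultimately have "Re (complex_of_real x * \<tau> ?P) = Re (\<tau> (Y * ?P) + complex_of_real t * \<tau> (A * ?P))"
    by (simp only:)
  then have x_eq: "x * p = Re (\<tau> (Y * ?P)) + t * Re (\<tau> (A * ?P))" by (simp add: p_def)
  have Yb: "a * p \<le> Re (\<tau> (Y * ?P))" "Re (\<tau> (Y * ?P)) \<le> b * p"
    using tr_compression_bounds[OF Y P(1,2) SY] by (auto simp: p_def)
  have "- K * p \<le> Re (\<tau> (A * ?P))" "Re (\<tau> (A * ?P)) \<le> K * p"
    using tr_compression_bounds[OF A P(1,2), of "-K" K] SA by (force simp: p_def abs_le_iff)+
  then have "\<bar>Re (\<tau> (A * ?P))\<bar> \<le> K * p" by (simp add: abs_le_iff)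
  then have "\<bar>t * Re (\<tau> (A * ?P))\<bar> \<le> \<bar>t\<bar> * K * p" by (simp add: abs_mult mult_left_mono mult.assoc)
  then have "(a - \<bar>t\<bar> * K) * p \<le> x * p" "x * p \<le> (b + \<bar>t\<bar> * K) * p"
    using x_eq Yb by (auto simp: algebra_simps abs_le_iff)
  then show "a - \<bar>t\<bar> * K \<le> x" "x \<le> b + \<bar>t\<bar> * K" using p by simp_all
qed

text \<open>For small \<open>t\<close> the spectrum of
  \<open>\<rho> + t A\<close> stays in a fixed compact interval of positive numbers, on which the scalar remainders are
  at most \<open>C (x - y)\<^sup>2\<close>; their weighted sum is at most \<open>C t\<^sup>2 \<tau>(A\<^sup>2)\<close>.\<close>

lemma tr_fun_calc_has_derivative:
  assumes f: "f C1_differentiable_on {0<..}" "deriv f C1_differentiable_on {0<..}"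
    and \<rho>: "\<rho> \<in> \<H>" "\<And>x. x \<in> spectral_values \<rho> \<Longrightarrow> x > 0" and A: "A \<in> \<H>"
  shows "((\<lambda>t::real. \<tau> (fun_calc f (\<rho> + complex_of_real t \<cdot>\<^sub>m A))) has_vector_derivative
    \<tau> (fun_calc (deriv f) \<rho> * A)) (at 0)"
proof -
  define m where "m = Min (insert 1 (spectral_values \<rho>))"
  define b where "b = Max (insert 1 (spectral_values \<rho>))"
  define K where "K = Max (insert 0 (abs ` spectral_values A))"
  have fin: "finite (spectral_values \<rho>)" "finite (spectral_values A)" using \<rho> A by auto
  have m: "m > 0" using \<rho>(2) fin by (simp add: m_def)
  have S\<rho>: "m \<le> y \<and> y \<le> b" if "y \<in> spectral_values \<rho>" for y
    using that fin by (simp add: m_def b_def)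
  have SA: "\<bar>z\<bar> \<le> K" if "z \<in> spectral_values A" for z
    using that fin by (auto simp: K_def)
  have K0: "K \<ge> 0" using fin by (simp add: K_def)
  \<comment> \<open>Chosen so that \<open>\<bar>t\<bar> K \<le> m / 2\<close>: the perturbed spectrum stays above \<open>m / 2\<close>.\<close>
  define \<delta> where "\<delta> = m / (2 * (K + 1))"
  have \<delta>: "\<delta> > 0" using m K0 by (simp add: \<delta>_def)
  obtain C where C: "C \<ge> 0" "\<And>x y. x \<in> {m/2..b + m} \<Longrightarrow> y \<in> {m/2..b + m} \<Longrightarrow>
      \<bar>f x - f y - deriv f y * (x - y)\<bar> \<le> C * (x - y)\<^sup>2"
    using taylor_quadratic_bound[OF f, of "m/2" "b + m"] m by auto
  have \<rho>A: "\<rho> \<in> \<A>" "A \<in> \<A>" using \<rho> A by (simp_all add: selfadjD)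
  show ?thesis
  proof (rule has_vector_derivative_quadratic[OF \<delta>, where C = "C * Re (\<tau> (A * A))"])
    fix t :: real assume t: "\<bar>t\<bar> < \<delta>"
    let ?X = "\<rho> + complex_of_real t \<cdot>\<^sub>m A"
    have X: "?X \<in> \<H>" using \<rho>(1) A by (intro selfadj_add selfadj_scale)
    have tK: "\<bar>t\<bar> * K \<le> m / 2"
    proof -
      have "\<bar>t\<bar> * K \<le> \<delta> * (K + 1)" using t K0 by (intro mult_mono) auto
      also have "\<dots> = m / 2" using K0 by (simp add: \<delta>_def field_simps)
      finally show ?thesis .
    qed
    have SX: "x \<in> {m/2..b + m}" if "x \<in> spectral_values ?X" for x
      using spectral_values_perturbation[OF \<rho>(1) A S\<rho> SA that] tK m by auto
    have S\<rho>': "y \<in> {m/2..b + m}" if "y \<in> spectral_values \<rho>" for y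
      using S\<rho>[OF that] m by auto
    let ?w = "\<lambda>x y. \<tau> (spectral_proj ?X x * spectral_proj \<rho> y)"
    have w: "?w x y = complex_of_real (Re (?w x y))" "0 \<le> Re (?w x y)"
      if "x \<in> spectral_values ?X" "y \<in> spectral_values \<rho>" for x y
      using tr_proj_mult[OF E_selfadj[OF X that(1)] E_idem[OF X that(1)] E_selfadj[OF \<rho>(1) that(2)] E_idem[OF \<rho>(1) that(2)]]
      by auto
    have X\<rho>: "?X - \<rho> = complex_of_real t \<cdot>\<^sub>m A"
      using carrier_matD[OF in_carrier[OF \<rho>A(1)]] carrier_matD[OF in_carrier[OF \<rho>A(2)]] by (intro eq_matI) simp_all
    have 0: "\<rho> + complex_of_real 0 \<cdot>\<^sub>m A = \<rho>" using \<rho>A by simp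
    have "\<tau> (fun_calc (deriv f) \<rho> * (?X - \<rho>)) = of_real t * \<tau> (fun_calc (deriv f) \<rho> * A)"
      unfolding X\<rho> using \<rho>(1) \<rho>A by (simp add: smult_mult tr_smult)
    then have rem: "\<tau> (fun_calc f ?X) - \<tau> (fun_calc f (\<rho> + complex_of_real 0 \<cdot>\<^sub>m A)) - of_real t * \<tau> (fun_calc (deriv f) \<rho> * A)
      = (\<Sum>x\<in>spectral_values ?X. \<Sum>y\<in>spectral_values \<rho>. complex_of_real (f x - f y - deriv f y * (x - y)) * ?w x y)"
      unfolding 0 using tr_taylor_remainder[OF X \<rho>(1), of f "deriv f"] by simp
    have "norm (\<Sum>x\<in>spectral_values ?X. \<Sum>y\<in>spectral_values \<rho>. complex_of_real (f x - f y - deriv f y * (x - y)) * ?w x y)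
      \<le> (\<Sum>x\<in>spectral_values ?X. \<Sum>y\<in>spectral_values \<rho>.
        norm (complex_of_real (f x - f y - deriv f y * (x - y)) * ?w x y))"
      by (rule order.trans[OF norm_sum], rule sum_mono, rule norm_sum)
    also have "\<dots> \<le> (\<Sum>x\<in>spectral_values ?X. \<Sum>y\<in>spectral_values \<rho>. C * (Re (complex_of_real ((x - y)\<^sup>2) * ?w x y)))"
    proof (intro sum_mono)
      fix x y assume xy: "x \<in> spectral_values ?X" "y \<in> spectral_values \<rho>"
      have nw: "norm (?w x y) = Re (?w x y)"
      proof -
        have "norm (?w x y) = norm (complex_of_real (Re (?w x y)))" using w(1)[OF xy] by (rule arg_cong)
        then show ?thesis using w(2)[OF xy] by (simp only: norm_of_real abs_of_nonneg)
      qed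
      have "norm (complex_of_real (f x - f y - deriv f y * (x - y)) * ?w x y)
        = \<bar>f x - f y - deriv f y * (x - y)\<bar> * Re (?w x y)"
        unfolding norm_mult nw norm_of_real ..
      also have "\<dots> \<le> (C * (x - y)\<^sup>2) * Re (?w x y)"
        using C(2)[OF SX[OF xy(1)] S\<rho>'[OF xy(2)]] w(2)[OF xy] by (rule mult_right_mono)
      also have "\<dots> = C * (Re (complex_of_real ((x - y)\<^sup>2) * ?w x y))"
        by (simp only: times_complex.sel Re_complex_of_real Im_complex_of_real mult_zero_left diff_0_right mult.assoc)
      finally show "norm (complex_of_real (f x - f y - deriv f y * (x - y)) * ?w x y)
        \<le> C * (Re (complex_of_real ((x - y)\<^sup>2) * ?w x y))" .
    qed
    also have "\<dots> = C * Re (\<tau> ((?X - \<rho>) * (?X - \<rho>)))"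
      unfolding tr_square_diff[OF X \<rho>(1)] by (simp only: Re_sum sum_distrib_left)
    also have "\<dots> = C * Re (\<tau> (A * A)) * t\<^sup>2"
    proof -
      have "\<tau> ((?X - \<rho>) * (?X - \<rho>)) = complex_of_real (t\<^sup>2) * \<tau> (A * A)"
        unfolding X\<rho> using \<rho>A by (simp add: smult_mult tr_smult power2_eq_square)
      then have "Re (\<tau> ((?X - \<rho>) * (?X - \<rho>))) = t\<^sup>2 * Re (\<tau> (A * A))"
        by (simp only: times_complex.sel Re_complex_of_real Im_complex_of_real mult_zero_left diff_0_right)
      then show ?thesis by (simp only: mult_ac)
    qed
    finally show "norm (\<tau> (fun_calc f ?X) - \<tau> (fun_calc f (\<rho> + complex_of_real 0 \<cdot>\<^sub>m A)) - of_real t * \<tau> (fun_calc (deriv f) \<rho> * A))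
      \<le> C * Re (\<tau> (A * A)) * t\<^sup>2"
      unfolding rem .
  qed
qed

end



context tracial begin

lemma add_diff_add:
  assumes "A \<in> \<A>" "B \<in> \<A>" "C \<in> \<A>" "D \<in> \<A>"
  shows "(A + B) - (C + D) = (A - C) + (B - D)"
  using carrier_matD[OF in_carrier[OF assms(1)]] carrier_matD[OF in_carrier[OF assms(2)]]
    carrier_matD[OF in_carrier[OF assms(3)]] carrier_matD[OF in_carrier[OF assms(4)]]
  by (intro eq_matI) simp_all

lemma smult_diff:
  assumes "A \<in> \<A>" "B \<in> \<A>"
  shows "c \<cdot>\<^sub>m (A - B) = c \<cdot>\<^sub>m A - c \<cdot>\<^sub>m B"
  using carrier_matD[OF in_carrier[OF assms(1)]] carrier_matD[OF in_carrier[OF assms(2)]]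
  by (intro eq_matI) (simp_all add: algebra_simps)

lemma smult_diff_left:
  assumes "A \<in> \<A>"
  shows "(c - d) \<cdot>\<^sub>m A = c \<cdot>\<^sub>m A - d \<cdot>\<^sub>m A"
  using carrier_matD[OF in_carrier[OF assms(1)]]
  by (intro eq_matI) (simp_all add: algebra_simps)

lemma fun_calc_one_matrix:
  assumes "f 1 = 1"
  shows "fun_calc f \<I> = \<I>"
proof -
  note sp = one_in adj_one
  have "x = 1" if x: "x \<in> spectral_values \<I>" for x
  proof (rule ccontr)
    assume "x \<noteq> 1"
    \<comment> \<open>\<open>\<I> E = x E\<close> with \<open>x \<noteq> 1\<close> forces \<open>E = 0\<close>.\<close>
    let ?E = "spectral_proj \<I> x"
    have E: "?E \<in> \<A>" by (rule spectral_proj_in[OF sp x])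
    have "?E = complex_of_real x \<cdot>\<^sub>m ?E" using mult_spectral_proj[OF sp x] E by simp
    then have "\<tau> (mat_adjoint ?E * ?E) = \<tau> (mat_adjoint ?E * (complex_of_real x \<cdot>\<^sub>m ?E))" by simp
    then have "(1 - complex_of_real x) * \<tau> (mat_adjoint ?E * ?E) = 0"
      using E by (simp add: smult_mult tr_smult algebra_simps)
    moreover have "1 - complex_of_real x \<noteq> 0" using \<open>x \<noteq> 1\<close> by (simp add: complex_eq_iff)
    ultimately have "?E = \<O>" using tr_faithful[OF E] by simp
    then show False using spectral_proj_nonzero[OF sp x] by contradiction
  qed
  note eq_one = this
  have "fun_calc f \<I> = fun_calc (\<lambda>_. 1) \<I>"
    unfolding fun_calc_eq[OF selfadj_one]
  proof (rule msum_cong[OF refl])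
    fix x assume "x \<in> spectral_values \<I>"
    then have "f x = 1" using eq_one[of x] assms by metis
    then show "complex_of_real (f x) \<cdot>\<^sub>m spectral_proj \<I> x = complex_of_real 1 \<cdot>\<^sub>m spectral_proj \<I> x"
      by (rule arg_cong)
  qed
  then show ?thesis by (simp only: fun_calc_one[OF selfadj_one])
qed

end

section \<open>Differential structures\<close>

locale star_hom = M: tracial M + N: tracial N for M N +
  fixes h assumes hom: "unital_star_hom M N h"
begin

lemma h_in [simp]: "A \<in> ops M \<Longrightarrow> h A \<in> ops N"
  and h_one: "h (1\<^sub>m (tdim M)) = 1\<^sub>m (tdim N)"
  and h_add: "A \<in> ops M \<Longrightarrow> B \<in> ops M \<Longrightarrow> h (A + B) = h A + h B"
  and h_mult: "A \<in> ops M \<Longrightarrow> B \<in> ops M \<Longrightarrow> h (A * B) = h A * h B"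
  and h_smult: "A \<in> ops M \<Longrightarrow> h (c \<cdot>\<^sub>m A) = c \<cdot>\<^sub>m h A"
  and h_adj: "A \<in> ops M \<Longrightarrow> h (mat_adjoint A) = mat_adjoint (h A)"
  using hom unfolding unital_star_hom_def by blast+

lemma h_zero: "h (0\<^sub>m (tdim M) (tdim M)) = 0\<^sub>m (tdim N) (tdim N)"
  using h_smult[OF M.one_in, of 0] by (simp add: h_one)

lemma h_msum:
  assumes "finite S" "\<And>x. x \<in> S \<Longrightarrow> F x \<in> ops M"
  shows "h (msum (tdim M) F S) = msum (tdim N) (\<lambda>x. h (F x)) S"
  by (rule M.msum_image[OF assms h_add h_zero N.in_carrier[OF h_in]])

end

locale diff_struct =
  fixes D :: "'j differential_structure"
  assumes ds: "is_differential_structure D"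
begin

lemma fin_idx [simp]: "finite (idx D)"
  using ds unfolding is_differential_structure_def by blast

sublocale A: tracial "alg D"
  by unfold_locales (use ds in \<open>unfold is_differential_structure_def, blast\<close>)

abbreviation "d \<equiv> partial D"

lemma tracial_tgt: "j \<in> idx D \<Longrightarrow> tracial (tgt D j)"
  by unfold_locales (use ds in \<open>unfold is_differential_structure_def, blast\<close>)

lemma star_hom_lr:
  assumes "j \<in> idx D"
  shows "star_hom (alg D) (tgt D j) (lhom D j)" "star_hom (alg D) (tgt D j) (rhom D j)"
  using ds assms tracial_tgt[OF assms] A.tracial_axioms
  unfolding is_differential_structure_def star_hom_def star_hom_axioms_def by blast+

text \<open>The Dirichlet form in direction \<open>j\<close>, weighted by the elementary tensor \<open>\<ell>\<^sub>j(P) \<otimes> r\<^sub>j(Q)\<close>.\<close>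

definition dirichlet_term where
  "dirichlet_term j P Q X Y = tr (tgt D j) (mat_adjoint (d j X) * lhom D j P * d j Y * rhom D j Q)"

text \<open>The expressions that the symmetry axiom relates for \<open>V\<^sub>j\<close> and its adjoint.\<close>

definition correlation where
  "correlation j X Y = tr (tgt D j) (mat_adjoint (Vop D j) * lhom D j X * Vop D j * rhom D j Y)"

context
  fixes j assumes j: "j \<in> idx D"
begin

interpretation B: tracial "tgt D j" by (rule tracial_tgt[OF j])
interpretation L: star_hom "alg D" "tgt D j" "lhom D j" by (rule star_hom_lr[OF j])
interpretation R: star_hom "alg D" "tgt D j" "rhom D j" by (rule star_hom_lr[OF j])

lemma V_in [simp]: "Vop D j \<in> ops (tgt D j)"
  using ds j unfolding is_differential_structure_def by blast

lemma l_in: "X \<in> ops (alg D) \<Longrightarrow> lhom D j X \<in> ops (tgt D j)"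
  and r_in: "X \<in> ops (alg D) \<Longrightarrow> rhom D j X \<in> ops (tgt D j)"
  by simp_all

lemma d_in [simp]: "X \<in> ops (alg D) \<Longrightarrow> d j X \<in> ops (tgt D j)"
  by (simp add: partial_def)

lemma d_add: "X \<in> ops (alg D) \<Longrightarrow> Y \<in> ops (alg D) \<Longrightarrow> d j (X + Y) = d j X + d j Y"
  by (simp add: partial_def L.h_add R.h_add B.distribs B.add_diff_add)

lemma d_smult: "X \<in> ops (alg D) \<Longrightarrow> d j (c \<cdot>\<^sub>m X) = c \<cdot>\<^sub>m d j X"
  by (simp add: partial_def L.h_smult R.h_smult B.smult_mult B.smult_diff)

lemma adj_d: "X \<in> ops (alg D) \<Longrightarrow> mat_adjoint (d j X) =
    rhom D j (mat_adjoint X) * mat_adjoint (Vop D j) - mat_adjoint (Vop D j) * lhom D j (mat_adjoint X)"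
  by (simp add: partial_def B.adj_simps L.h_adj R.h_adj)

lemma partial_adj_props:
  assumes "Y \<in> ops (tgt D j)"
  shows "partial_adj D j Y \<in> ops (alg D)"
    "\<And>X. X \<in> ops (alg D) \<Longrightarrow> tr (tgt D j) (mat_adjoint (d j X) * Y) = tr (alg D) (mat_adjoint X * partial_adj D j Y)"
  unfolding partial_adj_def
  using adj_op_props[OF A.tracial B.tracial d_in d_add d_smult assms] by blast+

text \<open>Multiplying out the two commutators and moving \<open>r\<^sub>j(X\<^sup>*)\<close> around the trace leaves only
  correlations, to which the symmetry axiom applies.\<close>

lemma dirichlet_term_expand:
  assumes P: "P \<in> ops (alg D)" "Q \<in> ops (alg D)" "X \<in> ops (alg D)" "Y \<in> ops (alg D)"
  shows "dirichlet_term j P Q X Y = correlation j P (Y * Q * mat_adjoint X) - correlation j (P * Y) (Q * mat_adjoint X)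
    - (correlation j (mat_adjoint X * P) (Y * Q) - correlation j (mat_adjoint X * P * Y) Q)"
proof -
  define V V' a b p y z q where abbr: "V = Vop D j" "V' = mat_adjoint V"
    "a = rhom D j (mat_adjoint X)" "b = lhom D j (mat_adjoint X)" "p = lhom D j P"
    "y = rhom D j Y" "z = lhom D j Y" "q = rhom D j Q"
  have m: "V \<in> ops (tgt D j)" "V' \<in> ops (tgt D j)" "a \<in> ops (tgt D j)" "b \<in> ops (tgt D j)" "p \<in> ops (tgt D j)"
    "y \<in> ops (tgt D j)" "z \<in> ops (tgt D j)" "q \<in> ops (tgt D j)"
    using P by (simp_all add: abbr)
  have "dirichlet_term j P Q X Y = tr (tgt D j) ((a * V' - V' * b) * p * (V * y - z * V) * q)"
    using P by (simp add: dirichlet_term_def adj_d) (simp add: partial_def abbr)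
  also have "(a * V' - V' * b) * p * (V * y - z * V) * q =
     (a * (V' * (p * (V * (y * q)))) - V' * (b * (p * (V * (y * q)))))
     - (a * (V' * (p * (z * (V * q)))) - V' * (b * (p * (z * (V * q)))))"
    using m by (simp add: B.distribs B.mult_assoc)
  also have "tr (tgt D j) \<dots> =
     (tr (tgt D j) (a * (V' * (p * (V * (y * q))))) - tr (tgt D j) (a * (V' * (p * (z * (V * q))))))
     - (tr (tgt D j) (V' * (b * (p * (V * (y * q))))) - tr (tgt D j) (V' * (b * (p * (z * (V * q))))))"
    using m by (simp add: B.tr_minus)
  also have "tr (tgt D j) (a * (V' * (p * (V * (y * q))))) = tr (tgt D j) ((V' * (p * (V * (y * q)))) * a)"
    using m by (intro B.tr_comm) simp_all
  also have "tr (tgt D j) (a * (V' * (p * (z * (V * q))))) = tr (tgt D j) ((V' * (p * (z * (V * q)))) * a)"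
    using m by (intro B.tr_comm) simp_all
  also have "tr (tgt D j) ((V' * (p * (V * (y * q)))) * a) = correlation j P (Y * Q * mat_adjoint X)"
    using m P by (simp add: correlation_def R.h_mult B.mult_assoc flip: abbr)
  also have "tr (tgt D j) ((V' * (p * (z * (V * q)))) * a) = correlation j (P * Y) (Q * mat_adjoint X)"
    using m P by (simp add: correlation_def R.h_mult L.h_mult B.mult_assoc flip: abbr)
  also have "tr (tgt D j) (V' * (b * (p * (V * (y * q))))) = correlation j (mat_adjoint X * P) (Y * Q)"
    using m P by (simp add: correlation_def R.h_mult L.h_mult B.mult_assoc flip: abbr)
  also have "tr (tgt D j) (V' * (b * (p * (z * (V * q))))) = correlation j (mat_adjoint X * P * Y) Q"
    using m P by (simp add: correlation_def R.h_mult L.h_mult B.mult_assoc flip: abbr)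
  finally show ?thesis .
qed

lemma dirichlet_term_add:
  assumes "P \<in> ops (alg D)" "Q \<in> ops (alg D)" "X \<in> ops (alg D)" "Y \<in> ops (alg D)" "Z \<in> ops (alg D)"
  shows "dirichlet_term j P Q X (Y + Z) = dirichlet_term j P Q X Y + dirichlet_term j P Q X Z"
  using assms by (simp add: dirichlet_term_def d_add B.distribs B.tr_add)

lemma dirichlet_term_smult:
  assumes "P \<in> ops (alg D)" "Q \<in> ops (alg D)" "X \<in> ops (alg D)" "Y \<in> ops (alg D)"
  shows "dirichlet_term j P Q X (c \<cdot>\<^sub>m Y) = c * dirichlet_term j P Q X Y"
  using assms by (simp add: dirichlet_term_def d_smult B.smult_mult B.tr_smult)

lemma dirichlet_term_hermitian:
  assumes P: "P \<in> A.\<H>" "Q \<in> A.\<H>" and X: "X \<in> ops (alg D)" "Y \<in> ops (alg D)"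
  shows "dirichlet_term j P Q X Y = cnj (dirichlet_term j P Q Y X)"
proof -
  note PA = A.selfadjD(1)[OF P(1)] A.selfadjD(1)[OF P(2)]
  define C E p q where abbr: "C = d j X" "E = d j Y" "p = lhom D j P" "q = rhom D j Q"
  have m: "C \<in> ops (tgt D j)" "E \<in> ops (tgt D j)" "p \<in> ops (tgt D j)" "q \<in> ops (tgt D j)"
    using PA X by (simp_all add: abbr)
  have pq: "mat_adjoint p = p" "mat_adjoint q = q"
    using L.h_adj[OF PA(1)] R.h_adj[OF PA(2)] A.selfadjD(2)[OF P(1)] A.selfadjD(2)[OF P(2)]
    by (simp_all add: abbr)
  have "cnj (dirichlet_term j P Q Y X) = tr (tgt D j) (mat_adjoint (mat_adjoint E * p * C * q))"
    using m by (simp add: dirichlet_term_def B.tr_adj flip: abbr)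
  also have "mat_adjoint (mat_adjoint E * p * C * q) = q * (mat_adjoint C * (p * E))"
    using m by (simp add: B.adj_simps pq)
  also have "tr (tgt D j) \<dots> = tr (tgt D j) (mat_adjoint C * (p * E) * q)"
    using m by (intro B.tr_comm) simp_all
  also have "\<dots> = dirichlet_term j P Q X Y"
    using m by (simp add: dirichlet_term_def B.mult_assoc flip: abbr)
  finally show ?thesis by simp
qed

lemma dirichlet_term_proj:
  assumes P: "P \<in> A.\<H>" "P * P = P" and Q: "Q \<in> A.\<H>" "Q * Q = Q" and X: "X \<in> ops (alg D)"
  shows "dirichlet_term j P Q X X = complex_of_real (Re (dirichlet_term j P Q X X))" "0 \<le> Re (dirichlet_term j P Q X X)"
    "dirichlet_term j P Q X X = 0 \<Longrightarrow> lhom D j P * d j X * rhom D j Q = 0\<^sub>m (tdim (tgt D j)) (tdim (tgt D j))"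
proof -
  note PA = A.selfadjD(1)[OF P(1)] A.selfadjD(1)[OF Q(1)]
  define C p q where abbr: "C = d j X" "p = lhom D j P" "q = rhom D j Q"
  have m: "C \<in> ops (tgt D j)" "p \<in> ops (tgt D j)" "q \<in> ops (tgt D j)"
    using PA X by (simp_all add: abbr)
  have pq: "mat_adjoint p = p" "mat_adjoint q = q" "p * p = p" "q * q = q"
    using L.h_adj[OF PA(1)] R.h_adj[OF PA(2)] A.selfadjD(2)[OF P(1)] A.selfadjD(2)[OF Q(1)]
      L.h_mult[OF PA(1) PA(1)] R.h_mult[OF PA(2) PA(2)] P(2) Q(2)
    by (simp_all add: abbr)
  have "mat_adjoint (p * C * q) * (p * C * q) = q * (mat_adjoint C * ((p * p) * (C * q)))"
    using m by (simp add: B.adj_simps pq(1,2) B.mult_assoc)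
  then have "tr (tgt D j) (mat_adjoint (p * C * q) * (p * C * q)) = tr (tgt D j) (q * (mat_adjoint C * (p * (C * q))))"
    by (simp only: pq(3))
  also have "\<dots> = tr (tgt D j) ((mat_adjoint C * (p * (C * q))) * q)"
    using m by (intro B.tr_comm) simp_all
  also have "(mat_adjoint C * (p * (C * q))) * q = mat_adjoint C * p * C * (q * q)"
    using m by (simp add: B.mult_assoc)
  also have "tr (tgt D j) \<dots> = dirichlet_term j P Q X X" by (simp only: dirichlet_term_def abbr pq[unfolded abbr])
  finally have e: "dirichlet_term j P Q X X = tr (tgt D j) (mat_adjoint (p * C * q) * (p * C * q))" by (rule sym)
  have pCq: "p * C * q \<in> ops (tgt D j)" using m by simp
  show "dirichlet_term j P Q X X = complex_of_real (Re (dirichlet_term j P Q X X))" "0 \<le> Re (dirichlet_term j P Q X X)"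
    using B.tr_real[OF pCq] B.tr_nonneg[OF pCq] unfolding e by simp_all
  show "lhom D j P * d j X * rhom D j Q = 0\<^sub>m (tdim (tgt D j)) (tdim (tgt D j))" if "dirichlet_term j P Q X X = 0"
    using B.tr_faithful[OF pCq] that unfolding e abbr by blast
qed

lemma dirichlet_term_null:
  assumes P: "P \<in> ops (alg D)" "Q \<in> ops (alg D)" "X \<in> ops (alg D)" "Y \<in> ops (alg D)"
    and 0: "d j Y = 0\<^sub>m (tdim (tgt D j)) (tdim (tgt D j))"
  shows "dirichlet_term j P Q X Y = 0"
proof -
  have "mat_adjoint (d j X) * lhom D j P * 0\<^sub>m (tdim (tgt D j)) (tdim (tgt D j)) * rhom D j Q
      = 0\<^sub>m (tdim (tgt D j)) (tdim (tgt D j))"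
    using P by simp
  then show ?thesis by (simp only: dirichlet_term_def 0 B.tr_zero)
qed

end

definition star_idx :: "'j \<Rightarrow> 'j" where
  "star_idx j = (THE k. is_star_index D j k)"

lemma is_star_idx: "j \<in> idx D \<Longrightarrow> is_star_index D j (star_idx j)"
  unfolding star_idx_def by (rule theI') (use ds in \<open>unfold is_differential_structure_def, blast\<close>)

lemma star_idx_in: "j \<in> idx D \<Longrightarrow> star_idx j \<in> idx D"
  using is_star_idx unfolding is_star_index_def by blast

lemma star_idx_invol:
  assumes j: "j \<in> idx D"
  shows "star_idx (star_idx j) = j"
proof -
  interpret B: tracial "tgt D j" by (rule tracial_tgt[OF j])
  have "Vop D j = mat_adjoint (mat_adjoint (Vop D j))" using V_in[OF j] by simp
  then have "is_star_index D (star_idx j) j"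
    using is_star_idx[OF j] j unfolding is_star_index_def by metis
  moreover have "\<exists>!k. is_star_index D (star_idx j) k"
    using ds star_idx_in[OF j] unfolding is_differential_structure_def by blast
  ultimately show ?thesis using is_star_idx[OF star_idx_in[OF j]] by blast
qed

lemma star_idx_bij: "bij_betw star_idx (idx D) (idx D)"
  by (rule bij_betw_byWitness[where f' = star_idx]) (auto simp: star_idx_invol star_idx_in)

text \<open>The symmetry axiom followed by one cyclic permutation under the trace.\<close>

lemma correlation_star:
  assumes j: "j \<in> idx D" and X: "X \<in> ops (alg D)" "Y \<in> ops (alg D)"
  shows "correlation j X Y = correlation (star_idx j) Y X"
proof -
  define k where "k = star_idx j"
  have k: "k \<in> idx D" "ops (tgt D k) = ops (tgt D j)" "Vop D k = mat_adjoint (Vop D j)"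
    using is_star_idx[OF j] unfolding is_star_index_def k_def by blast+
  interpret B: tracial "tgt D j" by (rule tracial_tgt[OF j])
  let ?V = "Vop D j"
  have V: "?V \<in> ops (tgt D j)" by (rule V_in[OF j])
  have lr: "lhom D k Y \<in> ops (tgt D j)" "rhom D k X \<in> ops (tgt D j)"
    using l_in[OF k(1) X(2)] r_in[OF k(1) X(1)] by (simp_all only: k(2))
  have tr_eq: "tr (tgt D k) Z = tr (tgt D j) Z" if "Z \<in> ops (tgt D j)" for Z
    using ds j is_star_idx[OF j] that unfolding is_differential_structure_def k_def by blast
  have "correlation j X Y = tr (tgt D j) (mat_adjoint ?V * rhom D k X * ?V * lhom D k Y)"
    using ds j is_star_idx[OF j] X unfolding is_differential_structure_def k_def correlation_def by blast
  also have "mat_adjoint ?V * rhom D k X * ?V * lhom D k Y = (mat_adjoint ?V * rhom D k X) * (?V * lhom D k Y)"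
    using V lr by (simp add: B.mult_assoc)
  also have "tr (tgt D j) \<dots> = tr (tgt D j) ((?V * lhom D k Y) * (mat_adjoint ?V * rhom D k X))"
    using V lr by (intro B.tr_comm) simp_all
  also have "(?V * lhom D k Y) * (mat_adjoint ?V * rhom D k X) = mat_adjoint (Vop D k) * lhom D k Y * Vop D k * rhom D k X"
    using V lr by (simp add: B.mult_assoc k(3))
  also have "tr (tgt D j) \<dots> = correlation k Y X"
    unfolding correlation_def using V lr by (intro tr_eq[symmetric]) (simp add: k(3))
  finally show ?thesis by (simp only: k_def)
qed

text \<open>Each of the four correlations for \<open>j\<close> is one for \<open>j\<^sup>*\<close> with the two arguments exchanged. Summed over
  all directions this is what makes the generator and \<open>K\<^sub>\<rho>\<close> commute with the adjoint.\<close>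

lemma dirichlet_term_star:
  assumes j: "j \<in> idx D" and X: "P \<in> ops (alg D)" "Q \<in> ops (alg D)" "X \<in> ops (alg D)" "Y \<in> ops (alg D)"
  shows "dirichlet_term j P Q X Y = dirichlet_term (star_idx j) Q P (mat_adjoint Y) (mat_adjoint X)"
  unfolding dirichlet_term_expand[OF j X]
  using dirichlet_term_expand[OF star_idx_in[OF j] X(2,1), of "mat_adjoint Y" "mat_adjoint X"] X
  by (simp add: correlation_star[OF j])

text \<open>The common kernel of the derivations. It is the kernel of \<open>K\<^sub>\<rho>\<close> for every self-adjoint \<open>\<rho>\<close>
  and every symmetric positive weight, so all these operators have the same range.\<close>

definition nullspace where
  "nullspace = {X \<in> ops (alg D). \<forall>j\<in>idx D. d j X = 0\<^sub>m (tdim (tgt D j)) (tdim (tgt D j))}"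

definition perp where
  "perp Y \<longleftrightarrow> Y \<in> ops (alg D) \<and> (\<forall>Z\<in>nullspace. tr (alg D) (mat_adjoint Z * Y) = 0)"

text \<open>For \<open>\<sigma> = 1\<close> this is the tangent space. The description through the null space lets every \<open>K\<^sub>\<rho>\<close> act
  on it.\<close>

definition null_perp where
  "null_perp = {Y \<in> A.\<H>. perp Y}"

lemma nullspace_sub: "nullspace \<subseteq> ops (alg D)"
  by (auto simp: nullspace_def)

lemma nullspace_add: "X \<in> nullspace \<Longrightarrow> Y \<in> nullspace \<Longrightarrow> X + Y \<in> nullspace"
  by (simp add: nullspace_def d_add)

lemma nullspace_smult: "X \<in> nullspace \<Longrightarrow> c \<cdot>\<^sub>m X \<in> nullspace"
  by (simp add: nullspace_def d_smult)

lemma nullspace_zero: "0\<^sub>m (tdim (alg D)) (tdim (alg D)) \<in> nullspace"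
proof -
  have "d j A.\<O> = 0\<^sub>m (tdim (tgt D j)) (tdim (tgt D j))" if j: "j \<in> idx D" for j
  proof -
    interpret B: tracial "tgt D j" by (rule tracial_tgt[OF j])
    show ?thesis using d_smult[OF j A.one_in, of 0] d_in[OF j A.one_in] by simp
  qed
  then show ?thesis by (simp add: nullspace_def)
qed

lemma perp_minus: "perp X \<Longrightarrow> perp Y \<Longrightarrow> perp (X - Y)"
  using nullspace_sub by (auto simp: perp_def A.distribs A.tr_simps subset_iff)

end

section \<open>The operator \<open>K\<^sub>\<rho>\<close>\<close>

text \<open>The weight enters only through its values on the spectrum of \<open>\<rho>\<close>. The constant weight \<open>1\<close> is
  included on purpose: it makes \<open>K\<^sub>\<rho>\<close> the negative generator when \<open>\<sigma> = 1\<close>, so that everything proved about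
  \<open>K\<^sub>\<rho>\<close> holds for the generator too.\<close>

locale weighted = diff_struct D for D :: "'j differential_structure" +
  fixes \<rho> :: "complex mat" and th :: "real \<Rightarrow> real \<Rightarrow> real"
  assumes \<rho>: "\<rho> \<in> self_adjoint_ops (alg D)"
    and th_sym: "\<And>x y. x \<in> spectral_values \<rho> \<Longrightarrow> y \<in> spectral_values \<rho> \<Longrightarrow> th x y = th y x"
    and th_pos: "\<And>x y. x \<in> spectral_values \<rho> \<Longrightarrow> y \<in> spectral_values \<rho> \<Longrightarrow> 0 < th x y"
begin

abbreviation "S \<equiv> spectral_values \<rho>"
abbreviation "E \<equiv> spectral_proj \<rho>"
abbreviation "K \<equiv> Kop D (\<lambda>_. th) \<rho>"
abbreviation "hat \<equiv> rho_hat_contract D (\<lambda>_. th)"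

lemma fin_S [simp]: "finite S" by (rule A.fin[OF \<rho>])

lemma E_in [simp]: "x \<in> S \<Longrightarrow> E x \<in> ops (alg D)" by (rule A.E_in[OF \<rho>])

lemma E_sa: "x \<in> S \<Longrightarrow> E x \<in> A.\<H>" by (rule A.E_selfadj[OF \<rho>])

lemma E_idem: "x \<in> S \<Longrightarrow> E x * E x = E x" by (rule A.E_idem[OF \<rho>])

text \<open>For an arbitrary family of weights, because the chain rule compares \<open>th\<close> with the constant weight.\<close>

lemma hat_eq: "rho_hat_contract D \<theta> j \<rho> C = msum (tdim (tgt D j))
    (\<lambda>z. complex_of_real (\<theta> j (fst z) (snd z)) \<cdot>\<^sub>m (lhom D j (E (fst z)) * C * rhom D j (E (snd z)))) (S \<times> S)"
  by (simp add: rho_hat_contract_def split_def)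

lemma block_in:
  assumes "j \<in> idx D" "C \<in> ops (tgt D j)" "z \<in> S \<times> S"
  shows "lhom D j (E (fst z)) * C * rhom D j (E (snd z)) \<in> ops (tgt D j)"
proof -
  interpret B: tracial "tgt D j" by (rule tracial_tgt[OF assms(1)])
  have "lhom D j (E (fst z)) \<in> ops (tgt D j)" "rhom D j (E (snd z)) \<in> ops (tgt D j)"
    using assms(3) by (auto intro!: l_in[OF assms(1)] r_in[OF assms(1)])
  then show ?thesis using assms(2) by simp
qed

lemma hat_in:
  assumes "j \<in> idx D" "C \<in> ops (tgt D j)"
  shows "hat j \<rho> C \<in> ops (tgt D j)"
proof -
  interpret B: tracial "tgt D j" by (rule tracial_tgt[OF assms(1)])
  show ?thesis unfolding hat_eq using block_in[OF assms] by (intro B.msum_in) simp_all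
qed

lemma msum_blocks:
  assumes j: "j \<in> idx D" and C: "C \<in> ops (tgt D j)"
  shows "msum (tdim (tgt D j)) (\<lambda>z. lhom D j (E (fst z)) * C * rhom D j (E (snd z))) (S \<times> S) = C"
proof -
  interpret B: tracial "tgt D j" by (rule tracial_tgt[OF j])
  interpret L: star_hom "alg D" "tgt D j" "lhom D j" by (rule star_hom_lr[OF j])
  interpret R: star_hom "alg D" "tgt D j" "rhom D j" by (rule star_hom_lr[OF j])
  have l1: "msum (tdim (tgt D j)) (\<lambda>x. lhom D j (E x)) S = B.\<I>"
    using L.h_msum[of S E] by (simp add: A.msum_spectral_proj[OF A.selfadjD[OF \<rho>]] L.h_one)
  have r1: "msum (tdim (tgt D j)) (\<lambda>y. rhom D j (E y)) S = B.\<I>"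
    using R.h_msum[of S E] by (simp add: A.msum_spectral_proj[OF A.selfadjD[OF \<rho>]] R.h_one)
  have "msum (tdim (tgt D j)) (\<lambda>z. lhom D j (E (fst z)) * C * rhom D j (E (snd z))) (S \<times> S)
    = msum (tdim (tgt D j)) (\<lambda>x. msum (tdim (tgt D j)) (\<lambda>y. lhom D j (E x) * C * rhom D j (E y)) S) S"
    using msum_Times[of "tdim (tgt D j)" "\<lambda>x y. lhom D j (E x) * C * rhom D j (E y)" S S] by (simp add: split_def)
  also have "\<dots> = msum (tdim (tgt D j)) (\<lambda>x. lhom D j (E x) * C) S"
  proof (rule msum_cong[OF refl])
    fix x assume x: "x \<in> S"
    have "msum (tdim (tgt D j)) (\<lambda>y. lhom D j (E x) * C * rhom D j (E y)) S
      = (lhom D j (E x) * C) * msum (tdim (tgt D j)) (\<lambda>y. rhom D j (E y)) S"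
      using x C by (intro B.msum_mult(2)[symmetric]) simp_all
    also have "\<dots> = lhom D j (E x) * C" unfolding r1 using x C by (intro B.units) simp_all
    finally show "msum (tdim (tgt D j)) (\<lambda>y. lhom D j (E x) * C * rhom D j (E y)) S = lhom D j (E x) * C" .
  qed
  also have "\<dots> = msum (tdim (tgt D j)) (\<lambda>x. lhom D j (E x)) S * C"
    using C by (intro B.msum_mult(1)[symmetric]) simp_all
  also have "\<dots> = C" unfolding l1 by (rule B.units[OF C])
  finally show ?thesis .
qed

definition dirichlet where
  "dirichlet X Y = (\<Sum>j\<in>idx D. \<Sum>z\<in>S \<times> S. complex_of_real (th (fst z) (snd z)) * dirichlet_term j (E (fst z)) (E (snd z)) X Y)"

lemma K_in:
  assumes Y: "Y \<in> ops (alg D)"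
  shows "K Y \<in> ops (alg D)"
  unfolding Kop_def using partial_adj_props(1) hat_in d_in Y by (intro A.msum_in) simp_all

lemma tr_hat:
  assumes j: "j \<in> idx D" and X: "X \<in> ops (alg D)" and Y: "Y \<in> ops (alg D)"
  shows "tr (tgt D j) (mat_adjoint (d j X) * hat j \<rho> (d j Y)) =
    (\<Sum>z\<in>S \<times> S. complex_of_real (th (fst z) (snd z)) * dirichlet_term j (E (fst z)) (E (snd z)) X Y)"
proof -
  interpret B: tracial "tgt D j" by (rule tracial_tgt[OF j])
  note dj = d_in[OF j X] d_in[OF j Y]
  note m = block_in[OF j d_in[OF j Y]]
  have "mat_adjoint (d j X) * hat j \<rho> (d j Y) = msum (tdim (tgt D j)) (\<lambda>z. mat_adjoint (d j X) *
     (complex_of_real (th (fst z) (snd z)) \<cdot>\<^sub>m (lhom D j (E (fst z)) * d j Y * rhom D j (E (snd z))))) (S \<times> S)"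
    unfolding hat_eq using m dj by (intro B.msum_mult(2)) simp_all
  then have "tr (tgt D j) (mat_adjoint (d j X) * hat j \<rho> (d j Y)) = (\<Sum>z\<in>S \<times> S. tr (tgt D j) (mat_adjoint (d j X) *
     (complex_of_real (th (fst z) (snd z)) \<cdot>\<^sub>m (lhom D j (E (fst z)) * d j Y * rhom D j (E (snd z))))))"
    using m dj by (simp only:) (intro B.tr_msum, simp_all)
  also have "\<dots> = (\<Sum>z\<in>S \<times> S. complex_of_real (th (fst z) (snd z)) * dirichlet_term j (E (fst z)) (E (snd z)) X Y)"
  proof (rule sum.cong[OF refl])
    fix z assume z: "z \<in> S \<times> S"
    then have lr: "lhom D j (E (fst z)) \<in> ops (tgt D j)" "rhom D j (E (snd z)) \<in> ops (tgt D j)"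
      by (auto intro!: l_in[OF j] r_in[OF j])
    then show "tr (tgt D j) (mat_adjoint (d j X) *
     (complex_of_real (th (fst z) (snd z)) \<cdot>\<^sub>m (lhom D j (E (fst z)) * d j Y * rhom D j (E (snd z)))))
      = complex_of_real (th (fst z) (snd z)) * dirichlet_term j (E (fst z)) (E (snd z)) X Y"
      using dj by (simp add: dirichlet_term_def B.smult_mult B.tr_smult B.mult_assoc)
  qed
  finally show ?thesis .
qed

lemma tr_K:
  assumes X: "X \<in> ops (alg D)" and Y: "Y \<in> ops (alg D)"
  shows "tr (alg D) (mat_adjoint X * K Y) = dirichlet X Y"
proof -
  have p: "partial_adj D j (hat j \<rho> (d j Y)) \<in> ops (alg D)" if "j \<in> idx D" for j
    using partial_adj_props(1)[OF that hat_in[OF that d_in[OF that Y]]] .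
  have "mat_adjoint X * K Y = msum (tdim (alg D)) (\<lambda>j. mat_adjoint X * partial_adj D j (hat j \<rho> (d j Y))) (idx D)"
    unfolding Kop_def using p X by (intro A.msum_mult(2)) simp_all
  then have "tr (alg D) (mat_adjoint X * K Y) = (\<Sum>j\<in>idx D. tr (alg D) (mat_adjoint X * partial_adj D j (hat j \<rho> (d j Y))))"
    using p X by (simp only:) (intro A.tr_msum, simp_all)
  also have "\<dots> = dirichlet X Y"
    unfolding dirichlet_def
  proof (rule sum.cong[OF refl])
    fix j assume j: "j \<in> idx D"
    show "tr (alg D) (mat_adjoint X * partial_adj D j (hat j \<rho> (d j Y))) =
      (\<Sum>z\<in>S \<times> S. complex_of_real (th (fst z) (snd z)) * dirichlet_term j (E (fst z)) (E (snd z)) X Y)"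
      using partial_adj_props(2)[OF j hat_in[OF j d_in[OF j Y]] X] tr_hat[OF j X Y] by simp
  qed
  finally show ?thesis .
qed

lemma dirichlet_add: "X \<in> ops (alg D) \<Longrightarrow> Y \<in> ops (alg D) \<Longrightarrow> Z \<in> ops (alg D) \<Longrightarrow> dirichlet X (Y + Z) = dirichlet X Y + dirichlet X Z"
  unfolding dirichlet_def sum.distrib[symmetric] distrib_left[symmetric]
  by (intro sum.cong refl arg_cong2[of _ _ _ _ "(*)"] dirichlet_term_add) auto

lemma dirichlet_smult: "X \<in> ops (alg D) \<Longrightarrow> Y \<in> ops (alg D) \<Longrightarrow> dirichlet X (c \<cdot>\<^sub>m Y) = c * dirichlet X Y"
  unfolding dirichlet_def sum_distrib_left mult.left_commute[of c]
  by (intro sum.cong refl arg_cong2[of _ _ _ _ "(*)"] dirichlet_term_smult) auto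

lemma dirichlet_minus: "X \<in> ops (alg D) \<Longrightarrow> Y \<in> ops (alg D) \<Longrightarrow> Z \<in> ops (alg D) \<Longrightarrow> dirichlet X (Y - Z) = dirichlet X Y - dirichlet X Z"
  by (simp add: A.minus_eq dirichlet_add dirichlet_smult)

lemma dirichlet_hermitian: "X \<in> ops (alg D) \<Longrightarrow> Y \<in> ops (alg D) \<Longrightarrow> dirichlet X Y = cnj (dirichlet Y X)"
  unfolding dirichlet_def cnj_sum complex_cnj_mult complex_cnj_complex_of_real
  by (intro sum.cong refl arg_cong2[of _ _ _ _ "(*)"] dirichlet_term_hermitian) (auto intro: E_sa)

lemma dirichlet_null_right:
  assumes "X \<in> ops (alg D)" "Y \<in> nullspace"
  shows "dirichlet X Y = 0"
proof -
  have "dirichlet_term j (E (fst z)) (E (snd z)) X Y = 0" if "j \<in> idx D" "z \<in> S \<times> S" for j z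
    using that assms by (intro dirichlet_term_null) (auto simp: nullspace_def)
  then show ?thesis by (simp add: dirichlet_def)
qed

text \<open>All summands are non-negative, so if the total is zero then every block \<open>\<ell>\<^sub>j(E\<^sub>x) (\<partial>\<^sub>j X) r\<^sub>j(E\<^sub>y)\<close>
  vanishes, and these blocks add up to \<open>\<partial>\<^sub>j X\<close>.\<close>

lemma dirichlet_zero_null:
  assumes X: "X \<in> ops (alg D)" and 0: "dirichlet X X = 0"
  shows "X \<in> nullspace"
proof -
  let ?c = "\<lambda>j z. Re (dirichlet_term j (E (fst z)) (E (snd z)) X X)"
  have c: "dirichlet_term j (E (fst z)) (E (snd z)) X X = complex_of_real (?c j z)" "0 \<le> ?c j z"
    if "j \<in> idx D" "z \<in> S \<times> S" for j z
  proof -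
    have z: "fst z \<in> S" "snd z \<in> S" using that(2) by auto
    show "dirichlet_term j (E (fst z)) (E (snd z)) X X = complex_of_real (?c j z)" "0 \<le> ?c j z"
      using dirichlet_term_proj(1,2)[OF that(1) E_sa[OF z(1)] E_idem[OF z(1)] E_sa[OF z(2)] E_idem[OF z(2)] X] by simp_all
  qed
  have th: "0 < th (fst z) (snd z)" if "z \<in> S \<times> S" for z using that th_pos by auto
  have "dirichlet X X = complex_of_real (\<Sum>j\<in>idx D. \<Sum>z\<in>S \<times> S. th (fst z) (snd z) * ?c j z)"
    unfolding dirichlet_def of_real_sum of_real_mult
    by (intro sum.cong refl arg_cong2[of _ _ _ _ "(*)"] c(1))
  then have "(\<Sum>j\<in>idx D. \<Sum>z\<in>S \<times> S. th (fst z) (snd z) * ?c j z) = 0"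
    unfolding 0 by (simp only: of_real_eq_0_iff[symmetric, where ?'a = complex])
  note sum0 = this
  have nn: "0 \<le> th (fst z) (snd z) * ?c j z" if "j \<in> idx D" "z \<in> S \<times> S" for j z
    using c(2)[OF that] th[OF that(2)] by simp
  have "(\<Sum>z\<in>S \<times> S. th (fst z) (snd z) * ?c j z) = 0" if "j \<in> idx D" for j
    using sum_nonneg_0[OF fin_idx _ sum0 that] nn by (simp add: sum_nonneg)
  then have z0: "th (fst z) (snd z) * ?c j z = 0" if "j \<in> idx D" "z \<in> S \<times> S" for j z
    using sum_nonneg_0[of "S \<times> S" "\<lambda>z. th (fst z) (snd z) * ?c j z" z] nn that by simp
  have "d j X = 0\<^sub>m (tdim (tgt D j)) (tdim (tgt D j))" if j: "j \<in> idx D" for j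
  proof -
    interpret B: tracial "tgt D j" by (rule tracial_tgt[OF j])
    have "lhom D j (E (fst z)) * d j X * rhom D j (E (snd z)) = B.\<O>" if z: "z \<in> S \<times> S" for z
    proof -
      have zz: "fst z \<in> S" "snd z \<in> S" using z by auto
      have "dirichlet_term j (E (fst z)) (E (snd z)) X X = 0"
        using z0[OF j z] th[OF z] c(1)[OF j z] by simp
      then show ?thesis
        by (rule dirichlet_term_proj(3)[OF j E_sa[OF zz(1)] E_idem[OF zz(1)] E_sa[OF zz(2)] E_idem[OF zz(2)] X])
    qed
    note comp0 = this
    have "d j X = msum (tdim (tgt D j)) (\<lambda>z. lhom D j (E (fst z)) * d j X * rhom D j (E (snd z))) (S \<times> S)"
      by (rule msum_blocks[OF j d_in[OF j X], symmetric])
    also have "\<dots> = msum (tdim (tgt D j)) (\<lambda>z. B.\<O>) (S \<times> S)"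
      by (rule msum_cong[OF refl comp0])
    also have "\<dots> = B.\<O>" by (rule eq_matI) (simp_all add: msum_def)
    finally show ?thesis .
  qed
  then show ?thesis using X by (simp add: nullspace_def)
qed

text \<open>Exchanging \<open>j\<close> with \<open>j\<^sup>*\<close> swaps the two spectral variables, which a symmetric weight does not see.\<close>

lemma dirichlet_star:
  assumes X: "X \<in> ops (alg D)" "Y \<in> ops (alg D)"
  shows "dirichlet X Y = dirichlet (mat_adjoint Y) (mat_adjoint X)"
proof -
  let ?g = "\<lambda>j z. complex_of_real (th (fst z) (snd z)) * dirichlet_term j (E (fst z)) (E (snd z)) (mat_adjoint Y) (mat_adjoint X)"
  have swap: "bij_betw prod.swap (S \<times> S) (S \<times> S)"
    by (rule bij_betw_byWitness[where f' = prod.swap]) auto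
  have "dirichlet X Y = (\<Sum>j\<in>idx D. \<Sum>z\<in>S \<times> S. ?g (star_idx j) (prod.swap z))"
    unfolding dirichlet_def
  proof (intro sum.cong refl arg_cong2[of _ _ _ _ "(*)"])
    fix j z assume j: "j \<in> idx D" and z: "z \<in> S \<times> S"
    show "complex_of_real (th (fst z) (snd z)) = complex_of_real (th (fst (prod.swap z)) (snd (prod.swap z)))"
      using z th_sym by auto
    show "dirichlet_term j (E (fst z)) (E (snd z)) X Y =
      dirichlet_term (star_idx j) (E (fst (prod.swap z))) (E (snd (prod.swap z))) (mat_adjoint Y) (mat_adjoint X)"
      using dirichlet_term_star[OF j _ _ X, of "E (fst z)" "E (snd z)"] z by auto
  qed
  also have "\<dots> = (\<Sum>j\<in>idx D. \<Sum>z\<in>S \<times> S. ?g (star_idx j) z)"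
    by (intro sum.cong refl sum.reindex_bij_betw[OF swap])
  also have "\<dots> = (\<Sum>j\<in>idx D. \<Sum>z\<in>S \<times> S. ?g j z)"
    by (rule sum.reindex_bij_betw[OF star_idx_bij])
  finally show ?thesis by (simp only: dirichlet_def)
qed

lemma K_ext:
  assumes X: "X \<in> ops (alg D)" "Y \<in> ops (alg D)" "\<And>Z. Z \<in> ops (alg D) \<Longrightarrow> tr (alg D) (mat_adjoint Z * X) = dirichlet Z Y"
  shows "X = K Y"
  by (rule A.inner_ext[OF X(1) K_in[OF X(2)]]) (simp add: X tr_K)

lemma K_adj:
  assumes Y: "Y \<in> ops (alg D)"
  shows "mat_adjoint (K Y) = K (mat_adjoint Y)"
proof (rule K_ext)
  fix Z assume Z: "Z \<in> ops (alg D)"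
  have "tr (alg D) (mat_adjoint Z * mat_adjoint (K Y)) = tr (alg D) (mat_adjoint (K Y * Z))"
    using Z K_in[OF Y] by (simp add: A.adj_simps)
  also have "\<dots> = cnj (tr (alg D) (Z * K Y))"
    using Z K_in[OF Y] by (simp add: A.tr_adj A.tr_comm[of Z])
  also have "\<dots> = cnj (dirichlet (mat_adjoint Z) Y)" using tr_K[of "mat_adjoint Z" Y] Z Y by simp
  also have "\<dots> = dirichlet Y (mat_adjoint Z)" using dirichlet_hermitian[of Y "mat_adjoint Z"] Y Z by simp
  also have "\<dots> = dirichlet Z (mat_adjoint Y)" using dirichlet_star[of Y "mat_adjoint Z"] Y Z by simp
  finally show "tr (alg D) (mat_adjoint Z * mat_adjoint (K Y)) = dirichlet Z (mat_adjoint Y)" .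
qed (use Y K_in in simp_all)

lemma nullspace_adj:
  assumes Z: "Z \<in> nullspace"
  shows "mat_adjoint Z \<in> nullspace"
proof (rule dirichlet_zero_null)
  have ZA: "Z \<in> ops (alg D)" by (rule subsetD[OF nullspace_sub Z])
  then show "mat_adjoint Z \<in> ops (alg D)" by (rule A.adj_in)
  show "dirichlet (mat_adjoint Z) (mat_adjoint Z) = 0"
    using dirichlet_star[OF ZA ZA] dirichlet_null_right[OF ZA Z] by simp
qed

lemma perp_adj:
  assumes Y: "perp Y"
  shows "perp (mat_adjoint Y)"
proof -
  have YA: "Y \<in> ops (alg D)" using Y by (simp add: perp_def)
  have "tr (alg D) (mat_adjoint Z * mat_adjoint Y) = 0" if Z: "Z \<in> nullspace" for Z
  proof -
    have ZA: "Z \<in> ops (alg D)" by (rule subsetD[OF nullspace_sub Z])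
    have "tr (alg D) (mat_adjoint Z * mat_adjoint Y) = cnj (tr (alg D) (Y * Z))"
      using A.tr_adj[of "Y * Z"] YA ZA by (simp add: A.adj_simps)
    also have "\<dots> = cnj (tr (alg D) (mat_adjoint (mat_adjoint Z) * Y))"
      using YA ZA by (simp add: A.tr_comm[of Y])
    also have "\<dots> = 0" using Y nullspace_adj[OF Z] by (simp add: perp_def)
    finally show ?thesis .
  qed
  then show ?thesis using YA by (simp add: perp_def)
qed

lemma K_perp:
  assumes Y: "Y \<in> ops (alg D)"
  shows "perp (K Y)"
proof -
  have "tr (alg D) (mat_adjoint Z * K Y) = 0" if Z: "Z \<in> nullspace" for Z
  proof -
    have ZA: "Z \<in> ops (alg D)" by (rule subsetD[OF nullspace_sub Z])
    show ?thesis using tr_K[OF ZA Y] dirichlet_hermitian[OF ZA Y] dirichlet_null_right[OF Y Z] by simp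
  qed
  then show ?thesis using K_in[OF Y] by (simp add: perp_def)
qed

lemma K_null_diff:
  assumes X: "X \<in> ops (alg D)" "Y \<in> ops (alg D)" "K X = K Y"
  shows "X - Y \<in> nullspace"
proof (rule dirichlet_zero_null)
  show XY: "X - Y \<in> ops (alg D)" using X by simp
  have "dirichlet (X - Y) (X - Y) = dirichlet (X - Y) X - dirichlet (X - Y) Y" using X by (intro dirichlet_minus) simp_all
  then show "dirichlet (X - Y) (X - Y) = 0"
    using tr_K[OF XY X(1)] tr_K[OF XY X(2)] X(3) by simp
qed

lemma null_perp_zero:
  assumes "X \<in> nullspace" "perp X"
  shows "X = 0\<^sub>m (tdim (alg D)) (tdim (alg D))"
  using A.tr_faithful[of X] assms by (simp add: perp_def)

lemma K_inj_perp:
  assumes X: "perp X" "perp Y" "K X = K Y"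
  shows "X = Y"
proof -
  have XY: "X \<in> ops (alg D)" "Y \<in> ops (alg D)" using X by (simp_all add: perp_def)
  show ?thesis
    by (rule A.diff_zero_eq[OF XY null_perp_zero[OF K_null_diff[OF XY X(3)] perp_minus[OF X(1,2)]]])
qed

text \<open>The Riesz representation for the degenerate Dirichlet form gives some preimage of \<open>Y\<close>; removing its
  component in the null space does not change the image.\<close>

lemma K_surj_perp:
  assumes Y: "perp Y"
  shows "\<exists>X. perp X \<and> K X = Y"
proof -
  have YA: "Y \<in> ops (alg D)" using Y by (simp add: perp_def)
  have "\<exists>X\<in>ops (alg D). \<forall>Z\<in>ops (alg D). tr (alg D) (mat_adjoint Y * Z) = dirichlet X Z"
  proof (rule A.riesz)
    show "dirichlet X Z = 0" if "X \<in> ops (alg D)" "Z \<in> ops (alg D)" "dirichlet X X = 0" for X Z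
      using dirichlet_hermitian[OF that(1,2)] dirichlet_null_right[OF that(2) dirichlet_zero_null[OF that(1,3)]] by simp
    show "tr (alg D) (mat_adjoint Y * Z) = 0" if "Z \<in> ops (alg D)" "dirichlet Z Z = 0" for Z
      using A.inner_commute[OF YA that(1)] Y dirichlet_zero_null[OF that] by (simp add: perp_def)
    show "dirichlet X Z = cnj (dirichlet Z X)" if "X \<in> ops (alg D)" "Z \<in> ops (alg D)" for X Z
      by (rule dirichlet_hermitian[OF that])
  qed (simp_all add: dirichlet_add dirichlet_smult YA A.distribs A.smult_mult A.tr_simps)
  then obtain X where X: "X \<in> ops (alg D)" "\<And>Z. Z \<in> ops (alg D) \<Longrightarrow> tr (alg D) (mat_adjoint Y * Z) = dirichlet X Z"
    by blast
  have "\<exists>P\<in>nullspace. \<forall>Z\<in>nullspace. tr (alg D) (mat_adjoint X * Z) = tr (alg D) (mat_adjoint P * Z)"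
  proof (rule A.riesz_tr[OF nullspace_sub nullspace_zero nullspace_add nullspace_smult])
    fix Z W assume ZW: "Z \<in> nullspace" "W \<in> nullspace"
    show "tr (alg D) (mat_adjoint X * (Z + W)) = tr (alg D) (mat_adjoint X * Z) + tr (alg D) (mat_adjoint X * W)"
      using X(1) subsetD[OF nullspace_sub ZW(1)] subsetD[OF nullspace_sub ZW(2)]
      by (simp add: A.distribs A.tr_simps)
  next
    fix Z c assume Z: "Z \<in> nullspace"
    show "tr (alg D) (mat_adjoint X * (c \<cdot>\<^sub>m Z)) = c * tr (alg D) (mat_adjoint X * Z)"
      using X(1) subsetD[OF nullspace_sub Z] by (simp add: A.smult_mult A.tr_simps)
  qed
  then obtain P where P: "P \<in> nullspace" "\<And>Z. Z \<in> nullspace \<Longrightarrow> tr (alg D) (mat_adjoint X * Z) = tr (alg D) (mat_adjoint P * Z)"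
    by blast
  have PA: "P \<in> ops (alg D)" by (rule subsetD[OF nullspace_sub P(1)])
  have perp: "perp (X - P)"
    unfolding perp_def
  proof (intro conjI ballI)
    show "X - P \<in> ops (alg D)" using X(1) PA by simp
    fix Z assume Z: "Z \<in> nullspace"
    have ZA: "Z \<in> ops (alg D)" by (rule subsetD[OF nullspace_sub Z])
    have "tr (alg D) (mat_adjoint Z * (X - P)) = tr (alg D) (mat_adjoint Z * X) - tr (alg D) (mat_adjoint Z * P)"
      using ZA X(1) PA by (simp add: A.distribs A.tr_simps)
    then show "tr (alg D) (mat_adjoint Z * (X - P)) = 0"
      using A.inner_commute[OF ZA X(1)] A.inner_commute[OF ZA PA] P(2)[OF Z] by simp
  qed
  have "Y = K (X - P)"
  proof (rule K_ext[OF YA])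
    show "X - P \<in> ops (alg D)" using X(1) PA by simp
    fix Z assume Z: "Z \<in> ops (alg D)"
    show "tr (alg D) (mat_adjoint Z * Y) = dirichlet Z (X - P)"
      using A.inner_commute[OF Z YA] X(2)[OF Z] dirichlet_hermitian[OF Z X(1)] dirichlet_minus[OF Z X(1) PA]
        dirichlet_null_right[OF Z P(1)] by simp
  qed
  then show ?thesis using perp by metis
qed

lemma K_null_perp:
  assumes "X \<in> A.\<H>"
  shows "K X \<in> null_perp"
  unfolding null_perp_def
proof (intro CollectI conjI A.selfadjI)
  have X: "X \<in> ops (alg D)" by (rule A.selfadjD(1)[OF assms])
  show "K X \<in> ops (alg D)" by (rule K_in[OF X])
  show "mat_adjoint (K X) = K X" using K_adj[OF X] by (simp only: A.selfadjD(2)[OF assms])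
  show "perp (K X)" by (rule K_perp[OF X])
qed

lemma K_inj_on: "inj_on K null_perp"
  by (rule inj_onI, rule K_inj_perp) (simp_all add: null_perp_def)

text \<open>The preimage orthogonal to the null space is unique, so for self-adjoint \<open>Y\<close> it equals its own
  adjoint.\<close>

lemma K_surj:
  assumes Y: "Y \<in> null_perp"
  shows "\<exists>X\<in>null_perp. K X = Y"
proof -
  have YH: "Y \<in> A.\<H>" "perp Y" using Y by (simp_all add: null_perp_def)
  obtain X where X: "perp X" "K X = Y" using K_surj_perp[OF YH(2)] by blast
  have XA: "X \<in> ops (alg D)" using X(1) by (simp add: perp_def)
  have "K (mat_adjoint X) = K X"
    using K_adj[OF XA] A.selfadjD(2)[OF YH(1)] by (simp only: X(2))
  then have "mat_adjoint X = X" by (rule K_inj_perp[OF perp_adj[OF X(1)] X(1)])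
  then have "X \<in> null_perp" using X(1) XA by (simp add: null_perp_def A.selfadjI)
  then show ?thesis using X(2) by blast
qed

lemma K_uminus:
  assumes "X \<in> ops (alg D)"
  shows "K (- X) = - K X"
proof (rule K_ext[symmetric])
  fix Z assume Z: "Z \<in> ops (alg D)"
  show "tr (alg D) (mat_adjoint Z * - K X) = dirichlet Z (- X)"
    using Z assms K_in[OF assms] tr_K[OF Z assms] by (simp add: A.uminus_eq A.smult_mult A.tr_smult dirichlet_smult)
qed (use assms K_in in simp_all)

text \<open>Each block of the derivation sees only an increment of \<open>g\<close>, since \<open>g(\<rho>)\<close> is a scalar on every
  spectral subspace.\<close>

lemma partial_fun_calc_block:
  assumes j: "j \<in> idx D" and x: "x \<in> S" "y \<in> S"
  shows "lhom D j (E x) * d j (fun_calc g \<rho>) * rhom D j (E y) =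
    complex_of_real (g y - g x) \<cdot>\<^sub>m (lhom D j (E x) * Vop D j * rhom D j (E y))"
proof -
  interpret B: tracial "tgt D j" by (rule tracial_tgt[OF j])
  interpret L: star_hom "alg D" "tgt D j" "lhom D j" by (rule star_hom_lr[OF j])
  interpret R: star_hom "alg D" "tgt D j" "rhom D j" by (rule star_hom_lr[OF j])
  have g: "fun_calc g \<rho> \<in> ops (alg D)" by (rule A.fun_calc_in[OF \<rho>])
  have V: "Vop D j \<in> ops (tgt D j)" by (rule V_in[OF j])
  have lx: "lhom D j (E x) * lhom D j (fun_calc g \<rho>) = complex_of_real (g x) \<cdot>\<^sub>m lhom D j (E x)"
    using x g A.spectral_proj_fun_calc(1)[OF \<rho> x(1), of g] by (simp add: L.h_mult[symmetric] L.h_smult)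
  have ry: "rhom D j (fun_calc g \<rho>) * rhom D j (E y) = complex_of_real (g y) \<cdot>\<^sub>m rhom D j (E y)"
    using x g A.spectral_proj_fun_calc(2)[OF \<rho> x(2), of g] by (simp add: R.h_mult[symmetric] R.h_smult)
  have "lhom D j (E x) * d j (fun_calc g \<rho>) * rhom D j (E y) =
     lhom D j (E x) * Vop D j * (rhom D j (fun_calc g \<rho>) * rhom D j (E y))
     - (lhom D j (E x) * lhom D j (fun_calc g \<rho>)) * (Vop D j * rhom D j (E y))"
    using x g V by (simp add: partial_def B.distribs B.mult_assoc)
  also have "\<dots> = complex_of_real (g y) \<cdot>\<^sub>m (lhom D j (E x) * Vop D j * rhom D j (E y))
     - complex_of_real (g x) \<cdot>\<^sub>m (lhom D j (E x) * Vop D j * rhom D j (E y))"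
    unfolding lx ry using x V by (simp add: B.smult_mult B.mult_assoc)
  also have "\<dots> = complex_of_real (g y - g x) \<cdot>\<^sub>m (lhom D j (E x) * Vop D j * rhom D j (E y))"
    using x V by (simp add: B.smult_diff_left)
  finally show ?thesis .
qed

text \<open>The non-commutative chain rule. Block by block, the weight converts the increments of \<open>g\<close> into those
  of \<open>h\<close>, so \<open>\<rho>\<close>-hat contracted with \<open>\<partial>\<^sub>j g(\<rho>)\<close> is \<open>\<partial>\<^sub>j h(\<rho>)\<close>.\<close>

lemma chain_rule:
  assumes "\<And>x y. x \<in> S \<Longrightarrow> y \<in> S \<Longrightarrow> th x y * (g y - g x) = h y - h x"
  shows "K (fun_calc g \<rho>) = Kop D (\<lambda>_ _ _. 1) \<rho> (fun_calc h \<rho>)"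
  unfolding Kop_def
proof (rule msum_cong[OF refl])
  fix j assume j: "j \<in> idx D"
  interpret B: tracial "tgt D j" by (rule tracial_tgt[OF j])
  have "hat j \<rho> (d j (fun_calc g \<rho>)) = rho_hat_contract D (\<lambda>_ _ _. 1) j \<rho> (d j (fun_calc h \<rho>))"
    unfolding hat_eq
  proof (rule msum_cong[OF refl])
    fix z assume "z \<in> S \<times> S"
    then have z: "fst z \<in> S" "snd z \<in> S" by auto
    show "complex_of_real (th (fst z) (snd z)) \<cdot>\<^sub>m (lhom D j (E (fst z)) * d j (fun_calc g \<rho>) * rhom D j (E (snd z))) =
      complex_of_real 1 \<cdot>\<^sub>m (lhom D j (E (fst z)) * d j (fun_calc h \<rho>) * rhom D j (E (snd z)))"
      unfolding partial_fun_calc_block[OF j z] B.smult_smult of_real_mult[symmetric] assms[OF z] by simp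
  qed
  then show "partial_adj D j (hat j \<rho> (d j (fun_calc g \<rho>))) =
    partial_adj D j (rho_hat_contract D (\<lambda>_ _ _. 1) j \<rho> (d j (fun_calc h \<rho>)))"
    by (rule arg_cong)
qed

end



section \<open>The generator and the tangent space\<close>

locale unit_weighted = weighted D \<rho> "\<lambda>_ _. 1" for D :: "'j differential_structure" and \<rho> +
  assumes sigma_one: "sigma D = 1\<^sub>m (tdim (alg D))"
begin

text \<open>For \<open>\<sigma> = 1\<close> the form that defines the generator is the Dirichlet form with constant weight, whatever
  \<open>\<rho>\<close> is used to write it.\<close>

lemma sum_tr_d:
  assumes X: "X \<in> ops (alg D)" "Y \<in> ops (alg D)"
  shows "(\<Sum>j\<in>idx D. tr (tgt D j)
     (mat_adjoint (d j X) * lhom D j (fun_calc sqrt (sigma D)) * d j Y * rhom D j (fun_calc sqrt (sigma D))))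
     = dirichlet X Y"
proof -
  have one: "fun_calc sqrt (sigma D) = A.\<I>"
    unfolding sigma_one by (rule A.fun_calc_one_matrix) simp
  show ?thesis
    unfolding one dirichlet_def
  proof (rule sum.cong[OF refl])
    fix j assume j: "j \<in> idx D"
    interpret B: tracial "tgt D j" by (rule tracial_tgt[OF j])
    interpret L: star_hom "alg D" "tgt D j" "lhom D j" by (rule star_hom_lr[OF j])
    interpret R: star_hom "alg D" "tgt D j" "rhom D j" by (rule star_hom_lr[OF j])
    have hat: "rho_hat_contract D (\<lambda>_ _ _. 1) j \<rho> (d j Y) = d j Y"
      using msum_blocks[OF j d_in[OF j X(2)]] by (simp only: hat_eq of_real_1 B.one_smult)
    have "tr (tgt D j) (mat_adjoint (d j X) * lhom D j A.\<I> * d j Y * rhom D j A.\<I>)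
      = tr (tgt D j) (mat_adjoint (d j X) * d j Y)"
      using d_in[OF j X(1)] d_in[OF j X(2)] by (simp add: L.h_one R.h_one)
    also have "\<dots> = (\<Sum>z\<in>S \<times> S. complex_of_real 1 * dirichlet_term j (E (fst z)) (E (snd z)) X Y)"
      using tr_hat[OF j X] by (simp only: hat)
    finally show "tr (tgt D j) (mat_adjoint (d j X) * lhom D j A.\<I> * d j Y * rhom D j A.\<I>)
      = (\<Sum>z\<in>S \<times> S. complex_of_real 1 * dirichlet_term j (E (fst z)) (E (snd z)) X Y)" .
  qed
qed

lemma generator_eq:
  assumes Y: "Y \<in> ops (alg D)"
  shows "generator D Y = - K Y"
  unfolding generator_def
proof (rule the_equality)
  have one: "fun_calc sqrt (sigma D) = A.\<I>"
    unfolding sigma_one by (rule A.fun_calc_one_matrix) simp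
  have tr1: "- tr (alg D) (mat_adjoint X * fun_calc sqrt (sigma D) * Z * fun_calc sqrt (sigma D))
     = - tr (alg D) (mat_adjoint X * Z)" if "X \<in> ops (alg D)" "Z \<in> ops (alg D)" for X Z
    unfolding one using that by simp
  show "- K Y \<in> ops (alg D) \<and> (\<forall>A1\<in>ops (alg D).
        (\<Sum>j\<in>idx D. tr (tgt D j) (mat_adjoint (d j A1) * lhom D j (fun_calc sqrt (sigma D)) *
            d j Y * rhom D j (fun_calc sqrt (sigma D)))) =
        - tr (alg D) (mat_adjoint A1 * fun_calc sqrt (sigma D) * - K Y * fun_calc sqrt (sigma D)))"
  proof (intro conjI ballI)
    show mK: "- K Y \<in> ops (alg D)" using K_in[OF Y] by simp
    fix X assume X: "X \<in> ops (alg D)"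
    have "dirichlet X Y = - tr (alg D) (mat_adjoint X * - K Y)"
      using X K_in[OF Y] tr_K[OF X Y] by (simp add: A.uminus_eq A.smult_mult A.tr_smult)
    then show "(\<Sum>j\<in>idx D. tr (tgt D j) (mat_adjoint (d j X) * lhom D j (fun_calc sqrt (sigma D)) *
            d j Y * rhom D j (fun_calc sqrt (sigma D)))) =
        - tr (alg D) (mat_adjoint X * fun_calc sqrt (sigma D) * - K Y * fun_calc sqrt (sigma D))"
      unfolding sum_tr_d[OF X Y] tr1[OF X mK] .
  qed
  fix Z assume Z: "Z \<in> ops (alg D) \<and> (\<forall>A1\<in>ops (alg D).
        (\<Sum>j\<in>idx D. tr (tgt D j) (mat_adjoint (d j A1) * lhom D j (fun_calc sqrt (sigma D)) *
            d j Y * rhom D j (fun_calc sqrt (sigma D)))) =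
        - tr (alg D) (mat_adjoint A1 * fun_calc sqrt (sigma D) * Z * fun_calc sqrt (sigma D)))"
  show "Z = - K Y"
  proof (rule A.inner_ext)
    show "Z \<in> ops (alg D)" using Z by blast
    show "- K Y \<in> ops (alg D)" using K_in[OF Y] by simp
    fix X assume X: "X \<in> ops (alg D)"
    have "dirichlet X Y = - tr (alg D) (mat_adjoint X * Z)"
      using bspec[OF conjunct2[OF Z] X] unfolding sum_tr_d[OF X Y] tr1[OF X conjunct1[OF Z]] .
    then show "tr (alg D) (mat_adjoint X * Z) = tr (alg D) (mat_adjoint X * - K Y)"
      using X K_in[OF Y] tr_K[OF X Y] by (simp add: A.uminus_eq A.smult_mult A.tr_smult)
  qed
qed

lemma generator_adj_eq:
  assumes Y: "Y \<in> ops (alg D)"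
  shows "generator_adj D Y = - K Y"
  unfolding generator_adj_def adj_op_def
proof (rule the_equality)
  have mK: "- K Y \<in> ops (alg D)" using K_in[OF Y] by simp
  have adj: "tr (alg D) (mat_adjoint (generator D X) * Y) = tr (alg D) (mat_adjoint X * - K Y)"
    if X: "X \<in> ops (alg D)" for X
  proof -
    have "tr (alg D) (mat_adjoint (generator D X) * Y) = cnj (tr (alg D) (mat_adjoint Y * - K X))"
      unfolding generator_eq[OF X] using K_in[OF X] Y by (intro A.inner_commute) simp_all
    also have "\<dots> = - cnj (dirichlet Y X)"
      using K_in[OF X] Y tr_K[OF Y X] by (simp add: A.uminus_eq A.smult_mult A.tr_smult)
    also have "\<dots> = - dirichlet X Y" using dirichlet_hermitian[OF X Y] by simp
    also have "\<dots> = tr (alg D) (mat_adjoint X * - K Y)"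
      using K_in[OF Y] X tr_K[OF X Y] by (simp add: A.uminus_eq A.smult_mult A.tr_smult)
    finally show ?thesis .
  qed
  then show "- K Y \<in> ops (alg D) \<and> (\<forall>A\<in>ops (alg D).
      tr (alg D) (mat_adjoint (generator D A) * Y) = tr (alg D) (mat_adjoint A * - K Y))"
    using mK by blast
  fix Z assume Z: "Z \<in> ops (alg D) \<and> (\<forall>A\<in>ops (alg D).
      tr (alg D) (mat_adjoint (generator D A) * Y) = tr (alg D) (mat_adjoint A * Z))"
  show "Z = - K Y"
    by (rule A.inner_ext) (use Z mK adj in simp_all)
qed

text \<open>The range of a self-adjoint operator is the orthogonal complement of its kernel.\<close>

lemma tangent_space_eq: "tangent_space D = null_perp"
proof (intro equalityI subsetI)
  fix Y assume "Y \<in> tangent_space D"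
  then obtain X where X: "X \<in> ops (alg D)" "Y = - K X" and Y: "Y \<in> A.\<H>"
    by (auto simp: tangent_space_def generator_adj_eq)
  have "perp (- K X)"
    using K_perp[of "- X"] X(1) by (simp add: K_uminus)
  then show "Y \<in> null_perp" using X(2) Y by (simp add: null_perp_def)
next
  fix Y assume Y: "Y \<in> null_perp"
  then obtain X where X: "X \<in> null_perp" "K X = Y" using K_surj by blast
  have XA: "X \<in> ops (alg D)" using X(1) by (simp add: null_perp_def perp_def)
  have mX: "- X \<in> ops (alg D)" using XA by simp
  moreover have "generator_adj D (- X) = Y"
    unfolding generator_adj_eq[OF mX] K_uminus[OF XA] X(2) by (rule eq_matI) simp_all
  moreover have "Y \<in> A.\<H>" using Y by (simp add: null_perp_def)
  ultimately show "Y \<in> tangent_space D" unfolding tangent_space_def by blast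
qed

end

context weighted begin

section \<open>Gradient and gradient flow\<close>

text \<open>The differential \<open>X\<close> need not be tangent. There is however a tangent \<open>a\<close> with \<open>K\<^sub>\<rho> a = K\<^sub>\<rho> X\<close>, and
  \<open>X - a\<close> lies in the null space, to which all tangent vectors are orthogonal; hence \<open>a\<close> and \<open>X\<close> pair
  alike with them.\<close>

lemma riem_gradient_eq:
  assumes tan: "tangent_space D = null_perp"
    and dF: "differential D F \<rho> \<in> A.\<H>"
  shows "riem_gradient D (\<lambda>_. th) F \<rho> = K (differential D F \<rho>)"
proof -
  define X where "X = differential D F \<rho>"
  have X: "X \<in> A.\<H>" using dF by (simp only: X_def)
  then have XA: "X \<in> ops (alg D)" by (rule A.selfadjD(1))
  have inv: "the_inv_into null_perp K (K a) = a" if "a \<in> null_perp" for a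
    using the_inv_into_f_f[OF K_inj_on that] .
  have met: "riem_metric D (\<lambda>_. th) \<rho> (K a) y = tr (alg D) (a * y)" if "a \<in> null_perp" for a y
    unfolding riem_metric_def tan using inv[OF that] by simp
  obtain a where a: "a \<in> null_perp" "K a = K X" using K_surj[OF K_null_perp[OF X]] by blast
  have np: "y \<in> ops (alg D)" "mat_adjoint y = y" "perp y" if "y \<in> null_perp" for y
    using that A.selfadjD by (auto simp: null_perp_def)
  have aX: "tr (alg D) (a * y) = tr (alg D) (X * y)" if y: "y \<in> null_perp" for y
  proof -
    have "X - a \<in> nullspace" using K_null_diff[OF XA np(1)[OF a(1)]] a(2) by simp
    then have "tr (alg D) (mat_adjoint (X - a) * y) = 0" using np(3)[OF y] by (simp add: perp_def)
    then have "tr (alg D) ((X - a) * y) = 0"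
      using XA np(1)[OF a(1)] np(2)[OF a(1)] A.selfadjD(2)[OF X] by (simp add: A.adj_simps)
    then show ?thesis using XA np(1)[OF a(1)] np(1)[OF y] by (simp add: A.distribs A.tr_simps)
  qed
  have "riem_gradient D (\<lambda>_. th) F \<rho> = K X"
    unfolding riem_gradient_def tan X_def[symmetric]
  proof (rule the_equality)
    show "K X \<in> null_perp \<and> (\<forall>y\<in>null_perp. riem_metric D (\<lambda>_. th) \<rho> (K X) y = tr (alg D) (X * y))"
      using K_null_perp[OF X] met[OF a(1)] aX by (simp only: a(2)) blast
    fix G assume G: "G \<in> null_perp \<and> (\<forall>y\<in>null_perp. riem_metric D (\<lambda>_. th) \<rho> G y = tr (alg D) (X * y))"
    then obtain c where c: "c \<in> null_perp" "K c = G" using K_surj by blast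
    have cy: "tr (alg D) (c * y) = tr (alg D) (a * y)" if "y \<in> null_perp" for y
      using met[OF c(1), of y] G aX[OF that] that unfolding c(2) by simp
    note m = np[OF c(1)] np[OF a(1)]
    have ca: "c - a \<in> ops (alg D)" "mat_adjoint (c - a) = c - a"
      using m by (simp_all add: A.adj_simps)
    have "c - a \<in> null_perp"
      using ca perp_minus[OF m(3) m(6)] by (simp add: null_perp_def A.selfadjI)
    from cy[OF this] have "tr (alg D) (mat_adjoint (c - a) * (c - a)) = 0"
      using m ca by (simp only: ca(2) A.distribs(3)[OF m(1) m(4) ca(1)]) (simp add: A.tr_minus)
    then have "c - a = A.\<O>" by (rule A.tr_faithful[OF ca(1)])
    then have "c = a" by (rule A.diff_zero_eq[OF m(1) m(4)])
    then show "G = K X" using c(2) a(2) by simp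
  qed
  then show ?thesis by (simp only: X_def)
qed

end

lemma (in diff_struct) differential_entropy:
  assumes f: "f C1_differentiable_on {0<..}" "deriv f C1_differentiable_on {0<..}"
    and \<rho>: "\<rho> \<in> A.\<H>" "\<And>x. x \<in> spectral_values \<rho> \<Longrightarrow> x > 0"
  shows "differential D (entropy_functional D f) \<rho> = fun_calc (deriv f) \<rho>"
  unfolding differential_def entropy_functional_def
proof (rule the_equality)
  have der: "((\<lambda>t. tr (alg D) (fun_calc f (\<rho> + complex_of_real t \<cdot>\<^sub>m X))) has_vector_derivative
      tr (alg D) (fun_calc (deriv f) \<rho> * X)) (at 0)" if "X \<in> A.\<H>" for X
    by (rule A.tr_fun_calc_has_derivative[OF f \<rho>(1) _ that]) (rule \<rho>(2))
  note sa = A.fun_calc_selfadj[OF \<rho>(1), of "deriv f"]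
  show "fun_calc (deriv f) \<rho> \<in> A.\<H> \<and> (\<forall>X\<in>A.\<H>.
     ((\<lambda>t. tr (alg D) (fun_calc f (\<rho> + complex_of_real t \<cdot>\<^sub>m X))) has_vector_derivative
       tr (alg D) (fun_calc (deriv f) \<rho> * X)) (at 0))"
    using sa der by blast
  fix Z assume Z: "Z \<in> A.\<H> \<and> (\<forall>X\<in>A.\<H>.
     ((\<lambda>t. tr (alg D) (fun_calc f (\<rho> + complex_of_real t \<cdot>\<^sub>m X))) has_vector_derivative
       tr (alg D) (Z * X)) (at 0))"
  let ?Y = "fun_calc (deriv f) \<rho>"
  have eq: "tr (alg D) (Z * X) = tr (alg D) (?Y * X)" if "X \<in> A.\<H>" for X
    by (rule vector_derivative_unique_at[OF bspec[OF conjunct2[OF Z] that] der[OF that]])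
  have C: "Z - ?Y \<in> A.\<H>" using Z sa by (intro A.selfadj_minus) blast+
  have m: "Z \<in> ops (alg D)" "?Y \<in> ops (alg D)" "Z - ?Y \<in> ops (alg D)"
    using Z sa C A.selfadjD(1) by blast+
  have "tr (alg D) (mat_adjoint (Z - ?Y) * (Z - ?Y)) = 0"
    using eq[OF C] m by (simp only: A.selfadjD(2)[OF C] A.distribs(3)[OF m(1,2,3)]) (simp add: A.tr_minus)
  then have "Z - ?Y = A.\<O>" by (rule A.tr_faithful[OF m(3)])
  then show "Z = ?Y" by (rule A.diff_zero_eq[OF m(1,2)])
qed

lemma theta_sym: "theta f \<phi> x y = theta f \<phi> y x"
  unfolding theta_def using minus_divide_divide[of "\<phi> x - \<phi> y" "deriv f x - deriv f y"] by simp

lemma theta_mult_diff: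
  assumes "x \<noteq> y \<Longrightarrow> deriv f x \<noteq> deriv f y"
  shows "theta f \<phi> x y * (deriv f y - deriv f x) = \<phi> y - \<phi> x"
proof (cases "x = y")
  case False
  define c where "c = deriv f x - deriv f y"
  have c: "c \<noteq> 0" using assms[OF False] by (simp add: c_def)
  have t: "theta f \<phi> x y = (\<phi> x - \<phi> y) / c" using False by (simp add: theta_def c_def)
  have "deriv f y - deriv f x = - c" by (simp add: c_def)
  then show ?thesis using c by (simp add: t)
qed simp

theorem theorem7p9:
  fixes D :: "'j differential_structure"
    and f \<phi> :: "real \<Rightarrow> real"
  assumes "is_differential_structure D"
    and "sigma D = 1\<^sub>m (tdim (alg D))"
    and "f C1_differentiable_on {0<..}" and "deriv f C1_differentiable_on {0<..}"
    and "strictly_convex_on {0<..} f"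
    and "\<phi> C1_differentiable_on {0<..}"
    and "strict_mono_on {0<..} \<phi>"
    and "\<forall>x>0. \<forall>y>0. x \<noteq> y \<longrightarrow> deriv f x \<noteq> deriv f y" and "\<forall>x>0. deriv (deriv f) x \<noteq> 0"
    and "Cinfinity_on ({0<..} \<times> {0<..}) (\<lambda>(x, y). theta f \<phi> x y)"
    and "\<forall>x>0. \<forall>y>0. theta f \<phi> x y > 0"
    and "\<exists>g. continuous_on ({0..} \<times> {0..}) g \<and> (\<forall>x>0. \<forall>y>0. g (x, y) = theta f \<phi> x y)"
  shows "(\<forall>\<rho>\<in>pos_states (alg D).
            generator D (fun_calc \<phi> \<rho>) = generator_adj D (fun_calc \<phi> \<rho>) \<and>
            generator_adj D (fun_calc \<phi> \<rho>) =
              - Kop D (\<lambda>_. theta f \<phi>) \<rho> (differential D (entropy_functional D f) \<rho>))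
       \<and> (\<forall>\<rho>\<in>M_one D.
            riem_gradient D (\<lambda>_. theta f \<phi>) (entropy_functional D f) \<rho> =
              Kop D (\<lambda>_. theta f \<phi>) \<rho> (differential D (entropy_functional D f) \<rho>))
       \<and> (\<forall>I \<rho>. is_interval I \<longrightarrow>
            (gradient_flow D (\<lambda>_. theta f \<phi>) (entropy_functional D f) I \<rho> \<longleftrightarrow>
             solves_flow D (\<lambda>X. generator D (fun_calc \<phi> X)) I \<rho>))"
proof -
  interpret diff_struct D by unfold_locales (rule assms(1))
  \<comment> \<open>Everything at a fixed state follows from the chain rule with \<open>g = f'\<close> and \<open>h = \<phi>\<close>.\<close>
  have at_state: "generator D (fun_calc \<phi> \<rho>) = generator_adj D (fun_calc \<phi> \<rho>) \<and>
      generator_adj D (fun_calc \<phi> \<rho>) =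
        - Kop D (\<lambda>_. theta f \<phi>) \<rho> (differential D (entropy_functional D f) \<rho>) \<and>
      riem_gradient D (\<lambda>_. theta f \<phi>) (entropy_functional D f) \<rho> =
        Kop D (\<lambda>_. theta f \<phi>) \<rho> (differential D (entropy_functional D f) \<rho>)"
    if "\<rho> \<in> pos_states (alg D)" for \<rho>
  proof -
    have \<rho>A: "\<rho> \<in> ops (alg D)" "pos_def_mat \<rho>" using that by (simp_all add: pos_states_def)
    then have \<rho>: "\<rho> \<in> A.\<H>" by (simp add: pos_def_mat_def A.selfadjI)
    have pos: "x > 0" if "x \<in> spectral_values \<rho>" for x
      by (rule A.pos_def_spectral_values[OF \<rho>A that])
    interpret W: weighted D \<rho> "theta f \<phi>"
    proof unfold_locales
      show "theta f \<phi> x y = theta f \<phi> y x" for x y by (rule theta_sym)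
      show "0 < theta f \<phi> x y" if "x \<in> spectral_values \<rho>" "y \<in> spectral_values \<rho>" for x y
        using assms(11) pos that by blast
    qed (rule \<rho>)
    interpret U: unit_weighted D \<rho>
      by unfold_locales (simp_all add: \<rho> assms(2))
    have dF: "differential D (entropy_functional D f) \<rho> = fun_calc (deriv f) \<rho>"
      by (rule differential_entropy[OF assms(3,4) \<rho> pos])
    have \<phi>A: "fun_calc \<phi> \<rho> \<in> ops (alg D)" by (rule A.fun_calc_in[OF \<rho>])
    have K: "Kop D (\<lambda>_. theta f \<phi>) \<rho> (fun_calc (deriv f) \<rho>) = Kop D (\<lambda>_ _ _. 1) \<rho> (fun_calc \<phi> \<rho>)"
      by (rule W.chain_rule, rule theta_mult_diff) (use assms(8) pos in blast)
    have "riem_gradient D (\<lambda>_. theta f \<phi>) (entropy_functional D f) \<rho> =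
        Kop D (\<lambda>_. theta f \<phi>) \<rho> (differential D (entropy_functional D f) \<rho>)"
      by (rule W.riem_gradient_eq[OF U.tangent_space_eq]) (simp only: dF A.fun_calc_selfadj[OF \<rho>])
    then show ?thesis
      unfolding dF K U.generator_eq[OF \<phi>A] U.generator_adj_eq[OF \<phi>A] by blast
  qed
  have M_one_states: "\<rho> \<in> pos_states (alg D)" if "\<rho> \<in> M_one D" for \<rho>
    using that by (simp add: M_one_def)
  have "- riem_gradient D (\<lambda>_. theta f \<phi>) (entropy_functional D f) \<rho> = generator D (fun_calc \<phi> \<rho>)"
    if "\<rho> \<in> M_one D" for \<rho>
    using at_state[OF M_one_states[OF that]] by simp
  then have "gradient_flow D (\<lambda>_. theta f \<phi>) (entropy_functional D f) I \<rho> \<longleftrightarrow>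
     solves_flow D (\<lambda>X. generator D (fun_calc \<phi> X)) I \<rho>" for I \<rho>
    unfolding gradient_flow_def solves_flow_def by (metis (no_types, lifting))
  then show ?thesis using at_state M_one_states by blast
qed

end
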